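(* Let $f:\mathbb{A}\to\mathbb{A}$ be a $C^{1+\alpha}$ positive symplectic twist map, let $\gamma\subset\mathbb{A}$ be an essential irrational invariant curve for $f$, and let $\mu$ be the unique $f$-invariant Borel probability measure supported in $\gamma$. Then the Lyapunov exponents of $\mu$ are zero.
   Context: $\mathbb{T}=\mathbb{R}/\mathbb{Z}$; $\mathbb{A}=\mathbb{T}\times\mathbb{R}$ is the annulus with points $x=(\theta,r)$, endowed with the symplectic form $\omega=d\theta\wedge dr$ and the usual Riemannian metric; $\pi:\mathbb{A}\to\mathbb{T}$ is the first projection. A positive symplectic twist map is a $C^1$ diffeomorphism $f:\mathbb{A}\to\mathbb{A}$, isotopic to the identity, with $f^*\omega=\omega$, for which there exists $\varepsilon>0$ such that $D(\pi\circ f)(x)(0,1)>\varepsilon$ for every $x\in\mathbb{A}$. $C^{1+\alpha}$ means $C^1$ with (locally) $\alpha$-Hölder derivative, for some $\alpha>0$. An essential curve is a simple loop in $\mathbb{A}$ that is not homotopic to a point. By a theorem of Birkhoff, every essential curve invariant by a symplectic twist map is the graph of a Lipschitz map $\mathbb{T}\to\mathbb{R}$. Projecting the restricted dynamics to $\mathbb{T}$ by $\pi$ gives an orientation-preserving circle homeomorphism; the curve is called irrational if the rotation number of this homeomorphism is irrational, and then the restricted dynamics is uniquely ergodic. *)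

theory Defs
  imports "HOL-Probability.Probability"
begin

section \<open>The circle \<open>\<real>/\<int>\<close> and the annulus\<close>

quotient_type circle = real / "\<lambda>x y. x - y \<in> \<int>"
proof (rule equivpI)
  show "reflp (\<lambda>x y::real. x - y \<in> \<int>)"
    by (simp add: reflp_def)
  show "symp (\<lambda>x y::real. x - y \<in> \<int>)"
  proof (rule sympI)
    fix x y :: real
    assume "x - y \<in> \<int>"
    then have "- (x - y) \<in> \<int>" by (rule Ints_minus)
    then show "y - x \<in> \<int>" by simp
  qed
  show "transp (\<lambda>x y::real. x - y \<in> \<int>)"
  proof (rule transpI)
    fix x y z :: real
    assume "x - y \<in> \<int>" "y - z \<in> \<int>"
    then have "(x - y) + (y - z) \<in> \<int>" by (rule Ints_add)
    then show "x - z \<in> \<int>" by simp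
  qed
qed

lift_definition to_circle :: "real \<Rightarrow> circle" is "\<lambda>x. x" .

lemma to_circle_eq_iff: "to_circle x = to_circle y \<longleftrightarrow> x - y \<in> \<int>"
  by transfer simp

lemma to_circle_cases: obtains x where "c = to_circle x"
  by transfer simp

lemma infdist_Ints_add: "n \<in> \<int> \<Longrightarrow> infdist (x + n) \<int> = infdist (x::real) \<int>"
proof -
  have le: "infdist (x + n) \<int> \<le> infdist x \<int>" if n: "n \<in> \<int>" for x n :: real
  proof -
    have "infdist (x + n) \<int> \<le> dist x m" if "m \<in> \<int>" for m
    proof -
      have "infdist (x + n) \<int> \<le> dist (x + n) (m + n)"
        using n that by (intro infdist_le) auto
      then show ?thesis by (simp add: dist_real_def)
    qed
    moreover have "(\<int>::real set) \<noteq> {}" by auto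
    ultimately show ?thesis
      unfolding infdist_def[of x] by (auto intro!: cINF_greatest)
  qed
  assume "n \<in> \<int>"
  then show ?thesis
    using le[of n x] le[of "-n" "x + n"] by auto
qed

lemma infdist_Ints_attained:
  obtains n where "n \<in> \<int>" "infdist (x::real) \<int> = \<bar>x - n\<bar>"
proof -
  have "closed (\<int>::real set)" "(\<int>::real set) \<noteq> {}" by auto
  from infdist_attains_inf[OF this, of x] show ?thesis
    using that by (auto simp: dist_real_def)
qed

text \<open>The quotient (flat Riemannian) distance.\<close>

instantiation circle :: metric_space
begin

lift_definition dist_circle :: "circle \<Rightarrow> circle \<Rightarrow> real"
  is "\<lambda>x y. infdist (x - y) \<int>"
proof -
  fix a a' b b' :: real
  assume "a - a' \<in> \<int>" "b - b' \<in> \<int>"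
  then have "(a - a') - (b - b') \<in> \<int>" by (rule Ints_diff)
  from infdist_Ints_add[OF this, of "a' - b'"]
  show "infdist (a - b) \<int> = infdist (a' - b') \<int>" by simp
qed

definition uniformity_circle :: "(circle \<times> circle) filter"
  where "uniformity_circle = (INF e\<in>{0<..}. principal {(x, y). dist x y < e})"

definition open_circle :: "circle set \<Rightarrow> bool"
  where "open_circle U \<longleftrightarrow> (\<forall>x\<in>U. \<forall>\<^sub>F (x', y) in uniformity. x' = x \<longrightarrow> y \<in> U)"

instance
proof
  fix x y z :: circle
  show "dist x y = 0 \<longleftrightarrow> x = y"
  proof transfer
    fix x y :: real
    have "closed (\<int>::real set)" "(\<int>::real set) \<noteq> {}" by auto
    then show "infdist (x - y) \<int> = 0 \<longleftrightarrow> x - y \<in> \<int>"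
      using in_closed_iff_infdist_zero by blast
  qed
  show "dist x y \<le> dist x z + dist y z"
  proof transfer
    fix x y z :: real
    obtain m where m: "m \<in> \<int>" "infdist (x - z) \<int> = \<bar>x - z - m\<bar>"
      by (rule infdist_Ints_attained)
    obtain n where n: "n \<in> \<int>" "infdist (y - z) \<int> = \<bar>y - z - n\<bar>"
      by (rule infdist_Ints_attained)
    have "infdist (x - y) \<int> \<le> dist (x - y) (m - n)"
      using m n by (intro infdist_le) auto
    also have "\<dots> \<le> \<bar>x - z - m\<bar> + \<bar>y - z - n\<bar>"
      by (simp add: dist_real_def)
    finally show "infdist (x - y) \<int> \<le> infdist (x - z) \<int> + infdist (y - z) \<int>"
      using m n by simp
  qed
qed (simp_all only: uniformity_circle_def open_circle_def)

end

lemma dist_to_circle: "dist (to_circle x) (to_circle y) = infdist (x - y) \<int>"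
  by transfer simp

text \<open>The topology induced by this distance is the quotient topology.\<close>

lemma continuous_on_to_circle: "continuous_on UNIV to_circle"
proof (rule continuous_on_iff[THEN iffD2], intro ballI allI impI)
  fix x e :: real
  assume "e > 0"
  moreover have "dist (to_circle y) (to_circle x) \<le> dist y x" for y
    using infdist_le[of 0 \<int> "y - x"] by (simp add: dist_to_circle dist_real_def)
  ultimately show "\<exists>d>0. \<forall>y\<in>UNIV. dist y x < d \<longrightarrow> dist (to_circle y) (to_circle x) < e"
    by (meson le_less_trans)
qed

lemma open_circle_iff: "open U \<longleftrightarrow> open (to_circle -` U)"
proof
  assume "open U"
  then show "open (to_circle -` U)"
    using continuous_on_to_circle by (simp add: continuous_on_open_vimage)
next
  assume U: "open (to_circle -` U)"
  show "open U"
    unfolding open_dist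
  proof
    fix c assume "c \<in> U"
    obtain x where x: "c = to_circle x" by (rule to_circle_cases)
    with U \<open>c \<in> U\<close> obtain e where e: "e > 0" "\<And>y. dist y x < e \<Longrightarrow> to_circle y \<in> U"
      unfolding open_dist by auto
    have "d \<in> U" if d: "dist d c < e" for d
    proof -
      obtain y where y: "d = to_circle y" by (rule to_circle_cases)
      obtain n where n: "n \<in> \<int>" "infdist (y - x) \<int> = \<bar>y - x - n\<bar>"
        by (rule infdist_Ints_attained)
      have "dist (y - n) x < e"
        using d n by (simp add: x y dist_to_circle dist_real_def algebra_simps)
      then have "to_circle (y - n) \<in> U" by (rule e)
      moreover have "to_circle (y - n) = to_circle y"
        using n by (simp add: to_circle_eq_iff)
      ultimately show ?thesis by (simp add: y)
    qed
    with e show "\<exists>e>0. \<forall>y. dist y c < e \<longrightarrow> y \<in> U" by blast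
  qed
qed

type_synonym annulus = "circle \<times> real"

definition to_annulus :: "real \<times> real \<Rightarrow> annulus"
  where "to_annulus z = (to_circle (fst z), snd z)"


section \<open>Differential calculus on the annulus\<close>

text \<open>
  All tangent spaces of the annulus are identified with \<open>\<real> \<times> \<real>\<close> through the coordinates
  \<open>(\<theta>, r)\<close>.  The derivative of \<open>f\<close> at \<open>x\<close> is the derivative at \<open>z\<close> of a local lift \<open>F\<close> of \<open>f\<close>
  to the universal cover, for a point \<open>z\<close> above \<open>x\<close>; it does not depend on the choice of \<open>z\<close>
  and \<open>F\<close>, see \<open>has_annulus_derivative_unique\<close>.
\<close>

definition has_annulus_derivative ::
    "(annulus \<Rightarrow> annulus) \<Rightarrow> ((real \<times> real) \<Rightarrow>\<^sub>L (real \<times> real)) \<Rightarrow> annulus \<Rightarrow> bool"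
  where "has_annulus_derivative f D x \<longleftrightarrow>
    (\<exists>z F. to_annulus z = x \<and>
      (\<forall>\<^sub>F w in nhds z. to_annulus (F w) = f (to_annulus w)) \<and>
      (F has_derivative blinfun_apply D) (at z))"

definition annulus_deriv :: "(annulus \<Rightarrow> annulus) \<Rightarrow> annulus \<Rightarrow> (real \<times> real) \<Rightarrow>\<^sub>L (real \<times> real)"
  where "annulus_deriv f x = (THE D. has_annulus_derivative f D x)"

lemma to_annulus_eq_iff:
  "to_annulus z = to_annulus w \<longleftrightarrow> fst z - fst w \<in> \<int> \<and> snd z = snd w"
  by (simp add: to_annulus_def to_circle_eq_iff)

lemma has_annulus_derivative_unique:
  assumes "has_annulus_derivative f D x" "has_annulus_derivative f D' x"
  shows "D = D'"
proof -
  obtain z F where F: "to_annulus z = x" "(F has_derivative blinfun_apply D) (at z)"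
      "\<forall>\<^sub>F w in nhds z. to_annulus (F w) = f (to_annulus w)"
    using assms(1) unfolding has_annulus_derivative_def by blast
  obtain z' G where G: "to_annulus z' = x" "(G has_derivative blinfun_apply D') (at z')"
      "\<forall>\<^sub>F w in nhds z'. to_annulus (G w) = f (to_annulus w)"
    using assms(2) unfolding has_annulus_derivative_def by blast
  define k where "k = z' - z"
  have k: "fst k \<in> \<int>" "snd k = 0"
    using F(1) G(1) to_annulus_eq_iff[of z' z] by (auto simp: k_def)
  have per: "to_annulus (w + k) = to_annulus w" for w
    using k by (simp add: to_annulus_eq_iff)
  have lim: "((\<lambda>w. w + k) \<longlongrightarrow> z') (nhds z)"
    unfolding k_def by (rule tendsto_eq_intros filterlim_ident | simp)+
  define H where "H = (\<lambda>w. F w - G (w + k))"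
  have G2: "\<forall>\<^sub>F w in nhds z. to_annulus (G (w + k)) = f (to_annulus w)"
    using G(3) lim unfolding filterlim_iff by (auto simp: per)
  have Gd: "((\<lambda>w. G (w + k)) has_derivative blinfun_apply D') (at z)"
  proof -
    have "((\<lambda>w. w + k) has_derivative (\<lambda>h. h)) (at z)"
      by (auto intro!: derivative_eq_intros)
    moreover have "(G has_derivative blinfun_apply D') (at (z + k))"
      using G(2) by (simp add: k_def)
    ultimately show ?thesis
      using has_derivative_compose[of "\<lambda>w. w + k" "\<lambda>h. h" z UNIV G "blinfun_apply D'"] by simp
  qed
  have Hd: "(H has_derivative (\<lambda>v. D v - D' v)) (at z)"
    unfolding H_def by (intro has_derivative_diff F Gd)
  have Hint: "\<forall>\<^sub>F w in nhds z. fst (H w) \<in> \<int> \<and> snd (H w) = 0"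
    using F(3) G2
  proof eventually_elim
    case (elim w)
    then have "to_annulus (F w) = to_annulus (G (w + k))" by simp
    then show ?case by (simp add: H_def to_annulus_eq_iff)
  qed
  have "isCont H z" using Hd by (rule has_derivative_continuous)
  then have "(H \<longlongrightarrow> H z) (nhds z)"
    by (simp add: isCont_def tendsto_at_iff_tendsto_nhds)
  then have "\<forall>\<^sub>F w in nhds z. dist (H w) (H z) < 1"
    by (rule tendstoD) simp
  then have "\<forall>\<^sub>F w in nhds z. H w = H z"
    using Hint
  proof eventually_elim
    case (elim w)
    have "fst (H z) \<in> \<int>" "snd (H z) = 0"
      using eventually_nhds_x_imp_x[OF Hint] by auto
    moreover have "\<bar>fst (H w) - fst (H z)\<bar> < 1"
      using elim(1) dist_fst_le[of "H w" "H z"] by (simp add: dist_real_def)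
    ultimately have "fst (H w) = fst (H z)" "snd (H w) = snd (H z)"
      using elim(2) Ints_eq_abs_less1[of "fst (H w)" "fst (H z)"] by simp_all
    then show ?case by (rule prod_eqI)
  qed
  then have "\<forall>\<^sub>F w in at z. H w = H z"
    by (simp add: eventually_nhds_conv_at)
  then have "(H has_derivative (\<lambda>_. 0)) (at z)"
    by (intro has_derivative_transform_eventually[OF has_derivative_const[of "H z"]])
      (auto elim: eventually_mono)
  with Hd have "(\<lambda>v. D v - D' v) = (\<lambda>_. 0)"
    by (rule has_derivative_unique)
  then show ?thesis
    by (intro blinfun_eqI) (metis eq_iff_diff_eq_0)
qed

lemma annulus_deriv_eqI: "has_annulus_derivative f D x \<Longrightarrow> annulus_deriv f x = D"
  unfolding annulus_deriv_def by (blast intro: has_annulus_derivative_unique)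

definition C1_annulus :: "(annulus \<Rightarrow> annulus) \<Rightarrow> bool"
  where "C1_annulus f \<longleftrightarrow>
    (\<forall>x. \<exists>D. has_annulus_derivative f D x) \<and> continuous_on UNIV (annulus_deriv f)"

definition C1_diffeo :: "(annulus \<Rightarrow> annulus) \<Rightarrow> bool"
  where "C1_diffeo f \<longleftrightarrow> bij f \<and> C1_annulus f \<and> C1_annulus (inv f)"

definition locally_Holder :: "real \<Rightarrow> ('a::metric_space \<Rightarrow> 'b::metric_space) \<Rightarrow> bool"
  where "locally_Holder \<alpha> g \<longleftrightarrow>
    (\<forall>x. \<exists>U C. open U \<and> x \<in> U \<and> (\<forall>y\<in>U. \<forall>z\<in>U. dist (g y) (g z) \<le> C * dist y z powr \<alpha>))"

definition C1_Holder :: "(annulus \<Rightarrow> annulus) \<Rightarrow> bool"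
  where "C1_Holder f \<longleftrightarrow> C1_annulus f \<and> (\<exists>\<alpha>>0. locally_Holder \<alpha> (annulus_deriv f))"


section \<open>Twist maps\<close>

text \<open>The symplectic form \<open>d\<theta> \<and> dr\<close>.\<close>

definition sympl_form :: "real \<times> real \<Rightarrow> real \<times> real \<Rightarrow> real"
  where "sympl_form u v = fst u * snd v - snd u * fst v"

definition symplectic :: "(annulus \<Rightarrow> annulus) \<Rightarrow> bool"
  where "symplectic f \<longleftrightarrow>
    (\<forall>x u v. sympl_form (annulus_deriv f x u) (annulus_deriv f x v) = sympl_form u v)"

definition isotopic_to_id :: "(annulus \<Rightarrow> annulus) \<Rightarrow> bool"
  where "isotopic_to_id f \<longleftrightarrow>
    homotopic_with (homeomorphic_map euclidean euclidean) euclidean euclidean id f"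

text \<open>The derivative of the first projection is \<open>fst\<close> in the coordinates \<open>(\<theta>, r)\<close>.\<close>

definition positive_symplectic_twist_map :: "(annulus \<Rightarrow> annulus) \<Rightarrow> bool"
  where "positive_symplectic_twist_map f \<longleftrightarrow>
    C1_diffeo f \<and> isotopic_to_id f \<and> symplectic f \<and>
    (\<exists>\<epsilon>>0. \<forall>x. fst (annulus_deriv f x (0, 1)) > \<epsilon>)"


section \<open>Irrational invariant curves\<close>

definition essential_curve :: "annulus set \<Rightarrow> bool"
  where "essential_curve \<gamma> \<longleftrightarrow>
    (\<exists>g. simple_path g \<and> pathfinish g = pathstart g \<and>
         \<not> (\<exists>a. homotopic_loops UNIV g (\<lambda>_. a)) \<and> \<gamma> = path_image g)"

definition circle_lift :: "(circle \<Rightarrow> circle) \<Rightarrow> (real \<Rightarrow> real) \<Rightarrow> bool"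
  where "circle_lift h H \<longleftrightarrow>
    continuous_on UNIV H \<and> (\<forall>t. to_circle (H t) = h (to_circle t))"

definition orientation_preserving_homeo :: "(circle \<Rightarrow> circle) \<Rightarrow> bool"
  where "orientation_preserving_homeo h \<longleftrightarrow>
    (\<exists>g. homeomorphism UNIV UNIV h g) \<and> (\<exists>H. circle_lift h H \<and> strict_mono H)"

text \<open>
  The rotation number is a class modulo \<open>\<int>\<close>: \<open>\<rho>\<close> ranges over its representatives, one for
  each lift \<open>H\<close> up to translation by an integer.
\<close>

definition has_rotation_number :: "(circle \<Rightarrow> circle) \<Rightarrow> real \<Rightarrow> bool"
  where "has_rotation_number h \<rho> \<longleftrightarrow>
    (\<exists>H. circle_lift h H \<and> (\<forall>t. (\<lambda>n. (H ^^ n) t / real n) \<longlonglongrightarrow> \<rho>))"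

text \<open>\<open>h\<close> is the circle homeomorphism obtained by projecting the restriction of \<open>f\<close> to \<open>\<gamma>\<close>.\<close>

definition irrational_curve :: "(annulus \<Rightarrow> annulus) \<Rightarrow> annulus set \<Rightarrow> bool"
  where "irrational_curve f \<gamma> \<longleftrightarrow>
    (\<exists>h \<rho>. (\<forall>x\<in>\<gamma>. h (fst x) = fst (f x)) \<and> orientation_preserving_homeo h \<and>
           has_rotation_number h \<rho> \<and> \<rho> \<notin> \<rat>)"


section \<open>Lyapunov exponents\<close>

text \<open>The exponent \<open>l\<close> is two-sided, as in Oseledets' theorem for invertible dynamics.\<close>

definition has_lyapunov_exponent ::
    "(annulus \<Rightarrow> annulus) \<Rightarrow> annulus \<Rightarrow> real \<times> real \<Rightarrow> real \<Rightarrow> bool"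
  where "has_lyapunov_exponent f x v l \<longleftrightarrow>
    (\<lambda>n. ln (norm (annulus_deriv (f ^^ n) x v)) / real n) \<longlonglongrightarrow> l \<and>
    (\<lambda>n. ln (norm (annulus_deriv (inv f ^^ n) x v)) / real n) \<longlonglongrightarrow> - l"

end

theory Submission
  imports Defs
begin

text \<open>
  Let \<open>P\<^sub>n\<close> be the derivative cocycle along the curve and suppose that \<open>sup \<parallel>P\<^sub>n\<parallel>\<close> grows at an
  exponential rate \<open>\<nu> > 0\<close>.  Along a long orbit segment that almost realises this rate most times
  are not slow: all segments of bounded length that start or end there grow at a rate close to \<open>\<nu>\<close>.
  If the times \<open>i - n\<close> and \<open>i + n\<close> are not slow, then at time \<open>i\<close> there is a basis of one vector
  expanded up to time \<open>i + n\<close> and one expanded backwards up to time \<open>i - n\<close>.  By the intermediate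
  value theorem the curve has a chord from its point at time \<open>i\<close> whose larger coordinate in this
  basis has a prescribed size.  Since the derivative is Hoelder, the chord follows the cocycle: it
  is exponentially short in \<open>n\<close> at time \<open>i\<close> and of definite length at time \<open>i + n\<close> or \<open>i - n\<close>.
  So among boundedly many consecutive times there are two whose long arcs overlap, and the orbit
  almost returns to itself at a bounded time.  As \<open>n\<close> grows this contradicts the absence of
  periodic points, which is all that is needed of the irrational rotation number.  The growth is
  hence subexponential, uniformly on the curve, and the exponents vanish at each of its points.
\<close>

section \<open>Symplectic maps of the plane\<close>

text \<open>Nothing here is uniformly hyperbolic: expanded and contracted directions exist only over
  finite times, and the angle between them is uncontrolled. The angle never enters, because the
  basis vectors at time i are images of unit vectors at times i + n and i - n, and a chord is
  measured by its coordinates, which show directly how long it is at those times. If growth on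
  segments that are not slow lies between a^n and b^n, with both rates close to exp \<nu>, these
  vectors decay at the rate c = a^2 / b. A chord of length r is linearized with an error of order
  r^(1 + \<alpha>); such errors, carried along with expansion at most b per step, remain negligible
  as long as c^(1 + \<alpha>) > b. Since \<alpha> > 0, this holds once a and b are close enough to
  exp \<nu>. Which of the two coordinates dominates cannot be prescribed, so forward and backward
  arcs are both counted, and so are slow times in both directions. Each of these four sets of times
  is kept to a density of about 1/8, so together they would have to cover a long orbit segment of
  which they can fill only about half.\<close>

lemma abs_sympl_form_le: "\<bar>sympl_form u v\<bar> \<le> norm u * norm v"
proof -
  have "(sympl_form u v)\<^sup>2 \<le> (norm u * norm v)\<^sup>2"
  proof -
    have "(norm u * norm v)\<^sup>2 - (sympl_form u v)\<^sup>2 = (fst u * fst v + snd u * snd v)\<^sup>2"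
      unfolding sympl_form_def norm_prod_def
      by (simp add: power_mult_distrib) (simp add: power2_eq_square algebra_simps)
    then show ?thesis by (smt (verit) zero_le_power2)
  qed
  then show ?thesis
    by (metis abs_le_square_iff abs_mult abs_norm_cancel)
qed

lemma sympl_form_rotate: "sympl_form v (- snd v, fst v) = (norm v)\<^sup>2"
  by (simp add: sympl_form_def norm_prod_def power2_eq_square)

lemma norm_rotate: "norm (- snd v, fst v) = norm (v :: real \<times> real)"
  by (simp add: norm_prod_def add.commute)

lemma sympl_form_linear [simp]:
  "sympl_form (u + u') v = sympl_form u v + sympl_form u' v"
  "sympl_form u (v + v') = sympl_form u v + sympl_form u v'"
  "sympl_form (c *\<^sub>R u) v = c * sympl_form u v"
  "sympl_form u (c *\<^sub>R v) = c * sympl_form u v"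
  "sympl_form u u = 0"
  by (simp_all add: sympl_form_def algebra_simps)

text \<open>Cramer's rule in division-free form.\<close>

lemma sympl_form_expand:
  "sympl_form u v *\<^sub>R w = sympl_form w v *\<^sub>R u + sympl_form u w *\<^sub>R v"
  by (simp add: sympl_form_def prod_eq_iff algebra_simps)

definition sympl_map :: "((real \<times> real) \<Rightarrow>\<^sub>L (real \<times> real)) \<Rightarrow> bool"
  where "sympl_map B \<longleftrightarrow> (\<forall>u v. sympl_form (B u) (B v) = sympl_form u v)"

lemma sympl_mapD: "sympl_map B \<Longrightarrow> sympl_form (B u) (B v) = sympl_form u v"
  unfolding sympl_map_def by blast

lemma sympl_map_id [simp]: "sympl_map id_blinfun"
  by (simp add: sympl_map_def)

lemma sympl_map_compose: "sympl_map B \<Longrightarrow> sympl_map C \<Longrightarrow> sympl_map (B o\<^sub>L C)"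
  unfolding sympl_map_def blinfun_apply_blinfun_compose by metis

text \<open>Area preservation: \<open>v\<close> and its rotation by a right angle span a square of
  area \<open>norm v\<close> squared, and the image of the square has the same area. So a strong
  contraction in one direction forces a strong expansion in another.\<close>

lemma sympl_map_norm_le:
  assumes "sympl_map B"
  shows "norm v \<le> norm B * norm (B v)"
proof (cases "v = 0")
  case False
  have "(norm v)\<^sup>2 = sympl_form (B v) (B (- snd v, fst v))"
    using assms by (simp add: sympl_mapD sympl_form_rotate)
  also have "\<dots> \<le> norm (B v) * norm (B (- snd v, fst v))"
    using abs_sympl_form_le by (smt (verit))
  also have "\<dots> \<le> norm (B v) * (norm B * norm v)"
    using norm_blinfun[of B "(- snd v, fst v)"]
    by (intro mult_left_mono) (simp_all add: norm_rotate)
  finally have "norm v * norm v \<le> (norm B * norm (B v)) * norm v"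
    by (simp add: power2_eq_square algebra_simps)
  then show ?thesis using False by simp
qed simp

lemma sympl_map_norm_ge_1:
  assumes "sympl_map B"
  shows "1 \<le> norm B"
proof -
  have "norm (1::real, 0::real) \<le> norm B * (norm B * norm (1::real, 0::real))"
    using sympl_map_norm_le[OF assms, of "(1, 0)"] norm_blinfun[of B "(1, 0)"]
    by (meson landau_o.R_trans mult_left_mono norm_ge_zero)
  then have "1\<^sup>2 \<le> (norm B)\<^sup>2" by (simp add: norm_prod_def power2_eq_square)
  then show ?thesis by (rule power2_le_imp_le) simp
qed

text \<open>The adjugate matrix, expressed through the images of the standard basis; it inverts
  \<open>B\<close> because a symplectic map of the plane has determinant 1.\<close>

definition sympl_inv :: "((real \<times> real) \<Rightarrow>\<^sub>L (real \<times> real)) \<Rightarrow> (real \<times> real) \<Rightarrow>\<^sub>L (real \<times> real)"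
  where "sympl_inv B = Blinfun (\<lambda>v. (sympl_form v (B (0, 1)), sympl_form (B (1, 0)) v))"

lemma sympl_inv_apply: "sympl_inv B v = (sympl_form v (B (0, 1)), sympl_form (B (1, 0)) v)"
proof -
  have "linear (\<lambda>v. (sympl_form v (B (0, 1)), sympl_form (B (1, 0)) v))"
    by (rule linearI) simp_all
  then show ?thesis
    unfolding sympl_inv_def by (subst bounded_linear_Blinfun_apply)
      (simp_all add: linear_conv_bounded_linear)
qed

lemma sympl_inv_left:
  assumes "sympl_map B"
  shows "sympl_inv B (B v) = v"
proof -
  have "sympl_inv B (B v) = (sympl_form v (0, 1), sympl_form (1, 0) v)"
    using assms by (simp add: sympl_inv_apply sympl_mapD)
  then show ?thesis by (simp add: sympl_form_def)
qed

lemma sympl_inv_right: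
  assumes "sympl_map B"
  shows "B (sympl_inv B v) = v"
proof -
  let ?a = "B (1, 0)" and ?b = "B (0, 1)"
  have ab: "sympl_form ?a ?b = 1"
    using sympl_mapD[OF assms, of "(1, 0)" "(0, 1)"] by (simp add: sympl_form_def)
  have "sympl_inv B v = sympl_form v ?b *\<^sub>R (1, 0) + sympl_form ?a v *\<^sub>R (0, 1)"
    by (simp add: sympl_inv_apply)
  then have "B (sympl_inv B v) = sympl_form v ?b *\<^sub>R ?a + sympl_form ?a v *\<^sub>R ?b"
    by (simp only: blinfun.add_right blinfun.scaleR_right)
  also have "\<dots> = v"
    using sympl_form_expand[of ?a ?b v] ab by simp
  finally show ?thesis .
qed

lemma sympl_map_inv: "sympl_map B \<Longrightarrow> sympl_map (sympl_inv B)"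
  unfolding sympl_map_def by (metis sympl_inv_right sympl_map_def)

lemma norm_right_inverse_le:
  fixes C :: "(real \<times> real) \<Rightarrow>\<^sub>L (real \<times> real)"
  assumes "sympl_map B" "\<And>v. B (C v) = v"
  shows "norm C \<le> norm B"
  using sympl_map_norm_le[OF assms(1), of "C v" for v] assms(2)
  by (intro norm_blinfun_bound) auto

lemma sympl_inv_norm:
  assumes "sympl_map B"
  shows "norm (sympl_inv B) = norm B"
  using norm_right_inverse_le[OF assms sympl_inv_right[OF assms]]
    norm_right_inverse_le[OF sympl_map_inv[OF assms] sympl_inv_left[OF assms]]
  by simp

lemma blinfun_norm_attained:
  obtains v where "norm v = 1" "norm ((B :: (real \<times> real) \<Rightarrow>\<^sub>L (real \<times> real)) v) = norm B"
proof -
  have ne: "(1, 0) \<in> sphere (0::real \<times> real) 1"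
    by (simp add: norm_prod_def)
  have "\<exists>v\<in>sphere 0 1. \<forall>w\<in>sphere 0 1. norm (B w) \<le> norm (B v)"
    using ne by (intro continuous_attains_sup) (auto intro!: continuous_intros)
  then obtain v where v: "norm v = 1" "\<And>w. norm w = 1 \<Longrightarrow> norm (B w) \<le> norm (B v)"
    by auto
  have "norm (B w) \<le> norm (B v) * norm w" for w
  proof (cases "w = 0")
    case False
    have "norm (B (w /\<^sub>R norm w)) \<le> norm (B v)"
      using False by (intro v) simp
    then show ?thesis using False
      by (simp add: blinfun.scaleR_right divide_simps mult.commute)
  qed simp
  then have "norm B \<le> norm (B v)"
    by (intro norm_blinfun_bound) auto
  moreover have "norm (B v) \<le> norm B"
    using norm_blinfun[of B v] v by simp
  ultimately show ?thesis using that v by auto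
qed

text \<open>The inverse has the same norm as \<open>B\<close>, so the vector that the inverse
  stretches most is, after normalization of its image, the source of the strongest
  contraction.\<close>

lemma sympl_map_contracted_vector:
  assumes "sympl_map B"
  obtains s where "norm s = 1" "norm (B s) = 1 / norm B"
proof -
  let ?C = "sympl_inv B"
  obtain w where w: "norm w = 1" "norm (?C w) = norm ?C"
    by (rule blinfun_norm_attained)
  have n: "norm ?C = norm B" "norm B > 0"
    using sympl_inv_norm[OF assms] sympl_map_norm_ge_1[OF assms] by auto
  show ?thesis
  proof
    show "norm (?C w /\<^sub>R norm B) = 1"
      using w n by simp
    show "norm (B (?C w /\<^sub>R norm B)) = 1 / norm B"
      using w n by (simp add: blinfun.scaleR_right sympl_inv_right[OF assms] divide_simps)
  qed
qed

lemma orthonormal_expand: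
  assumes "norm (s :: real \<times> real) = 1"
  shows "v = (s \<bullet> v) *\<^sub>R s + sympl_form s v *\<^sub>R (- snd s, fst s)"
proof -
  have "(fst s)\<^sup>2 + (snd s)\<^sup>2 = 1"
    using assms by (simp add: norm_prod_def)
  then have "fst s * (fst s * x) + snd s * (snd s * x) = x" for x
    by (metis (no_types, lifting) distrib_right mult.assoc mult_1 power2_eq_square)
  then show ?thesis
    by (simp add: prod_eq_iff sympl_form_def inner_prod_def algebra_simps)
      (smt (verit, ccfv_SIG) mult.commute mult.left_commute)
qed

text \<open>For unit vectors \<open>\<bar>sympl_form s v\<bar>\<close> is the sine of the angle
  between them: this is the cost of replacing one direction by a nearby one.\<close>

lemma norm_blinfun_le_by_sympl_form:
  fixes B :: "(real \<times> real) \<Rightarrow>\<^sub>L (real \<times> real)"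
  assumes "norm s = 1" "norm v = 1"
  shows "norm (B v) \<le> norm (B s) + \<bar>sympl_form s v\<bar> * norm B"
proof -
  let ?r = "(- snd s, fst s)"
  have "norm (B v) = norm ((s \<bullet> v) *\<^sub>R B s + sympl_form s v *\<^sub>R B ?r)"
    by (subst orthonormal_expand[OF assms(1), of v])
      (simp only: blinfun.add_right blinfun.scaleR_right)
  also have "\<dots> \<le> \<bar>s \<bullet> v\<bar> * norm (B s) + \<bar>sympl_form s v\<bar> * norm (B ?r)"
    by (metis norm_scaleR norm_triangle_ineq)
  also have "\<dots> \<le> 1 * norm (B s) + \<bar>sympl_form s v\<bar> * norm B"
    using Cauchy_Schwarz_ineq2[of s v] norm_blinfun[of B ?r] assms
    by (intro add_mono mult_right_mono mult_left_mono) (auto simp: norm_rotate)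
  finally show ?thesis by simp
qed

section \<open>Cocycles of symplectic maps\<close>

primrec cocycle :: "('a \<Rightarrow> 'a) \<Rightarrow> ('a \<Rightarrow> (real \<times> real) \<Rightarrow>\<^sub>L (real \<times> real)) \<Rightarrow> nat \<Rightarrow> 'a
    \<Rightarrow> (real \<times> real) \<Rightarrow>\<^sub>L (real \<times> real)"
  where
    "cocycle T A 0 x = id_blinfun"
  | "cocycle T A (Suc n) x = A ((T ^^ n) x) o\<^sub>L cocycle T A n x"

lemma cocycle_add:
  "cocycle T A (m + n) x = cocycle T A m ((T ^^ n) x) o\<^sub>L cocycle T A n x"
  by (induction m) (auto simp: funpow_add intro!: blinfun_eqI)

lemma cocycle_Suc_right: "cocycle T A (Suc n) x = cocycle T A n (T x) o\<^sub>L A x"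
  using cocycle_add[of T A n 1 x] by (auto intro!: blinfun_eqI)

locale sympl_cocycle =
  fixes T :: "'a \<Rightarrow> 'a" and A :: "'a \<Rightarrow> (real \<times> real) \<Rightarrow>\<^sub>L (real \<times> real)" and M :: real
  assumes sympl: "sympl_map (A x)" and norm_le_M: "norm (A x) \<le> M"
begin

abbreviation P where "P \<equiv> cocycle T A"

lemma sympl_P: "sympl_map (P n x)"
  by (induction n) (simp_all add: sympl_map_compose sympl)

lemma norm_P_ge_1: "1 \<le> norm (P n x)"
  by (rule sympl_map_norm_ge_1[OF sympl_P])

lemma M_ge_1: "1 \<le> M"
  using norm_le_M[of undefined] sympl_map_norm_ge_1[OF sympl, of undefined] by linarith

lemma norm_P_add_le: "norm (P (m + n) x) \<le> norm (P m ((T ^^ n) x)) * norm (P n x)"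
  unfolding cocycle_add by (rule norm_blinfun_compose)

lemma norm_P_Suc_le: "norm (P (Suc n) x v) \<le> M * norm (P n x v)"
proof -
  have "norm (P (Suc n) x v) \<le> norm (A ((T ^^ n) x)) * norm (P n x v)"
    by (simp add: norm_blinfun)
  also have "\<dots> \<le> M * norm (P n x v)"
    by (intro mult_right_mono norm_le_M) simp
  finally show ?thesis .
qed

lemma norm_P_le_power: "norm (P n x) \<le> M ^ n"
proof (rule norm_blinfun_bound)
  show "norm (P n x v) \<le> M ^ n * norm v" for v
  proof (induction n)
    case (Suc n)
    have "norm (P (Suc n) x v) \<le> M * (M ^ n * norm v)"
      using norm_P_Suc_le[of n x v] Suc M_ge_1 by (smt (verit) mult_left_mono)
    then show ?case by (simp add: mult.assoc)
  qed simp
qed (use M_ge_1 in simp)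

end

locale bounded_growth = sympl_cocycle +
  fixes K b :: real
  assumes K: "1 \<le> K" and b: "1 < b"
    and norm_P_le: "norm (P n x) \<le> K * b ^ n"
begin

text \<open>A finite-time stable direction. The most contracted directions of consecutive iterates
  differ by an angle of order a^(-2j), because step j contracts both of them. Hence the direction
  for the last time \<open>m\<close> also serves all earlier times n, where the accumulated angle is
  magnified by \<open>norm (P n x)\<close>, of order b^n; this yields the rate b / a^2.\<close>

lemma contracted_vector_upto:
  assumes a: "1 < a" "a \<le> b" and k: "0 < \<kappa>"
    and lower: "\<And>n. n \<le> m \<Longrightarrow> \<kappa> * a ^ n \<le> norm (P n x)"
  obtains s where "norm s = 1"
    "\<And>n. n \<le> m \<Longrightarrow> norm (P n x s) \<le>
      (1 / \<kappa> + M * K / (\<kappa>\<^sup>2 * (1 - 1 / a\<^sup>2))) * (b / a\<^sup>2) ^ n"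
proof -
  define q where "q = 1 / a\<^sup>2"
  have q: "0 < q" "q < 1"
    using a unfolding q_def by (simp_all add: divide_simps)
  have "\<exists>s. norm s = 1 \<and> norm (P n x s) = 1 / norm (P n x)" for n
    using sympl_map_contracted_vector[OF sympl_P] by metis
  then obtain s where s: "norm (s n) = 1" "norm (P n x (s n)) = 1 / norm (P n x)" for n
    by metis
  have contr: "norm (P n x (s n)) \<le> 1 / (\<kappa> * a ^ n)" if "n \<le> m" for n
  proof -
    have "0 < norm (P n x)" using norm_P_ge_1[of n x] by linarith
    then show ?thesis
      unfolding s(2) using lower[OF that] a k by (intro divide_left_mono mult_pos_pos) auto
  qed
  have step: "\<bar>sympl_form (s j) (s (Suc j))\<bar> \<le> M / \<kappa>\<^sup>2 * q ^ j" if "Suc j \<le> m" for j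
  proof -
    \<comment> \<open>The vector is known to be short one step later; undoing that step costs a
      factor \<open>M\<close>.\<close>
    have 1: "norm (P j x (s (Suc j))) \<le> M * (1 / (\<kappa> * a ^ j))"
    proof -
      have "norm (P j x (s (Suc j))) \<le>
          norm (A ((T ^^ j) x)) * norm (A ((T ^^ j) x) (P j x (s (Suc j))))"
        by (rule sympl_map_norm_le[OF sympl])
      also have "\<dots> \<le> M * norm (P (Suc j) x (s (Suc j)))"
        by (simp add: mult_right_mono norm_le_M)
      also have "\<dots> \<le> M * (1 / (\<kappa> * a ^ j))"
      proof -
        have "1 / (\<kappa> * a ^ Suc j) \<le> 1 / (\<kappa> * a ^ j)"
          using a k by (intro divide_left_mono mult_left_mono power_increasing) auto
        then show ?thesis
          using contr[OF that] M_ge_1 by (intro mult_left_mono) linarith+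
      qed
      finally show ?thesis .
    qed
    have "\<bar>sympl_form (s j) (s (Suc j))\<bar> = \<bar>sympl_form (P j x (s j)) (P j x (s (Suc j)))\<bar>"
      by (simp add: sympl_mapD[OF sympl_P])
    also have "\<dots> \<le> norm (P j x (s j)) * norm (P j x (s (Suc j)))"
      by (rule abs_sympl_form_le)
    also have "\<dots> \<le> 1 / (\<kappa> * a ^ j) * (M * (1 / (\<kappa> * a ^ j)))"
      using that a k by (intro mult_mono contr 1) auto
    also have "\<dots> = M / \<kappa>\<^sup>2 * q ^ j"
      by (simp add: q_def power2_eq_square power_divide power_mult_distrib)
    finally show ?thesis .
  qed
  \<comment> \<open>The angles form a geometric series of ratio \<open>q\<close>; its partial sum is
    kept in closed form so that the induction on \<open>i\<close> closes.\<close>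
  have tele: "norm (P n x (s (n + i))) \<le>
      1 / (\<kappa> * a ^ n) + M / \<kappa>\<^sup>2 * (K * b ^ n) * (q ^ n * (1 - q ^ i) / (1 - q))"
    if "n + i \<le> m" for n i
    using that
  proof (induction i)
    case 0
    then show ?case using contr[of n] by simp
  next
    case (Suc i)
    have "norm (P n x (s (n + Suc i))) \<le> norm (P n x (s (n + i))) +
        \<bar>sympl_form (s (n + i)) (s (n + Suc i))\<bar> * norm (P n x)"
      by (intro norm_blinfun_le_by_sympl_form s)
    also have "\<bar>sympl_form (s (n + i)) (s (n + Suc i))\<bar> * norm (P n x) \<le>
        M / \<kappa>\<^sup>2 * q ^ (n + i) * (K * b ^ n)"
      using step[of "n + i"] Suc.prems norm_P_le M_ge_1 q by (intro mult_mono) auto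
    also have "norm (P n x (s (n + i))) \<le>
        1 / (\<kappa> * a ^ n) + M / \<kappa>\<^sup>2 * (K * b ^ n) * (q ^ n * (1 - q ^ i) / (1 - q))"
      using Suc by simp
    also have "1 / (\<kappa> * a ^ n) + M / \<kappa>\<^sup>2 * (K * b ^ n) * (q ^ n * (1 - q ^ i) / (1 - q))
        + M / \<kappa>\<^sup>2 * q ^ (n + i) * (K * b ^ n) =
        1 / (\<kappa> * a ^ n) + M / \<kappa>\<^sup>2 * (K * b ^ n) * (q ^ n * (1 - q ^ Suc i) / (1 - q))"
    proof -
      have "q ^ n * (1 - q ^ i) / (1 - q) + q ^ (n + i) = q ^ n * (1 - q ^ Suc i) / (1 - q)"
        using q by (simp add: divide_simps power_add) (simp add: algebra_simps)
      from arg_cong[OF this, of "\<lambda>z. M / \<kappa>\<^sup>2 * (K * b ^ n) * z"] show ?thesis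
        by (simp add: algebra_simps)
    qed
    finally show ?case by simp
  qed
  show ?thesis
  proof
    show "norm (s m) = 1" by (rule s)
    fix n assume n: "n \<le> m"
    have "norm (P n x (s m)) \<le>
        1 / (\<kappa> * a ^ n) + M / \<kappa>\<^sup>2 * (K * b ^ n) * (q ^ n * (1 - q ^ (m - n)) / (1 - q))"
      using tele[of n "m - n"] n by simp
    also have "1 / (\<kappa> * a ^ n) \<le> 1 / \<kappa> * (b / a\<^sup>2) ^ n"
    proof -
      have "1 / a \<le> b / a\<^sup>2"
        using a by (simp add: divide_simps power2_eq_square)
      then have "(1 / a) ^ n \<le> (b / a\<^sup>2) ^ n"
        using a by (intro power_mono) auto
      then have "1 / \<kappa> * (1 / a) ^ n \<le> 1 / \<kappa> * (b / a\<^sup>2) ^ n"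
        using k by (intro mult_left_mono) auto
      then show ?thesis by (simp add: power_divide)
    qed
    also have "M / \<kappa>\<^sup>2 * (K * b ^ n) * (q ^ n * (1 - q ^ (m - n)) / (1 - q)) \<le>
        M / \<kappa>\<^sup>2 * (K * b ^ n) * (q ^ n * 1 / (1 - q))"
      using M_ge_1 K b q
      by (intro mult_left_mono divide_right_mono mult_nonneg_nonneg) auto
    also have "\<dots> = M * K / (\<kappa>\<^sup>2 * (1 - 1 / a\<^sup>2)) * (b / a\<^sup>2) ^ n"
      by (simp add: q_def power_divide divide_simps)
    finally show "norm (P n x (s m)) \<le>
      (1 / \<kappa> + M * K / (\<kappa>\<^sup>2 * (1 - 1 / a\<^sup>2))) * (b / a\<^sup>2) ^ n"
      by (simp add: algebra_simps)
  qed
qed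

text \<open>A Lyapunov norm for the rate \<open>b\<close>: it is comparable to the Euclidean norm up
  to the factor \<open>K\<close>, but a single step expands it by at most \<open>b\<close> with no
  constant in front. Constants therefore do not accumulate along an orbit cut into many
  pieces.\<close>

definition adapted_norm :: "'a \<Rightarrow> real \<times> real \<Rightarrow> real"
  where "adapted_norm x v = (SUP n. norm (P n x v) / b ^ n)"

lemma adapted_norm_bdd: "norm (P n x v) / b ^ n \<le> K * norm v"
proof -
  have "norm (P n x v) \<le> norm (P n x) * norm v" by (rule norm_blinfun)
  also have "\<dots> \<le> K * b ^ n * norm v" by (intro mult_right_mono norm_P_le) simp
  finally show ?thesis using b by (simp add: divide_simps mult_ac)
qed

lemma adapted_norm_le: "adapted_norm x v \<le> K * norm v"
  unfolding adapted_norm_def by (rule cSUP_least) (auto intro: adapted_norm_bdd)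

lemma le_adapted_norm: "norm (P n x v) / b ^ n \<le> adapted_norm x v"
  unfolding adapted_norm_def
  by (rule cSUP_upper) (auto intro!: bdd_aboveI[of _ "K * norm v"] adapted_norm_bdd)

lemma norm_le_adapted_norm: "norm v \<le> adapted_norm x v"
  using le_adapted_norm[of 0 x v] by simp

lemma adapted_norm_nonneg: "0 \<le> adapted_norm x v"
  using norm_le_adapted_norm[of v x] norm_ge_zero[of v] by linarith

lemma adapted_norm_triangle: "adapted_norm x (u + v) \<le> adapted_norm x u + adapted_norm x v"
  unfolding adapted_norm_def[of x "u + v"]
proof (rule cSUP_least)
  fix n
  have "norm (P n x (u + v)) / b ^ n \<le> norm (P n x u) / b ^ n + norm (P n x v) / b ^ n"
    using b by (simp add: blinfun.add_right divide_right_mono norm_triangle_ineq flip: add_divide_distrib)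
  also have "\<dots> \<le> adapted_norm x u + adapted_norm x v"
    by (intro add_mono le_adapted_norm)
  finally show "norm (P n x (u + v)) / b ^ n \<le> adapted_norm x u + adapted_norm x v" .
qed simp

lemma adapted_norm_step: "adapted_norm (T x) (A x v) \<le> b * adapted_norm x v"
  unfolding adapted_norm_def[of "T x"]
proof (rule cSUP_least)
  fix n
  have "norm (P n (T x) (A x v)) / b ^ n = b * (norm (P (Suc n) x v) / b ^ Suc n)"
    using b by (simp add: cocycle_Suc_right del: cocycle.simps(2))
  also have "\<dots> \<le> b * adapted_norm x v"
    using b by (intro mult_left_mono le_adapted_norm) simp
  finally show "norm (P n (T x) (A x v)) / b ^ n \<le> b * adapted_norm x v" .
qed simp

lemma adapted_norm_P: "adapted_norm ((T ^^ n) x) (P n x v) \<le> b ^ n * adapted_norm x v"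
proof (induction n)
  case (Suc n)
  have "adapted_norm ((T ^^ Suc n) x) (P (Suc n) x v) \<le> b * adapted_norm ((T ^^ n) x) (P n x v)"
    using adapted_norm_step[of "(T ^^ n) x" "P n x v"] by simp
  also have "\<dots> \<le> b * (b ^ n * adapted_norm x v)"
    using Suc b by (intro mult_left_mono) auto
  finally show ?case by simp
qed simp

text \<open>Lengths below \<open>n\<^sub>0\<close> are left out because every jump over a slow
  segment costs a factor \<open>K\<close>, which only a long enough segment can absorb. The upper
  bound \<open>m\<close> will be the length \<open>2 * n\<close> of the window around a
  time.\<close>

definition slow :: "real \<Rightarrow> nat \<Rightarrow> nat \<Rightarrow> 'a \<Rightarrow> bool"
  where "slow a n\<^sub>0 m x \<longleftrightarrow> (\<exists>l\<in>{n\<^sub>0..m}. norm (P l x) < a ^ l)"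

definition slow_times :: "real \<Rightarrow> nat \<Rightarrow> nat \<Rightarrow> nat \<Rightarrow> 'a \<Rightarrow> nat set"
  where "slow_times a n\<^sub>0 m N x = {k. k < N \<and> slow a n\<^sub>0 m ((T ^^ k) x)}"

lemma finite_slow_times [simp]: "finite (slow_times a n\<^sub>0 m N x)"
  by (simp add: slow_times_def)

lemma card_slow_times_le: "card (slow_times a n\<^sub>0 m N x) \<le> N"
  using card_mono[of "{..<N}" "slow_times a n\<^sub>0 m N x"] by (auto simp: slow_times_def)

lemma slow_times_split:
  "slow_times a n\<^sub>0 m (l + N) x =
    slow_times a n\<^sub>0 m l x \<union> (\<lambda>k. k + l) ` slow_times a n\<^sub>0 m N ((T ^^ l) x)"
proof -
  have "k \<in> (\<lambda>k. k + l) ` slow_times a n\<^sub>0 m N ((T ^^ l) x)"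
    if "l \<le> k" "k < l + N" "slow a n\<^sub>0 m ((T ^^ k) x)" for k
  proof (rule image_eqI)
    show "k = (k - l) + l" using that by simp
    have "(T ^^ (k - l)) ((T ^^ l) x) = (T ^^ k) x"
      using that by (metis comp_apply funpow_add le_add_diff_inverse2)
    then show "k - l \<in> slow_times a n\<^sub>0 m N ((T ^^ l) x)"
      using that by (auto simp: slow_times_def)
  qed
  then have "slow_times a n\<^sub>0 m (l + N) x \<subseteq>
      slow_times a n\<^sub>0 m l x \<union> (\<lambda>k. k + l) ` slow_times a n\<^sub>0 m N ((T ^^ l) x)"
    unfolding slow_times_def[of _ _ _ "l + N"] slow_times_def[of _ _ _ l]
    by (auto simp: not_less) (meson leI)
  then show ?thesis
    by (auto simp: slow_times_def funpow_add)
qed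

text \<open>
  The orbit is cut greedily: at a slow time jump over the slow segment, otherwise make one step.
\<close>

lemma adapted_norm_P_slow:
  assumes q: "0 < q" "q \<le> b" and n0: "0 < n\<^sub>0"
    and jump: "\<And>l. n\<^sub>0 \<le> l \<Longrightarrow> K * a ^ l \<le> q ^ l"
  shows "adapted_norm ((T ^^ N) x) (P N x v) \<le>
    b ^ N * (q / b) ^ card (slow_times a n\<^sub>0 m N x) * (b / q) ^ m * adapted_norm x v"
proof (induction N arbitrary: x v rule: less_induct)
  case (less N)
  let ?r = "q / b" and ?c = "\<lambda>N x. card (slow_times a n\<^sub>0 m N x)"
  have r: "0 < ?r" "?r \<le> 1" and br: "1 \<le> b / q" using q b by auto
  have nn: "0 \<le> b ^ N * adapted_norm x v"
    using b adapted_norm_nonneg by simp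
  consider "N \<le> m" | "N > m" "\<not> slow a n\<^sub>0 m x" |
    l where "N > m" "n\<^sub>0 \<le> l" "l \<le> m" "norm (P l x) < a ^ l"
    unfolding slow_def by (metis atLeastAtMost_iff not_le_imp_less)
  then show ?case
  proof cases
    case 1
    \<comment> \<open>At most \<open>m\<close> times remain, and the factor
      \<open>(b / q) ^ m\<close> pays for all of them being counted as slow.\<close>
    have "1 \<le> ?r ^ ?c N x * (b / q) ^ m"
    proof -
      have "?r ^ m \<le> ?r ^ ?c N x"
        using r 1 card_slow_times_le[of a n\<^sub>0 m N x] by (intro power_decreasing) auto
      then have "?r ^ m * (b / q) ^ m \<le> ?r ^ ?c N x * (b / q) ^ m"
        using br by (intro mult_right_mono) auto
      moreover have "?r ^ m * (b / q) ^ m = 1"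
        using q b by (simp flip: power_mult_distrib)
      ultimately show ?thesis by simp
    qed
    from mult_left_mono[OF this nn] adapted_norm_P[of N x v] show ?thesis
      by (simp add: mult_ac)
  next
    case 2
    then obtain N' where N': "N = Suc N'" by (cases N) auto
    have c: "?c N x = ?c N' (T x)"
    proof -
      have "slow_times a n\<^sub>0 m 1 x = {}" using 2 by (auto simp: slow_times_def)
      then have "slow_times a n\<^sub>0 m N x = (\<lambda>k. k + 1) ` slow_times a n\<^sub>0 m N' (T x)"
        using slow_times_split[of a n\<^sub>0 m 1 N' x] N' by simp
      then show ?thesis by (simp add: card_image)
    qed
    have "adapted_norm ((T ^^ N) x) (P N x v) =
        adapted_norm ((T ^^ N') (T x)) (P N' (T x) (A x v))"
      by (simp add: N' cocycle_Suc_right funpow_swap1 del: cocycle.simps(2))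
    also have "\<dots> \<le> b ^ N' * ?r ^ ?c N x * (b / q) ^ m * adapted_norm (T x) (A x v)"
      using less[of N'] N' c by simp
    also have "\<dots> \<le> b ^ N' * ?r ^ ?c N x * (b / q) ^ m * (b * adapted_norm x v)"
      using r br b by (intro mult_left_mono adapted_norm_step mult_nonneg_nonneg) auto
    finally show ?thesis by (simp add: N' mult_ac)
  next
    case 3
    let ?y = "(T ^^ l) x"
    have l: "l < N" "0 < l" and N: "N = (N - l) + l" using 3 n0 by auto
    \<comment> \<open>All \<open>l\<close> times jumped over are charged as slow; the jump gains
      \<open>(q / b) ^ l\<close>, which covers the charge.\<close>
    have c: "?c N x \<le> l + ?c (N - l) ?y"
    proof -
      have "?c N x \<le> card (slow_times a n\<^sub>0 m l x) + card ((\<lambda>k. k + l) ` slow_times a n\<^sub>0 m (N - l) ?y)"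
        using slow_times_split[of a n\<^sub>0 m l "N - l" x] l card_Un_le by simp
      also have "\<dots> \<le> l + ?c (N - l) ?y"
        using card_slow_times_le[of a n\<^sub>0 m l x] by (simp add: card_image)
      finally show ?thesis .
    qed
    have "adapted_norm ((T ^^ N) x) (P N x v) =
        adapted_norm ((T ^^ (N - l)) ?y) (P (N - l) ?y (P l x v))"
      by (subst (1 2) N) (simp add: cocycle_add funpow_add)
    also have "\<dots> \<le> b ^ (N - l) * ?r ^ ?c (N - l) ?y * (b / q) ^ m * adapted_norm ?y (P l x v)"
      using less[of "N - l"] l by simp
    also have "adapted_norm ?y (P l x v) \<le> b ^ l * ?r ^ l * adapted_norm x v"
    proof -
      have "adapted_norm ?y (P l x v) \<le> K * norm (P l x v)" by (rule adapted_norm_le)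
      also have "\<dots> \<le> K * (a ^ l * norm v)"
      proof -
        have "norm (P l x v) \<le> norm (P l x) * norm v" by (rule norm_blinfun)
        also have "\<dots> \<le> a ^ l * norm v" using 3 by (intro mult_right_mono) auto
        finally show ?thesis using K by simp
      qed
      also have "\<dots> \<le> q ^ l * adapted_norm x v"
        using jump[OF 3(2)] norm_le_adapted_norm[of v x] q
        by (metis (no_types, opaque_lifting) mult.assoc mult_mono norm_ge_zero zero_le_power less_imp_le)
      finally show ?thesis using b by (simp add: power_divide)
    qed
    also have "b ^ (N - l) * ?r ^ ?c (N - l) ?y * (b / q) ^ m * (b ^ l * ?r ^ l * adapted_norm x v)
        = b ^ N * ?r ^ (l + ?c (N - l) ?y) * (b / q) ^ m * adapted_norm x v"
      using l by (simp add: power_add mult_ac flip: power_add)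
    also have "\<dots> \<le> b ^ N * ?r ^ ?c N x * (b / q) ^ m * adapted_norm x v"
      using c r br b adapted_norm_nonneg
      by (intro mult_left_mono mult_right_mono power_decreasing) auto
    finally show ?thesis using r br b by (simp add: mult_left_mono)
  qed
qed

lemma norm_P_slow:
  assumes "0 < q" "q \<le> b" "0 < n\<^sub>0"
    and "\<And>l. n\<^sub>0 \<le> l \<Longrightarrow> K * a ^ l \<le> q ^ l"
  shows "norm (P N x) \<le> K * b ^ N * (q / b) ^ card (slow_times a n\<^sub>0 m N x) * (b / q) ^ m"
proof (rule norm_blinfun_bound)
  let ?B = "b ^ N * (q / b) ^ card (slow_times a n\<^sub>0 m N x) * (b / q) ^ m"
  have B: "0 \<le> ?B" using assms b by simp
  show "0 \<le> K * b ^ N * (q / b) ^ card (slow_times a n\<^sub>0 m N x) * (b / q) ^ m"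
    using assms b K by simp
  fix v
  have "norm (P N x v) \<le> adapted_norm ((T ^^ N) x) (P N x v)" by (rule norm_le_adapted_norm)
  also have "\<dots> \<le> ?B * adapted_norm x v" using assms by (rule adapted_norm_P_slow)
  also have "\<dots> \<le> ?B * (K * norm v)" using B by (intro mult_left_mono adapted_norm_le)
  finally show "norm (P N x v) \<le>
      K * b ^ N * (q / b) ^ card (slow_times a n\<^sub>0 m N x) * (b / q) ^ m * norm v"
    by (simp add: mult_ac)
qed

end

section \<open>The exponential growth rate of a cocycle\<close>

context sympl_cocycle
begin

text \<open>Fekete's lemma for the submultiplicative suprema \<open>S n\<close>, with \<nu> the
  infimum of \<open>ln (S n) / n\<close>. An infimum bounds every single \<open>n\<close> from
  below; the factor 2 is there because the supremum over x need not be attained.\<close>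

lemma growth_rate:
  obtains \<nu> where "0 \<le> \<nu>"
    "\<And>\<epsilon>. 0 < \<epsilon> \<Longrightarrow> \<exists>K\<ge>1. \<forall>n x. norm (P n x) \<le> K * exp (\<nu> + \<epsilon>) ^ n"
    "\<And>n. \<exists>x. exp \<nu> ^ n \<le> 2 * norm (P n x)"
proof -
  define S where "S n = (SUP x. norm (P n x))" for n
  have bdd: "bdd_above (range (\<lambda>x. norm (P n x)))" for n
    by (auto intro!: bdd_aboveI[of _ "M ^ n"] norm_P_le_power)
  have le_S: "norm (P n x) \<le> S n" for n x
    unfolding S_def by (intro cSUP_upper bdd) simp
  have S1: "1 \<le> S n" for n
    using le_S[of n undefined] norm_P_ge_1[of n undefined] by linarith
  define \<nu> where "\<nu> = (INF n\<in>{1..}. ln (S n) / real n)"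
  have nn: "0 \<le> ln (S n) / real n" for n using S1[of n] by simp
  have \<nu>_le: "\<nu> \<le> ln (S n) / real n" if "n \<ge> 1" for n
    unfolding \<nu>_def using that nn by (intro cINF_lower) (auto intro!: bdd_belowI[of _ 0])
  have S_submult: "S (m + n) \<le> S m * S n" for m n
    unfolding S_def[of "m + n"]
  proof (rule cSUP_least)
    fix x
    have "norm (P (m + n) x) \<le> norm (P m ((T ^^ n) x)) * norm (P n x)" by (rule norm_P_add_le)
    also have "\<dots> \<le> S m * S n"
      using S1[of m] by (intro mult_mono le_S) auto
    finally show "norm (P (m + n) x) \<le> S m * S n" .
  qed simp
  show ?thesis
  proof
    show "0 \<le> \<nu>"
      unfolding \<nu>_def by (rule cINF_greatest) (use nn in auto)
  next
    fix \<epsilon> :: real assume "0 < \<epsilon>"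
    then have "\<nu> < \<nu> + \<epsilon>" by simp
    then obtain p where p: "p \<ge> 1" "ln (S p) / real p < \<nu> + \<epsilon>"
      unfolding \<nu>_def by (subst (asm) cINF_less_iff) (use nn in \<open>auto intro!: bdd_belowI[of _ 0]\<close>)
    define e where "e = exp (\<nu> + \<epsilon>)"
    have e: "1 \<le> e" unfolding e_def using \<open>0 < \<epsilon>\<close> \<open>\<nu> < \<nu> + \<epsilon>\<close> p nn[of p] by simp
    have Sp: "S p \<le> e ^ p"
    proof -
      have "ln (S p) < real p * (\<nu> + \<epsilon>)" using p by (simp add: field_simps)
      then have "S p < exp (real p * (\<nu> + \<epsilon>))"
        using S1[of p] by (metis exp_less_mono exp_ln less_le_trans zero_less_one)
      then show ?thesis by (simp add: e_def exp_of_nat_mult)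
    qed
    \<comment> \<open>Lengths are reduced modulo \<open>p\<close>, and \<open>K\<close> bounds the
      growth over all possible remainders.\<close>
    define K where "K = Max (S ` {..<p})"
    have KS: "S r \<le> K" if "r < p" for r unfolding K_def using that by (intro Max_ge) auto
    have K1: "1 \<le> K" using KS[of 0] S1[of 0] p by linarith
    have "S n \<le> K * e ^ n" for n
    proof (induction n rule: less_induct)
      case (less n)
      show ?case
      proof (cases "n < p")
        case True
        have "S n * 1 \<le> K * e ^ n"
          using KS[OF True] K1 e by (intro mult_mono) auto
        then show ?thesis by simp
      next
        case False
        then have n: "n = (n - p) + p" by simp
        have "S n \<le> S (n - p) * S p" using S_submult[of "n - p" p] n by simp
        also have "\<dots> \<le> (K * e ^ (n - p)) * e ^ p"
          using less[of "n - p"] p False Sp S1[of p] K1 e by (intro mult_mono) auto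
        also have "\<dots> = K * e ^ n" by (subst (2) n) (simp add: power_add)
        finally show ?thesis .
      qed
    qed
    then show "\<exists>K\<ge>1. \<forall>n x. norm (P n x) \<le> K * exp (\<nu> + \<epsilon>) ^ n"
      using K1 le_S order_trans unfolding e_def by blast
  next
    fix n
    show "\<exists>x. exp \<nu> ^ n \<le> 2 * norm (P n x)"
    proof (cases "n = 0")
      case False
      have "S n / 2 < S n" using S1[of n] by simp
      then obtain x where "S n / 2 < norm (P n x)"
        unfolding S_def[of n] by (subst (asm) less_cSUP_iff[OF _ bdd]) auto
      moreover have "exp \<nu> ^ n \<le> S n"
      proof -
        have "real n * \<nu> \<le> ln (S n)" using \<nu>_le[of n] False by (simp add: field_simps)
        then show ?thesis
          using S1[of n] by (metis exp_le_cancel_iff exp_ln exp_of_nat_mult less_le_trans zero_less_one)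
      qed
      ultimately show ?thesis by (intro exI[of _ x]) simp
    qed (use norm_P_ge_1[of 0] in \<open>auto intro: order_trans\<close>)
  qed
qed

end

section \<open>Chords that follow the cocycle\<close>

context bounded_growth
begin

text \<open>
  In the adapted norm each step expands by at most \<open>b\<close>, so the errors made along the way
  stay dominated by the last one.
\<close>

lemma pseudo_orbit_follows_cocycle:
  fixes w :: "nat \<Rightarrow> real \<times> real"
  assumes C: "0 \<le> C" and \<alpha>: "0 < \<alpha>" and c: "1 \<le> c" "b < c powr (1 + \<alpha>)"
    and K2: "0 < K2" and l: "0 < l"
    and step: "\<And>j. j < n \<Longrightarrow> norm (w j) \<le> \<delta> \<Longrightarrow>
      norm (w (Suc j) - A ((T ^^ j) x) (w j)) \<le> C * norm (w j) powr (1 + \<alpha>)"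
    and lin: "\<And>j. j \<le> n \<Longrightarrow> norm (P j x (w 0)) \<le> K2 * l / c ^ (n - j)"
  defines "C3 \<equiv> K * C * (2 * K2) powr (1 + \<alpha>) / (c powr (1 + \<alpha>) - b)"
  assumes small: "C3 * l powr \<alpha> \<le> K2" "2 * K2 * l \<le> \<delta>" and j: "j \<le> n"
  shows "norm (w j - P j x (w 0)) \<le> C3 * l powr (1 + \<alpha>) / (c powr (1 + \<alpha>)) ^ (n - j)"
proof -
  define D where "D = c powr (1 + \<alpha>)"
  have D: "1 \<le> D" "c \<le> D" "b < D"
    using c \<alpha> powr_mono[of 1 "1 + \<alpha>" c] by (auto simp: D_def)
  have C3: "0 \<le> C3" unfolding C3_def using K C K2 D by (simp add: D_def)
  \<comment> \<open>As long as the error estimate holds, the true vector is at most twice the bound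
    on its linear prediction, so it stays below \<delta> and \<open>step\<close> remains
    applicable.\<close>
  have w_le: "norm (w j) \<le> 2 * K2 * l / c ^ (n - j)"
    if j: "j \<le> n" and IH: "norm (w j - P j x (w 0)) \<le> C3 * l powr (1 + \<alpha>) / D ^ (n - j)" for j
  proof -
    have "C3 * l powr (1 + \<alpha>) / D ^ (n - j) \<le> C3 * l powr (1 + \<alpha>) / c ^ (n - j)"
      using C3 D c by (intro divide_left_mono power_mono) auto
    also have "\<dots> = (C3 * l powr \<alpha>) * l / c ^ (n - j)"
      using l by (simp add: powr_add)
    also have "\<dots> \<le> K2 * l / c ^ (n - j)"
      using small l c by (intro divide_right_mono mult_right_mono) auto
    finally have "norm (w j - P j x (w 0)) \<le> K2 * l / c ^ (n - j)" using IH by linarith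
    moreover have "norm (w j) \<le> norm (w j - P j x (w 0)) + norm (P j x (w 0))"
      by (metis diff_add_cancel norm_triangle_ineq)
    ultimately have "norm (w j) \<le> K2 * l / c ^ (n - j) + K2 * l / c ^ (n - j)"
      using lin[OF j] by linarith
    then show ?thesis by simp
  qed
  have "adapted_norm ((T ^^ j) x) (w j - P j x (w 0)) \<le> C3 * l powr (1 + \<alpha>) / D ^ (n - j)"
    using j
  proof (induction j)
    case 0
    have "adapted_norm x 0 \<le> 0" using adapted_norm_le[of x 0] by simp
    then show ?case using C3 D by (simp add: order_trans)
  next
    case (Suc j)
    let ?y = "(T ^^ j) x" and ?err = "w j - P j x (w 0)" and ?e = "w (Suc j) - A ((T ^^ j) x) (w j)"
    have IH: "adapted_norm ?y ?err \<le> C3 * l powr (1 + \<alpha>) / D ^ (n - j)" using Suc by simp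
    have wj: "norm (w j) \<le> 2 * K2 * l / c ^ (n - j)"
      using IH Suc.prems norm_le_adapted_norm[of ?err ?y] by (intro w_le) auto
    also have "\<dots> \<le> 2 * K2 * l / 1"
      using c K2 l by (intro divide_left_mono) auto
    finally have "norm (w j) \<le> \<delta>" using small by simp
    then have e: "norm ?e \<le> C * norm (w j) powr (1 + \<alpha>)" using Suc.prems by (intro step) auto
    also have "\<dots> \<le> C * (2 * K2 * l / c ^ (n - j)) powr (1 + \<alpha>)"
      using wj C \<alpha> by (intro mult_left_mono powr_mono2) auto
    also have "(2 * K2 * l / c ^ (n - j)) powr (1 + \<alpha>) =
        (2 * K2) powr (1 + \<alpha>) * l powr (1 + \<alpha>) / D ^ (n - j)"
    proof -
      have "(c ^ (n - j)) powr (1 + \<alpha>) = D ^ (n - j)"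
        using c by (simp add: D_def powr_powr mult.commute powr_realpow [symmetric])
      then show ?thesis using K2 l c by (simp add: powr_divide powr_mult)
    qed
    finally have e': "norm ?e \<le> C * ((2 * K2) powr (1 + \<alpha>) * l powr (1 + \<alpha>) / D ^ (n - j))" .
    have eq: "w (Suc j) - P (Suc j) x (w 0) = A ?y ?err + ?e"
      by (simp add: blinfun.diff_right)
    have "adapted_norm ((T ^^ Suc j) x) (w (Suc j) - P (Suc j) x (w 0)) \<le>
        adapted_norm (T ?y) (A ?y ?err) + adapted_norm (T ?y) ?e"
      unfolding eq using adapted_norm_triangle by simp
    also have "\<dots> \<le> b * (C3 * l powr (1 + \<alpha>) / D ^ (n - j)) +
        K * (C * ((2 * K2) powr (1 + \<alpha>) * l powr (1 + \<alpha>) / D ^ (n - j)))"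
    proof (rule add_mono)
      show "adapted_norm (T ?y) (A ?y ?err) \<le> b * (C3 * l powr (1 + \<alpha>) / D ^ (n - j))"
        using adapted_norm_step[of ?y ?err] mult_left_mono[OF IH, of b] b by linarith
      show "adapted_norm (T ?y) ?e \<le>
          K * (C * ((2 * K2) powr (1 + \<alpha>) * l powr (1 + \<alpha>) / D ^ (n - j)))"
        using adapted_norm_le[of "T ?y" ?e] mult_left_mono[OF e', of K] K by linarith
    qed
    also have "\<dots> = (b * C3 + K * C * (2 * K2) powr (1 + \<alpha>)) * (l powr (1 + \<alpha>) / D ^ (n - j))"
      by (simp add: algebra_simps)
    \<comment> \<open>\<open>C3\<close> is the fixed point of the recursion "old error times
      \<open>b\<close> plus new error, allowed to grow by \<open>D\<close>"; it exists because
      \<open>b < D\<close>.\<close>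
    also have "b * C3 + K * C * (2 * K2) powr (1 + \<alpha>) = D * C3"
    proof -
      have "C3 * (D - b) = K * C * (2 * K2) powr (1 + \<alpha>)"
        using D unfolding C3_def D_def[symmetric] by simp
      then show ?thesis by (simp add: algebra_simps)
    qed
    also have "D * C3 * (l powr (1 + \<alpha>) / D ^ (n - j)) = C3 * l powr (1 + \<alpha>) / D ^ (n - Suc j)"
    proof -
      have "n - j = Suc (n - Suc j)" using Suc.prems by simp
      then show ?thesis using D by simp
    qed
    finally show ?case .
  qed
  then show ?thesis
    using norm_le_adapted_norm[of "w j - P j x (w 0)" "(T ^^ j) x"] unfolding D_def by linarith
qed

end

text \<open>The base map is kept abstract because two instances are needed: the dynamics of the
  lifted curve and its inverse.\<close>

locale chord_dynamics = bounded_growth T A M K b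
  for T :: "real \<Rightarrow> real" and A M K b +
  fixes \<Gamma> :: "real \<Rightarrow> real \<times> real" and C \<alpha> \<delta> :: real
  assumes C: "0 \<le> C" and \<alpha>: "0 < \<alpha>"
    and chord: "norm (\<Gamma> y - \<Gamma> x) \<le> \<delta> \<Longrightarrow>
      norm ((\<Gamma> (T y) - \<Gamma> (T x)) - A x (\<Gamma> y - \<Gamma> x)) \<le> C * norm (\<Gamma> y - \<Gamma> x) powr (1 + \<alpha>)"
begin

text \<open>The bounds on \<open>u\<close> and \<open>s\<close> are those of images of unit vectors
  at times n and -n. At time n the \<open>u\<close> part of the chord has length \<open>l\<close>,
  the \<open>s\<close> part at most \<open>l / 2\<close> and the nonlinear error at most
  \<open>l / 4\<close>, which leaves \<open>l / 4\<close>.\<close>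

lemma expanded_chord:
  assumes c: "1 \<le> c" "b < c powr (1 + \<alpha>)" and K1: "1 \<le> K1" and l: "0 < l"
    and u: "\<And>j. j \<le> n \<Longrightarrow> norm (P j x u) \<le> K1 / c ^ (n - j)" "norm (P n x u) = 1"
    and s: "\<And>j. j \<le> n \<Longrightarrow> norm (P j x s) \<le> K1 / c ^ (n + j)"
    and n: "K1 / c ^ (2 * n) \<le> 1 / 2"
    and w: "\<Gamma> y - \<Gamma> x = p *\<^sub>R u + q *\<^sub>R s" "\<bar>p\<bar> = l" "\<bar>q\<bar> \<le> l"
    and small: "K * C * (4 * K1) powr (1 + \<alpha>) / (c powr (1 + \<alpha>) - b) * l powr \<alpha> \<le> 1 / 4"
      "4 * K1 * l \<le> \<delta>"
  shows "norm (\<Gamma> y - \<Gamma> x) \<le> 2 * K1 * l / c ^ n \<and>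
    l / 4 \<le> norm (\<Gamma> ((T ^^ n) y) - \<Gamma> ((T ^^ n) x))"
proof
  define C3 where "C3 = K * C * (4 * K1) powr (1 + \<alpha>) / (c powr (1 + \<alpha>) - b)"
  define w where "w j = \<Gamma> ((T ^^ j) y) - \<Gamma> ((T ^^ j) x)" for j
  have w0: "w 0 = p *\<^sub>R u + q *\<^sub>R s" by (simp add: w_def w(1))
  have lin: "norm (P j x (w 0)) \<le> 2 * K1 * l / c ^ (n - j)" if "j \<le> n" for j
  proof -
    have "norm (P j x (w 0)) \<le> \<bar>p\<bar> * norm (P j x u) + \<bar>q\<bar> * norm (P j x s)"
      unfolding w0 blinfun.add_right blinfun.scaleR_right
      by (rule order_trans[OF norm_triangle_ineq]) simp
    also have "\<dots> \<le> l * (K1 / c ^ (n - j)) + l * (K1 / c ^ (n - j))"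
    proof -
      have "K1 / c ^ (n + j) \<le> K1 / c ^ (n - j)"
        using K1 c by (intro divide_left_mono power_increasing) auto
      then have "norm (P j x s) \<le> K1 / c ^ (n - j)" using s[OF that] by linarith
      then show ?thesis
        using w(2,3) u(1)[OF that] l by (intro add_mono mult_mono) auto
    qed
    finally show ?thesis by (simp add: algebra_simps)
  qed
  show "norm (\<Gamma> y - \<Gamma> x) \<le> 2 * K1 * l / c ^ n"
    using lin[of 0] by (simp add: w_def)
  \<comment> \<open>Used with \<open>2 * K1\<close> in place of \<open>K2\<close>, since each
    coordinate contributes \<open>K1\<close>; hence the \<open>4 * K1\<close> in
    \<open>small\<close>.\<close>
  have "norm (w n - P n x (w 0)) \<le>
      K * C * (2 * (2 * K1)) powr (1 + \<alpha>) / (c powr (1 + \<alpha>) - b) * l powr (1 + \<alpha>) /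
      (c powr (1 + \<alpha>)) ^ (n - n)"
  proof (rule pseudo_orbit_follows_cocycle[where \<delta> = \<delta>])
    show "norm (w (Suc j) - A ((T ^^ j) x) (w j)) \<le> C * norm (w j) powr (1 + \<alpha>)"
      if "norm (w j) \<le> \<delta>" for j
      using chord[of "(T ^^ j) y" "(T ^^ j) x"] that by (simp add: w_def)
    show "norm (P j x (w 0)) \<le> 2 * K1 * l / c ^ (n - j)" if "j \<le> n" for j
      using that by (rule lin)
    show "K * C * (2 * (2 * K1)) powr (1 + \<alpha>) / (c powr (1 + \<alpha>) - b) * l powr \<alpha> \<le> 2 * K1"
      unfolding mult.assoc[symmetric, of 2 2 K1] using order_trans[OF small(1), of "2 * K1"] K1
      by simp
  qed (use C \<alpha> c K1 l small(2) in auto)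
  also have "\<dots> = C3 * l powr \<alpha> * l" using l by (simp add: powr_add C3_def)
  also have "\<dots> \<le> 1 / 4 * l"
    using small l unfolding C3_def by (intro mult_right_mono) auto
  finally have 1: "norm (w n - P n x (w 0)) \<le> l / 4" by simp
  have "l - l / 2 \<le> norm (p *\<^sub>R P n x u) - norm (q *\<^sub>R P n x s)"
  proof -
    have "norm (P n x s) \<le> 1 / 2" using order_trans[OF s[of n] n[unfolded mult_2]] by simp
    then have "\<bar>q\<bar> * norm (P n x s) \<le> l * (1 / 2)"
      using w(2,3) by (intro mult_mono) auto
    then show ?thesis using u(2) w(2) by simp
  qed
  also have "\<dots> \<le> norm (P n x (w 0))"
    unfolding w0 blinfun.add_right blinfun.scaleR_right by (rule norm_diff_ineq)
  finally have "l / 2 \<le> norm (P n x (w 0))" by simp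
  moreover have "norm (P n x (w 0)) \<le> norm (w n - P n x (w 0)) + norm (w n)"
    using norm_triangle_sub[of "P n x (w 0)" "w n"] by (simp add: norm_minus_commute)
  ultimately show "l / 4 \<le> norm (\<Gamma> ((T ^^ n) y) - \<Gamma> ((T ^^ n) x))"
    using 1 by (simp add: w_def)
qed

end

text \<open>
  Two of the long arcs that occur within \<open>L\<close> steps are disjoint modulo \<open>\<int>\<close>, since their
  short preimages are.
\<close>

lemma card_long_image_arcs_le:
  fixes z :: "nat \<Rightarrow> real" and G :: "real \<Rightarrow> real"
  assumes G: "strict_mono G" "\<And>t p. p \<in> \<int> \<Longrightarrow> G (t + p) = G t + p"
    and Q: "1 \<le> d * real Q" and L: "0 < L" and D: "D \<subseteq> {..<N}"
    and arcs: "\<And>i. i \<in> D \<Longrightarrow> \<exists>y. y - z i \<le> \<tau> \<and> d \<le> G y - G (z i)"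
    and separated: "\<And>i j p. i < j \<Longrightarrow> j < i + L \<Longrightarrow> p \<in> \<int> \<Longrightarrow> \<tau> < \<bar>z j - z i - p\<bar>"
  shows "card D \<le> (N div L + 1) * Q"
proof (rule ccontr)
  assume "\<not> ?thesis"
  then have big: "(N div L + 1) * Q < card D" by simp
  have Q0: "0 < Q" using Q by (cases Q) auto
  \<comment> \<open>Pigeonhole: the first component is the block of \<open>L\<close> consecutive
    times, the second the cell of length 1 / \<open>Q\<close>, at most \<open>d\<close>, that
    contains \<open>G (z i)\<close> modulo 1.\<close>
  define k where "k i = (i div L, nat \<lfloor>frac (G (z i)) * Q\<rfloor>)" for i
  have fr: "0 \<le> frac (G (z i)) * Q" "frac (G (z i)) * Q < Q" for i
    using Q0 by (auto simp: frac_ge_0 frac_lt_1)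
  have "k ` D \<subseteq> {..N div L} \<times> {..<Q}"
  proof
    fix a assume "a \<in> k ` D"
    then obtain i where i: "i \<in> D" "a = k i" by auto
    have "i div L \<le> N div L" using i D by (intro div_le_mono) auto
    moreover have "nat \<lfloor>frac (G (z i)) * Q\<rfloor> < Q" using fr[of i] Q0 by linarith
    ultimately show "a \<in> {..N div L} \<times> {..<Q}" using i by (simp add: k_def)
  qed
  then have "card (k ` D) \<le> card ({..N div L} \<times> {..<Q})" by (intro card_mono) auto
  also have "\<dots> < card D" using big by (simp add: card_cartesian_product)
  finally have "\<not> inj_on k D" using card_image by fastforce
  then obtain i j where ij: "i \<in> D" "j \<in> D" "i \<noteq> j" "k i = k j" by (auto simp: inj_on_def)
  have near: "\<bar>int i - int j\<bar> < int L"
  proof -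
    have "i div L = j div L" using ij by (simp add: k_def)
    moreover have "i = L * (i div L) + i mod L" "j = L * (j div L) + j mod L" by simp_all
    moreover have "i mod L < L" "j mod L < L" using L by simp_all
    ultimately show ?thesis by (smt (verit) of_nat_add of_nat_less_iff of_nat_0_le_iff)
  qed
  have frac_near: "\<bar>frac (G (z i)) - frac (G (z j))\<bar> < d"
  proof -
    have "nat \<lfloor>frac (G (z i)) * Q\<rfloor> = nat \<lfloor>frac (G (z j)) * Q\<rfloor>" using ij by (simp add: k_def)
    then have "\<lfloor>frac (G (z i)) * Q\<rfloor> = \<lfloor>frac (G (z j)) * Q\<rfloor>"
      using fr(1)[of i] fr(1)[of j] by (metis floor_mono floor_zero nat_0_le)
    then have "\<bar>frac (G (z i)) * Q - frac (G (z j)) * Q\<bar> < 1" by linarith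
    then have "\<bar>frac (G (z i)) - frac (G (z j))\<bar> * Q < 1"
      by (simp flip: left_diff_distrib add: abs_mult)
    then have "\<bar>frac (G (z i)) - frac (G (z j))\<bar> * Q < d * Q" using Q by linarith
    then show ?thesis using Q0 by simp
  qed
  \<comment> \<open>The long arc that starts at \<open>G (z i)\<close> covers an integer translate
    of \<open>G (z j)\<close>. Monotonicity of \<open>G\<close> pulls this back into the short arc,
    so the two points are within \<tau> modulo an integer.\<close>
  have contra: False if ij: "i \<in> D" "i \<noteq> j" "\<bar>int i - int j\<bar> < int L"
    and le: "frac (G (z i)) \<le> frac (G (z j))" "frac (G (z j)) - frac (G (z i)) < d" for i j
  proof -
    define p :: real where "p = of_int (\<lfloor>G (z i)\<rfloor> - \<lfloor>G (z j)\<rfloor>)"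
    have p: "p \<in> \<int>" by (simp add: p_def)
    obtain y where y: "y - z i \<le> \<tau>" "d \<le> G y - G (z i)" using arcs[OF ij(1)] by blast
    have "G (z j + p) = G (z i) + (frac (G (z j)) - frac (G (z i)))"
      using G(2)[OF p, of "z j"] by (simp add: p_def frac_def)
    then have "G (z i) \<le> G (z j + p)" "G (z j + p) < G y" using le y by linarith+
    then have 1: "z i \<le> z j + p" "z j + p < y"
      using G(1) by (simp_all add: strict_mono_less strict_mono_less_eq)
    then have abs: "\<bar>z j - z i - (- p)\<bar> \<le> \<tau>" "\<bar>z i - z j - p\<bar> \<le> \<tau>" using y by linarith+
    consider "i < j" "j < i + L" | "j < i" "i < j + L" using ij(2,3) by linarith
    then show False
    proof cases
      case 1 then show ?thesis using separated[of i j "- p"] p abs by simp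
    next
      case 2 then show ?thesis using separated[of j i p] p abs by simp
    qed
  qed
  show False
    using contra[of i j] contra[of j i] ij near frac_near by linarith
qed

section \<open>Slow times of an almost extremal orbit segment\<close>

context bounded_growth
begin

text \<open>A slow time lowers the rate from \<nu> + \<epsilon>/32 to \<nu> - \<epsilon>/2, a loss
  of more than \<epsilon>/2. The excess available per step is \<epsilon>/32, and \<open>N\<close> is
  so large that the constants cost at most another \<epsilon>/32 per step. The proportion of slow
  times is thus at most (\<epsilon>/16) / (\<epsilon>/2) = 1/8.\<close>

lemma few_slow_times:
  assumes \<nu>: "0 \<le> \<nu>" and \<epsilon>: "0 < \<epsilon>" and b: "b = exp (\<nu> + \<epsilon> / 32)" and n0: "0 < n\<^sub>0"
    and n0_large: "2 * ln K \<le> \<epsilon> * n\<^sub>0"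
    and N: "32 * (ln 2 + ln K + \<epsilon> * m) \<le> \<epsilon> * N"
    and x: "exp \<nu> ^ N \<le> 2 * norm (P N x)"
  shows "8 * card (slow_times (exp (\<nu> - \<epsilon>)) n\<^sub>0 m N x) \<le> N"
proof -
  define q where "q = exp (\<nu> - \<epsilon> / 2)"
  define k where "k = card (slow_times (exp (\<nu> - \<epsilon>)) n\<^sub>0 m N x)"
  have K0: "0 < K" using K by simp
  have "norm (P N x) \<le> K * b ^ N * (q / b) ^ k * (b / q) ^ m"
    unfolding k_def
  proof (rule norm_P_slow)
    show "0 < q" "q \<le> b" using \<epsilon> by (simp_all add: q_def b)
    show "0 < n\<^sub>0" by (rule n0)
    \<comment> \<open>The intermediate rate \<open>q\<close> leaves a factor exp (\<epsilon>/2) per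
      step over the slow rate, and \<open>n\<^sub>0\<close> is long enough for this to absorb
      \<open>K\<close>.\<close>
    fix l assume l: "n\<^sub>0 \<le> l"
    have "\<epsilon> * n\<^sub>0 \<le> \<epsilon> * l" using l \<epsilon> by (intro mult_left_mono) auto
    then have "ln K \<le> real l * (\<epsilon> / 2)" using n0_large by (simp add: mult.commute)
    then have "K \<le> exp (real l * (\<epsilon> / 2))"
      using K0 by (metis exp_le_cancel_iff exp_ln)
    then have "K * exp (\<nu> - \<epsilon>) ^ l \<le> exp (\<epsilon> / 2) ^ l * exp (\<nu> - \<epsilon>) ^ l"
      by (intro mult_right_mono) (simp_all flip: exp_of_nat_mult)
    also have "\<dots> = q ^ l"
      by (simp add: q_def flip: power_mult_distrib exp_add)
    finally show "K * exp (\<nu> - \<epsilon>) ^ l \<le> q ^ l" .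
  qed
  also have "\<dots> = exp (ln K + N * (\<nu> + \<epsilon> / 32) + k * (- (\<epsilon> / 2 + \<epsilon> / 32)) + m * (\<epsilon> / 2 + \<epsilon> / 32))"
  proof -
    have "q / b = exp (- (\<epsilon> / 2 + \<epsilon> / 32))" "b / q = exp (\<epsilon> / 2 + \<epsilon> / 32)"
      by (simp_all add: q_def b flip: exp_diff)
    then show ?thesis
      unfolding exp_add exp_of_nat_mult b using K0 by simp
  qed
  finally have "exp (N * \<nu>) \<le>
      exp (ln 2 + (ln K + N * (\<nu> + \<epsilon> / 32) + k * (- (\<epsilon> / 2 + \<epsilon> / 32)) + m * (\<epsilon> / 2 + \<epsilon> / 32)))"
    using x by (subst exp_add) (simp add: exp_of_nat_mult)
  then have "N * \<nu> \<le>
      ln 2 + (ln K + N * (\<nu> + \<epsilon> / 32) + k * (- (\<epsilon> / 2 + \<epsilon> / 32)) + m * (\<epsilon> / 2 + \<epsilon> / 32))"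
    by simp
  then have 1: "k * (\<epsilon> / 2) + k * (\<epsilon> / 32) \<le> ln 2 + ln K + N * (\<epsilon> / 32) + m * (\<epsilon> / 2 + \<epsilon> / 32)"
    by (simp add: algebra_simps)
  have 2: "m * (\<epsilon> / 2 + \<epsilon> / 32) \<le> \<epsilon> * m" using \<epsilon> by (simp add: algebra_simps)
  have "k * (\<epsilon> / 2) \<le> ln 2 + ln K + N * (\<epsilon> / 32) + \<epsilon> * m" 
  proof -
    have "0 \<le> k * (\<epsilon> / 32)" using \<epsilon> by simp
    then show ?thesis using 1 2 by linarith
  qed
  also have "\<dots> \<le> N * (\<epsilon> / 16)" using N by (simp add: algebra_simps)
  finally have "\<epsilon> * (8 * k) \<le> \<epsilon> * N" by (simp add: algebra_simps)
  then show ?thesis using \<epsilon> by (simp add: k_def)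
qed

end

section \<open>Invariant curves\<close>

text \<open>The situation on the universal cover: \<open>H\<close> lifts the projected dynamics,
  \<open>\<Gamma>\<close> parametrizes the lifted graph by its abscissa, and \<open>A t\<close> is
  the derivative at \<open>\<Gamma> t\<close>. Irrationality appears as \<open>separated\<close>: no
  close returns within a bounded number of steps.\<close>

locale invariant_curve = sympl_cocycle H A M for H :: "real \<Rightarrow> real" and A M +
  fixes H' :: "real \<Rightarrow> real" and \<Gamma> :: "real \<Rightarrow> real \<times> real" and C \<alpha> \<delta> :: real
  assumes H'_H [simp]: "H' (H t) = t" and H_H' [simp]: "H (H' t) = t"
    and strict_mono_H: "strict_mono H"
    and H_add_Int: "p \<in> \<int> \<Longrightarrow> H (t + p) = H t + p"
    and unif_cont_H': "uniformly_continuous_on UNIV H'"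
    and separated: "\<exists>\<tau>>0. \<forall>l t p. 0 < l \<longrightarrow> l < L \<longrightarrow> p \<in> \<int> \<longrightarrow> \<tau> < \<bar>(H ^^ l) t - t - p\<bar>"
    and unif_cont_\<Gamma>: "uniformly_continuous_on UNIV \<Gamma>"
    and fst_\<Gamma> [simp]: "fst (\<Gamma> t) = t" and \<Gamma>_add_1: "\<Gamma> (t + 1) = \<Gamma> t + (1, 0)"
    and C: "0 \<le> C" and \<alpha>: "0 < \<alpha>" and \<delta>: "0 < \<delta>"
    and chord: "norm (\<Gamma> y - \<Gamma> x) \<le> \<delta> \<Longrightarrow>
      norm ((\<Gamma> (H y) - \<Gamma> (H x)) - A x (\<Gamma> y - \<Gamma> x)) \<le> C * norm (\<Gamma> y - \<Gamma> x) powr (1 + \<alpha>)"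
begin

definition A' where "A' t = sympl_inv (A (H' t))"

lemma sympl_cocycle': "sympl_cocycle A' M"
  by unfold_locales
    (simp_all add: A'_def sympl_map_inv sympl_inv_norm sympl norm_le_M)

abbreviation P' where "P' \<equiv> cocycle H' A'"

lemma funpow_inverse [simp]: "(H' ^^ n) ((H ^^ n) t) = t" "(H ^^ n) ((H' ^^ n) t) = t"
proof (induction n arbitrary: t)
  case (Suc n)
  { case 1 show ?case by (subst funpow_Suc_right) (simp add: Suc) }
  { case 2 show ?case by (subst funpow_Suc_right) (simp add: Suc) }
qed simp_all

lemma funpow_inverse_le:
  assumes "j \<le> n"
  shows "(H' ^^ j) ((H ^^ n) t) = (H ^^ (n - j)) t" "(H ^^ j) ((H' ^^ n) t) = (H' ^^ (n - j)) t"
proof -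
  have n: "n = j + (n - j)" using assms by simp
  show "(H' ^^ j) ((H ^^ n) t) = (H ^^ (n - j)) t"
    by (subst n, subst funpow_add) simp
  show "(H ^^ j) ((H' ^^ n) t) = (H' ^^ (n - j)) t"
    by (subst n, subst funpow_add) simp
qed

lemma P'_P: "P' n ((H ^^ n) t) (P n t v) = v"
proof (induction n)
  case (Suc n)
  have "P' (Suc n) ((H ^^ Suc n) t) (P (Suc n) t v) = P' n ((H ^^ n) t) (P n t v)"
    unfolding cocycle_Suc_right[of H'] by (simp add: A'_def sympl_inv_left sympl)
  then show ?case by (simp only: Suc)
qed simp

lemma P_P': "P n ((H' ^^ n) t) (P' n t v) = v"
proof (induction n)
  case (Suc n)
  have "P (Suc n) ((H' ^^ Suc n) t) (P' (Suc n) t v) = P n ((H' ^^ n) t) (P' n t v)"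
    unfolding cocycle_Suc_right[of H] by (simp add: A'_def sympl_inv_right sympl)
  then show ?case by (simp only: Suc)
qed simp

text \<open>A symplectic map and its inverse have equal norms. Hence the inverse cocycle obeys the
  same growth bounds, and an orbit segment that is almost extremal forwards is so backwards from its
  other end.\<close>

lemma norm_P': "norm (P' n t) = norm (P n ((H' ^^ n) t))"
proof (rule antisym)
  show "norm (P' n t) \<le> norm (P n ((H' ^^ n) t))"
    by (rule norm_right_inverse_le[OF sympl_P P_P'])
  show "norm (P n ((H' ^^ n) t)) \<le> norm (P' n t)"
    using norm_right_inverse_le[OF sympl_cocycle.sympl_P[OF sympl_cocycle'], of H' n t "P n ((H' ^^ n) t)"]
      P'_P[of n "(H' ^^ n) t"] by simp
qed

lemma P_P'_le:
  assumes "j \<le> n"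
  shows "P j x (P' n ((H ^^ n) x) v) = P' (n - j) ((H ^^ n) x) v"
proof -
  have "P' n ((H ^^ n) x) = P' j ((H ^^ j) x) o\<^sub>L P' (n - j) ((H ^^ n) x)"
    using cocycle_add[of H' A' j "n - j" "(H ^^ n) x"] funpow_inverse_le(1)[of "n - j" n x] assms
    by simp
  then show ?thesis using P_P'[of j "(H ^^ j) x"] by simp
qed

lemma P'_P_le:
  assumes "j \<le> n"
  shows "P' j x (P n ((H' ^^ n) x) v) = P (n - j) ((H' ^^ n) x) v"
proof -
  have "P n ((H' ^^ n) x) = P j ((H' ^^ j) x) o\<^sub>L P (n - j) ((H' ^^ n) x)"
    using cocycle_add[of H A j "n - j" "(H' ^^ n) x"] funpow_inverse_le(2)[of "n - j" n x] assms
    by simp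
  then show ?thesis using P'_P[of j "(H' ^^ j) x"] by simp
qed

lemma strict_mono_H': "strict_mono H'"
  by (rule strict_monoI) (metis H_H' strict_mono_H strict_mono_less)

lemma H'_add_Int: "p \<in> \<int> \<Longrightarrow> H' (t + p) = H' t + p"
  by (metis H'_H H_H' H_add_Int)

lemma strict_mono_funpow: "strict_mono (H ^^ n)" "strict_mono (H' ^^ n)"
  using strict_mono_H strict_mono_H' by (induction n) (auto simp: strict_mono_def)

lemma funpow_add_Int:
  "p \<in> \<int> \<Longrightarrow> (H ^^ n) (t + p) = (H ^^ n) t + p" "p \<in> \<int> \<Longrightarrow> (H' ^^ n) (t + p) = (H' ^^ n) t + p"
  by (induction n) (simp_all add: H_add_Int H'_add_Int)

lemma le_norm_chord: "\<bar>y - x\<bar> \<le> norm (\<Gamma> y - \<Gamma> x)"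
proof -
  have "norm (fst z) \<le> norm z" for z :: "real \<times> real"
    by (metis norm_fst_le prod.collapse)
  from this[of "\<Gamma> y - \<Gamma> x"] show ?thesis by simp
qed

text \<open>The linearization is inverted. Its error is given in terms of the chord at the preimages
  and has to be rewritten in terms of the chord itself; this needs
  \<open>norm w \<le> 2 * M * norm w'\<close>, obtained by absorbing the error into half of
  \<open>norm w\<close>. The absorption requires \<open>w\<close> to be small beforehand, which
  uniform continuity of \<open>H'\<close> and \<open>\<Gamma>\<close> provides.\<close>

lemma chord':
  obtains C' \<delta>' where "0 \<le> C'" "0 < \<delta>'"
    "\<And>x y. norm (\<Gamma> y - \<Gamma> x) \<le> \<delta>' \<Longrightarrow>
      norm ((\<Gamma> (H' y) - \<Gamma> (H' x)) - A' x (\<Gamma> y - \<Gamma> x)) \<le> C' * norm (\<Gamma> y - \<Gamma> x) powr (1 + \<alpha>)"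
proof -
  have M: "1 \<le> M" by (rule M_ge_1)
  \<comment> \<open>The second bound makes \<open>M * C * r powr \<alpha>\<close> at most 1/2;
    \<open>C + 1\<close> occurs because \<open>C\<close> may be 0.\<close>
  define \<eta> where "\<eta> = min \<delta> ((1 / (2 * M * (C + 1))) powr (1 / \<alpha>))"
  have \<eta>: "0 < \<eta>" using \<delta> M C by (simp add: \<eta>_def)
  have small: "M * C * r powr \<alpha> \<le> 1 / 2" if "0 \<le> r" "r \<le> \<eta>" for r
  proof -
    have "r powr \<alpha> \<le> ((1 / (2 * M * (C + 1))) powr (1 / \<alpha>)) powr \<alpha>"
      using that \<alpha> by (intro powr_mono2) (auto simp: \<eta>_def)
    also have "\<dots> = 1 / (2 * M * (C + 1))" using \<alpha> M C by (simp add: powr_powr)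
    finally have "M * C * r powr \<alpha> \<le> M * C * (1 / (2 * M * (C + 1)))"
      using M C by (intro mult_left_mono) auto
    also have "\<dots> \<le> 1 / 2" using M C by (simp add: divide_simps)
    finally show ?thesis .
  qed
  obtain d where d: "0 < d" "\<And>x y. dist y x < d \<Longrightarrow> dist (\<Gamma> y) (\<Gamma> x) < \<eta>"
    using unif_cont_\<Gamma> \<eta> unfolding uniformly_continuous_on_def by blast
  obtain d' where d': "0 < d'" "\<And>x y. dist y x < d' \<Longrightarrow> dist (H' y) (H' x) < d"
    using unif_cont_H' d(1) unfolding uniformly_continuous_on_def by blast
  show ?thesis
  proof
    show "0 \<le> M * C * (2 * M) powr (1 + \<alpha>)" using M C by simp
    show "0 < d' / 2" using d' by simp
    fix x y
    define w where "w = \<Gamma> (H' y) - \<Gamma> (H' x)"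
    define w' where "w' = \<Gamma> y - \<Gamma> x"
    define e where "e = w' - A (H' x) w"
    assume "norm (\<Gamma> y - \<Gamma> x) \<le> d' / 2"
    then have "dist y x < d'" using le_norm_chord[of y x] d'(1) by (simp add: dist_real_def)
    then have w: "norm w \<le> \<eta>"
      using d(2)[OF d'(2)] by (simp add: w_def dist_norm less_imp_le)
    then have e: "norm e \<le> C * norm w powr (1 + \<alpha>)"
      using chord[of "H' y" "H' x"] by (simp add: e_def w_def w'_def \<eta>_def)
    have "A' x w' = w + A' x e"
      by (simp add: A'_def e_def blinfun.diff_right sympl_inv_left sympl)
    then have err: "w - A' x w' = - A' x e" by simp
    have "norm (A' x e) \<le> M * (C * norm w powr (1 + \<alpha>))"
      using norm_blinfun[of "A' x" e] e M sympl_cocycle.norm_le_M[OF sympl_cocycle', of x]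
      by (meson mult_mono norm_ge_zero order_trans zero_le_one)
    then have err': "norm (w - A' x w') \<le> M * C * norm w powr (1 + \<alpha>)"
      by (simp add: err)
    have w_le: "norm w \<le> 2 * M * norm w'"
    proof -
      have "norm w \<le> norm (A' x w') + norm (w - A' x w')"
        by (metis add.commute diff_add_cancel norm_triangle_ineq)
      also have "norm (A' x w') \<le> M * norm w'"
        using norm_blinfun[of "A' x" w'] sympl_cocycle.norm_le_M[OF sympl_cocycle', of x]
        by (meson mult_right_mono norm_ge_zero order_trans)
      also have "norm (w - A' x w') \<le> (M * C * norm w powr \<alpha>) * norm w"
        using err' by (cases "w = 0") (simp_all add: powr_add mult_ac)
      also have "(M * C * norm w powr \<alpha>) * norm w \<le> 1 / 2 * norm w"
        using w by (intro mult_right_mono small) auto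
      finally show ?thesis by simp
    qed
    have "norm w powr (1 + \<alpha>) \<le> (2 * M * norm w') powr (1 + \<alpha>)"
      using w_le \<alpha> by (intro powr_mono2) auto
    then have "M * C * norm w powr (1 + \<alpha>) \<le> M * C * ((2 * M) powr (1 + \<alpha>) * norm w' powr (1 + \<alpha>))"
      using M C by (intro mult_left_mono) (simp_all add: powr_mult)
    then show "norm ((\<Gamma> (H' y) - \<Gamma> (H' x)) - A' x (\<Gamma> y - \<Gamma> x)) \<le>
        M * C * (2 * M) powr (1 + \<alpha>) * norm (\<Gamma> y - \<Gamma> x) powr (1 + \<alpha>)"
      using err' by (simp add: w_def w'_def mult.assoc)
  qed
qed

text \<open>One contracted direction starts n steps before \<open>x\<close>, the other n steps after
  it, and both are carried to \<open>x\<close>. A chord dominated by \<open>vu\<close> becomes long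
  n steps later, one dominated by \<open>vs\<close> n steps earlier; hence the disjunction.\<close>

lemma long_arc:
  assumes cd: "chord_dynamics H A M K b \<Gamma> C\<^sub>1 \<alpha> \<delta>\<^sub>1" "chord_dynamics H' A' M K b \<Gamma> C\<^sub>1 \<alpha> \<delta>\<^sub>1"
    and a: "1 < a" "a \<le> b" and c: "1 < a\<^sup>2 / b" "b < (a\<^sup>2 / b) powr (1 + \<alpha>)"
    and k: "0 < \<kappa>" "\<kappa> \<le> 1"
    and lower: "\<And>l. l \<le> 2 * n \<Longrightarrow> \<kappa> * a ^ l \<le> norm (P l ((H' ^^ n) x))"
      "\<And>l. l \<le> 2 * n \<Longrightarrow> \<kappa> * a ^ l \<le> norm (P' l ((H ^^ n) x))"
  defines "c \<equiv> a\<^sup>2 / b"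
  defines "K1 \<equiv> 1 / \<kappa> + M * K / (\<kappa>\<^sup>2 * (1 - 1 / a\<^sup>2))"
  assumes l: "0 < l" "2 * K1 * l \<le> 1"
      "K * C\<^sub>1 * (4 * K1) powr (1 + \<alpha>) / (c powr (1 + \<alpha>) - b) * l powr \<alpha> \<le> 1 / 4"
      "4 * K1 * l \<le> \<delta>\<^sub>1"
    and n: "K1 / c ^ (2 * n) \<le> 1 / 2" "2 * K1 * l / c ^ n \<le> \<tau>"
    and d: "\<And>s t. \<bar>t - s\<bar> < d \<Longrightarrow> norm (\<Gamma> t - \<Gamma> s) < l / 4"
  shows "\<exists>y. y - x \<le> \<tau> \<and>
    (d \<le> (H ^^ n) y - (H ^^ n) x \<or> d \<le> (H' ^^ n) y - (H' ^^ n) x)"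
proof -
  interpret F: chord_dynamics H A M K b \<Gamma> C\<^sub>1 \<alpha> \<delta>\<^sub>1 by (rule cd)
  interpret B: chord_dynamics H' A' M K b \<Gamma> C\<^sub>1 \<alpha> \<delta>\<^sub>1 by (rule cd)
  have c1: "1 < c" using c by (simp add: c_def)
  have K1: "1 \<le> K1"
  proof -
    have "1 \<le> 1 / \<kappa>" using k by simp
    moreover have "0 \<le> M * K / (\<kappa>\<^sup>2 * (1 - 1 / a\<^sup>2))"
      using M_ge_1 F.K a k by (intro divide_nonneg_nonneg mult_nonneg_nonneg) auto
    ultimately show ?thesis unfolding K1_def by linarith
  qed
  have rate: "K1 * (b / a\<^sup>2) ^ l = K1 / c ^ l" for l
    by (simp add: c_def power_divide)
  let ?xm = "(H' ^^ n) x" and ?xp = "(H ^^ n) x"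
  obtain s where s: "norm s = 1" "\<And>l. l \<le> 2 * n \<Longrightarrow> norm (P l ?xm s) \<le> K1 / c ^ l"
    using F.contracted_vector_upto[OF a k(1) lower(1)] unfolding K1_def[symmetric] rate by blast
  obtain u where u: "norm u = 1" "\<And>l. l \<le> 2 * n \<Longrightarrow> norm (P' l ?xp u) \<le> K1 / c ^ l"
    using B.contracted_vector_upto[OF a k(1) lower(2)] unfolding K1_def[symmetric] rate by blast
  define vs where "vs = P n ?xm s"
  define vu where "vu = P' n ?xp u"
  have P_vu: "P j x vu = P' (n - j) ?xp u" if "j \<le> n" for j
    unfolding vu_def by (rule P_P'_le[OF that])
  have P'_vs: "P' j x vs = P (n - j) ?xm s" if "j \<le> n" for j
    unfolding vs_def by (rule P'_P_le[OF that])
  have P_vs: "P j x vs = P (n + j) ?xm s" for j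
    using cocycle_add[of H A j n ?xm] by (simp add: vs_def add.commute)
  have P'_vu: "P' j x vu = P' (n + j) ?xp u" for j
    using cocycle_add[of H' A' j n ?xp] by (simp add: vu_def add.commute)
  \<comment> \<open>Were they parallel, going forward along \<open>s\<close> for 2n steps and back
    along \<open>u\<close> would each shrink the vector to at most half, although the round trip is
    the identity.\<close>
  have indep: "sympl_form vu vs \<noteq> 0"
  proof
    assume 0: "sympl_form vu vs = 0"
    define z where "z = P (2 * n) ?xm s"
    have z_le: "norm z \<le> 1 / 2" using order_trans[OF s(2)[of "2 * n"] n(1)] by (simp add: z_def)
    have s_eq: "P' (2 * n) ?xp z = s"
      using P'_P[of "2 * n" ?xm s] funpow_inverse_le(2)[of n "2 * n" x]
      by (simp add: z_def mult_2 funpow_add)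
    have "sympl_form u z = sympl_form (P n x vu) (P n x vs)"
      using P_vu[of n] P_vs[of n] by (simp add: z_def mult_2)
    then have "sympl_form u z = 0" using 0 by (simp add: sympl_mapD[OF sympl_P])
    then have "z = (u \<bullet> z) *\<^sub>R u"
      using orthonormal_expand[OF u(1), of z] by (simp flip: zero_prod_def)
    then have "s = (u \<bullet> z) *\<^sub>R P' (2 * n) ?xp u"
      using s_eq by (metis blinfun.scaleR_right)
    then have "1 = \<bar>u \<bullet> z\<bar> * norm (P' (2 * n) ?xp u)" using s(1) by (metis norm_scaleR)
    also have "\<dots> \<le> (1 / 2) * (1 / 2)"
      using order_trans[OF u(2)[of "2 * n"] n(1)] z_le Cauchy_Schwarz_ineq2[of u z] u(1)
      by (intro mult_mono) auto
    finally show False by simp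
  qed
  define p where "p y = sympl_form (\<Gamma> y - \<Gamma> x) vs / sympl_form vu vs" for y
  define q where "q y = sympl_form vu (\<Gamma> y - \<Gamma> x) / sympl_form vu vs" for y
  have w: "\<Gamma> y - \<Gamma> x = p y *\<^sub>R vu + q y *\<^sub>R vs" for y
  proof -
    have "sympl_form vu vs *\<^sub>R (\<Gamma> y - \<Gamma> x) = sympl_form vu vs *\<^sub>R (p y *\<^sub>R vu + q y *\<^sub>R vs)"
      using indep sympl_form_expand[of vu vs "\<Gamma> y - \<Gamma> x"]
      by (simp add: p_def q_def scaleR_add_right del: sympl_form_linear)
    then show ?thesis using indep by simp
  qed
  have cont_\<Gamma>: "continuous_on S \<Gamma>" for S
    using unif_cont_\<Gamma> uniformly_continuous_imp_continuous continuous_on_subset by blast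
  \<comment> \<open>At \<open>y = x\<close> both coordinates vanish. At \<open>y = x + 1\<close> the
    curve has closed up and the chord is (1, 0); as the basis vectors have norm at most
    \<open>K1\<close>, some coordinate is at least 1 / (2 \<open>K1\<close>), hence at least
    \<open>l\<close>.\<close>
  have "\<exists>y\<ge>x. y \<le> x + 1 \<and> max \<bar>p y\<bar> \<bar>q y\<bar> = l"
  proof (rule IVT')
    show "max \<bar>p x\<bar> \<bar>q x\<bar> \<le> l" using l by (simp add: p_def q_def sympl_form_def)
    show "l \<le> max \<bar>p (x + 1)\<bar> \<bar>q (x + 1)\<bar>"
    proof -
      let ?m = "max \<bar>p (x + 1)\<bar> \<bar>q (x + 1)\<bar>"
      have small: "norm vu \<le> K1" "norm vs \<le> K1"
      proof -
        have "K1 / c ^ n \<le> K1 / 1" using c1 K1 by (intro divide_left_mono) auto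
        then show "norm vu \<le> K1" "norm vs \<le> K1"
          using u(2)[of n] s(2)[of n] unfolding vu_def vs_def by linarith+
      qed
      have "1 = norm (\<Gamma> (x + 1) - \<Gamma> x)" by (simp add: \<Gamma>_add_1)
      also have "\<dots> \<le> \<bar>p (x + 1)\<bar> * norm vu + \<bar>q (x + 1)\<bar> * norm vs"
        unfolding w by (rule order_trans[OF norm_triangle_ineq]) simp
      also have "\<dots> \<le> ?m * K1 + ?m * K1"
        using small by (intro add_mono mult_mono) auto
      finally have "2 * K1 * l \<le> 2 * K1 * ?m" using l(2) by simp
      then show ?thesis using K1 by simp
    qed
    show "continuous_on {x..x + 1} (\<lambda>y. max \<bar>p y\<bar> \<bar>q y\<bar>)"
      unfolding p_def q_def sympl_form_def using indep
      by (intro continuous_intros cont_\<Gamma>) (auto simp: sympl_form_def)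
  qed simp
  then obtain y where y: "x \<le> y" "max \<bar>p y\<bar> \<bar>q y\<bar> = l" by blast
  have long: "d \<le> G y - G x"
    if "strict_mono G" "l / 4 \<le> norm (\<Gamma> (G y) - \<Gamma> (G x))" for G
  proof -
    have "G x \<le> G y" using that(1) y(1) by (simp add: strict_mono_less_eq)
    moreover have "d \<le> \<bar>G y - G x\<bar>" using d[of "G y" "G x"] that(2) by linarith
    ultimately show ?thesis by linarith
  qed
  consider "\<bar>p y\<bar> = l" "\<bar>q y\<bar> \<le> l" | "\<bar>q y\<bar> = l" "\<bar>p y\<bar> \<le> l" using y(2) by linarith
  then show ?thesis
  proof cases
    case 1
    have "norm (\<Gamma> y - \<Gamma> x) \<le> 2 * K1 * l / c ^ n \<and> l / 4 \<le> norm (\<Gamma> ((H ^^ n) y) - \<Gamma> ((H ^^ n) x))"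
    proof (rule F.expanded_chord[where u = vu and s = vs])
      show "norm (P n x vu) = 1" using P_vu[of n] u(1) by simp
      show "norm (P j x vu) \<le> K1 / c ^ (n - j)" if "j \<le> n" for j using P_vu[OF that] u(2) by simp
      show "norm (P j x vs) \<le> K1 / c ^ (n + j)" if "j \<le> n" for j using P_vs s(2) that by simp
      show "\<Gamma> y - \<Gamma> x = p y *\<^sub>R vu + q y *\<^sub>R vs" by (rule w)
    qed (use c1 c K1 l n 1 in \<open>auto simp: c_def\<close>)
    then show ?thesis
      using le_norm_chord[of y x] n(2) long[OF strict_mono_funpow(1)[of n]] by (intro exI[of _ y]) linarith
  next
    case 2
    \<comment> \<open>Reversing time exchanges the roles of \<open>vu\<close> and
      \<open>vs\<close>.\<close>
    have "norm (\<Gamma> y - \<Gamma> x) \<le> 2 * K1 * l / c ^ n \<and> l / 4 \<le> norm (\<Gamma> ((H' ^^ n) y) - \<Gamma> ((H' ^^ n) x))"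
    proof (rule B.expanded_chord[where u = vs and s = vu])
      show "norm (P' n x vs) = 1" using P'_vs[of n] s(1) by simp
      show "norm (P' j x vs) \<le> K1 / c ^ (n - j)" if "j \<le> n" for j using P'_vs[OF that] s(2) by simp
      show "norm (P' j x vu) \<le> K1 / c ^ (n + j)" if "j \<le> n" for j using P'_vu u(2) that by simp
      show "\<Gamma> y - \<Gamma> x = q y *\<^sub>R vs + p y *\<^sub>R vu" using w[of y] by (simp add: add.commute)
    qed (use c1 c K1 l n 2 in \<open>auto simp: c_def\<close>)
    then show ?thesis
      using le_norm_chord[of y x] n(2) long[OF strict_mono_funpow(2)[of n]] by (intro exI[of _ y]) linarith
  qed
qed

end

section \<open>Positive growth is impossible\<close>

context invariant_curve
begin

text \<open>The order of the choices carries the argument: the length \<open>l\<close> of a long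
  chord, then \<open>d\<close>, \<open>Q\<close>, the number \<open>L\<close> of consecutive times,
  the separation \<tau> over \<open>L\<close> steps, and only then \<open>n\<close> and
  \<open>N\<close>. In particular \<open>l\<close> and \<open>L\<close> do not depend on
  \<open>n\<close>, so chords of initial length of order c^(-n) can be made shorter than
  \<tau>.\<close>

lemma growth_rate_not_pos:
  assumes \<nu>: "0 < \<nu>"
    and upper: "\<And>\<epsilon>. 0 < \<epsilon> \<Longrightarrow> \<exists>K\<ge>1. \<forall>n x. norm (P n x) \<le> K * exp (\<nu> + \<epsilon>) ^ n"
    and lower: "\<And>n. \<exists>x. exp \<nu> ^ n \<le> 2 * norm (P n x)"
  shows False
proof -
  \<comment> \<open>Makes \<open>c powr (1 + \<alpha>)\<close> exceed \<open>b\<close>: the gain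
    \<alpha>\<nu> equals 8 (1 + \<alpha>) \<epsilon>, while passing from \<nu> to the rates of
    \<open>c\<close> and \<open>b\<close> loses only little more than 2 (1 + \<alpha>)
    \<epsilon>.\<close>
  define \<epsilon> where "\<epsilon> = \<alpha> * \<nu> / (8 * (1 + \<alpha>))"
  have \<epsilon>: "0 < \<epsilon>" using \<alpha> \<nu> by (simp add: \<epsilon>_def)
  have \<epsilon>8: "8 * ((1 + \<alpha>) * \<epsilon>) = \<alpha> * \<nu>" using \<alpha> by (simp add: \<epsilon>_def field_simps)
  have \<epsilon>_\<nu>: "8 * \<epsilon> < \<nu>" using \<alpha> \<nu> by (simp add: \<epsilon>_def divide_simps)
  define a where "a = exp (\<nu> - \<epsilon>)"
  define b where "b = exp (\<nu> + \<epsilon> / 32)"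
  define c where "c = a\<^sup>2 / b"
  have a: "1 < a" "a \<le> b" and b: "1 < b" using \<epsilon> \<epsilon>_\<nu> by (simp_all add: a_def b_def)
  have c_eq: "c = exp (\<nu> - 2 * \<epsilon> - \<epsilon> / 32)"
    by (simp add: c_def a_def b_def power2_eq_square flip: exp_add exp_diff)
  have c: "1 < c" "b < c powr (1 + \<alpha>)"
  proof -
    show "1 < c" using \<epsilon> \<epsilon>_\<nu> by (simp add: c_eq)
    have "0 < \<alpha> * \<epsilon>" using \<alpha> \<epsilon> by simp
    moreover have "(1 + \<alpha>) * (\<nu> - 2 * \<epsilon> - \<epsilon> / 32) =
        \<nu> + \<alpha> * \<nu> - 65 / 32 * \<epsilon> - 65 / 32 * (\<alpha> * \<epsilon>)"
      by (simp add: field_simps)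
    moreover have "\<alpha> * \<nu> = 8 * \<epsilon> + 8 * (\<alpha> * \<epsilon>)"
      using \<epsilon>8 by (simp add: algebra_simps)
    ultimately have "\<nu> + \<epsilon> / 32 < (1 + \<alpha>) * (\<nu> - 2 * \<epsilon> - \<epsilon> / 32)"
      using \<epsilon> by linarith
    then show "b < c powr (1 + \<alpha>)" by (simp add: b_def c_eq powr_def)
  qed
  obtain K where K: "1 \<le> K" "\<And>n x. norm (P n x) \<le> K * b ^ n"
    using upper[of "\<epsilon> / 32"] \<epsilon> unfolding b_def by auto
  obtain C' \<delta>' where C': "0 \<le> C'" "0 < \<delta>'"
    "\<And>x y. norm (\<Gamma> y - \<Gamma> x) \<le> \<delta>' \<Longrightarrow>
      norm ((\<Gamma> (H' y) - \<Gamma> (H' x)) - A' x (\<Gamma> y - \<Gamma> x)) \<le> C' * norm (\<Gamma> y - \<Gamma> x) powr (1 + \<alpha>)"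
    using chord' by blast
  define C\<^sub>1 where "C\<^sub>1 = max C C'"
  define \<delta>\<^sub>1 where "\<delta>\<^sub>1 = min \<delta> \<delta>'"
  have C1: "0 \<le> C\<^sub>1" "0 < \<delta>\<^sub>1" using C C' \<delta> by (auto simp: C\<^sub>1_def \<delta>\<^sub>1_def)
  have C1_le: "C * r powr s \<le> C\<^sub>1 * r powr s" "C' * r powr s \<le> C\<^sub>1 * r powr s" for r s
    by (auto simp: C\<^sub>1_def intro!: mult_right_mono)
  have cd: "chord_dynamics H A M K b \<Gamma> C\<^sub>1 \<alpha> \<delta>\<^sub>1"
  proof unfold_locales
    fix x y assume "norm (\<Gamma> y - \<Gamma> x) \<le> \<delta>\<^sub>1"
    then show "norm ((\<Gamma> (H y) - \<Gamma> (H x)) - A x (\<Gamma> y - \<Gamma> x)) \<le>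
        C\<^sub>1 * norm (\<Gamma> y - \<Gamma> x) powr (1 + \<alpha>)"
      by (intro order_trans[OF chord C1_le(1)]) (simp add: \<delta>\<^sub>1_def)
  qed (use K b C1 \<alpha> in auto)
  have cd': "chord_dynamics H' A' M K b \<Gamma> C\<^sub>1 \<alpha> \<delta>\<^sub>1"
  proof (intro chord_dynamics.intro bounded_growth.intro sympl_cocycle')
    show "bounded_growth_axioms H' A' K b"
      using K b by unfold_locales (simp_all add: norm_P')
    show "chord_dynamics_axioms H' A' \<Gamma> C\<^sub>1 \<alpha> \<delta>\<^sub>1"
    proof unfold_locales
      fix x y assume "norm (\<Gamma> y - \<Gamma> x) \<le> \<delta>\<^sub>1"
      then show "norm ((\<Gamma> (H' y) - \<Gamma> (H' x)) - A' x (\<Gamma> y - \<Gamma> x)) \<le>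
          C\<^sub>1 * norm (\<Gamma> y - \<Gamma> x) powr (1 + \<alpha>)"
        by (intro order_trans[OF C'(3) C1_le(2)]) (simp add: \<delta>\<^sub>1_def)
    qed (use C1 \<alpha> in auto)
  qed
  interpret F: chord_dynamics H A M K b \<Gamma> C\<^sub>1 \<alpha> \<delta>\<^sub>1 by (rule cd)
  interpret B: chord_dynamics H' A' M K b \<Gamma> C\<^sub>1 \<alpha> \<delta>\<^sub>1 by (rule cd')

  define n\<^sub>0 where "n\<^sub>0 = nat \<lceil>2 * ln K / \<epsilon>\<rceil> + 1"
  have n0: "0 < n\<^sub>0" "2 * ln K \<le> \<epsilon> * n\<^sub>0"
  proof -
    have "2 * ln K / \<epsilon> \<le> n\<^sub>0" unfolding n\<^sub>0_def by linarith
    then show "2 * ln K \<le> \<epsilon> * n\<^sub>0" using \<epsilon> by (simp add: field_simps)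
  qed (simp add: n\<^sub>0_def)
  \<comment> \<open>Lengths below \<open>n\<^sub>0\<close> are not covered by the absence of slow
    segments; there the bound 1 on symplectic norms suffices, at the price of this factor.\<close>
  define \<kappa> where "\<kappa> = 1 / a ^ n\<^sub>0"
  have k: "0 < \<kappa>" "\<kappa> \<le> 1" using a by (auto simp: \<kappa>_def)
  have lower_growth: "\<kappa> * a ^ l \<le> r" if "1 \<le> r" "n\<^sub>0 \<le> l \<Longrightarrow> a ^ l \<le> r" for l r
  proof (cases "n\<^sub>0 \<le> l")
    case True
    have "\<kappa> * a ^ l \<le> 1 * a ^ l" using k a by (intro mult_right_mono) auto
    then show ?thesis using that(2)[OF True] by simp
  next
    case False
    then have "\<kappa> * a ^ l \<le> 1" using a by (simp add: \<kappa>_def divide_simps power_increasing)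
    then show ?thesis using that(1) by simp
  qed

  define K1 where "K1 = 1 / \<kappa> + M * K / (\<kappa>\<^sup>2 * (1 - 1 / a\<^sup>2))"
  have K1: "1 \<le> K1"
  proof -
    have "1 \<le> 1 / \<kappa>" using k by simp
    moreover have "0 \<le> M * K / (\<kappa>\<^sup>2 * (1 - 1 / a\<^sup>2))"
      using M_ge_1 K a k by (intro divide_nonneg_nonneg mult_nonneg_nonneg) auto
    ultimately show ?thesis unfolding K1_def by linarith
  qed
  define X where "X = K * C\<^sub>1 * (4 * K1) powr (1 + \<alpha>) / (c powr (1 + \<alpha>) - b)"
  have X: "0 \<le> X" using K C1 c by (simp add: X_def)
  \<comment> \<open>The three bounds serve, in order, the intermediate value argument, the range in
    which the linearization is valid, and the smallness of the nonlinear error.\<close>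
  define l where "l = min (1 / (4 * K1)) (min (\<delta>\<^sub>1 / (4 * K1)) ((1 / (4 * (X + 1))) powr (1 / \<alpha>)))"
  have l: "0 < l" "2 * K1 * l \<le> 1" "X * l powr \<alpha> \<le> 1 / 4" "4 * K1 * l \<le> \<delta>\<^sub>1"
  proof -
    show "0 < l" using K1 C1 X by (simp add: l_def)
    have "l \<le> 1 / (4 * K1)" "l \<le> \<delta>\<^sub>1 / (4 * K1)" by (simp_all add: l_def)
    then have "4 * K1 * l \<le> 1" "4 * K1 * l \<le> \<delta>\<^sub>1" using K1 by (simp_all add: field_simps)
    then show "2 * K1 * l \<le> 1" "4 * K1 * l \<le> \<delta>\<^sub>1" using K1 \<open>0 < l\<close> by auto
    have "l powr \<alpha> \<le> ((1 / (4 * (X + 1))) powr (1 / \<alpha>)) powr \<alpha>"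
      using \<open>0 < l\<close> \<alpha> by (intro powr_mono2) (auto simp: l_def)
    also have "\<dots> = 1 / (4 * (X + 1))" using \<alpha> X by (simp add: powr_powr)
    finally have "X * l powr \<alpha> \<le> X * (1 / (4 * (X + 1)))" using X by (intro mult_left_mono)
    also have "\<dots> \<le> 1 / 4" using X by (simp add: divide_simps)
    finally show "X * l powr \<alpha> \<le> 1 / 4" .
  qed
  obtain d where d: "0 < d" "\<And>s t. \<bar>t - s\<bar> < d \<Longrightarrow> norm (\<Gamma> t - \<Gamma> s) < l / 4"
    using unif_cont_\<Gamma> l(1) unfolding uniformly_continuous_on_def dist_norm real_norm_def
    by (metis UNIV_I divide_pos_pos zero_less_numeral)
  define Q where "Q = nat \<lceil>1 / d\<rceil> + 1"
  have Q: "1 \<le> d * real Q"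
  proof -
    have "1 / d \<le> real Q" unfolding Q_def by linarith
    then show ?thesis using d by (simp add: field_simps)
  qed
  \<comment> \<open>Each block of \<open>L\<close> times contains at most \<open>Q\<close> long arcs
    of one kind, hence a density of 1/8.\<close>
  define L where "L = 8 * Q"
  have L: "0 < L" by (simp add: L_def Q_def)
  obtain \<tau> where \<tau>: "0 < \<tau>"
    "\<And>j t p. 0 < j \<Longrightarrow> j < L \<Longrightarrow> p \<in> \<int> \<Longrightarrow> \<tau> < \<bar>(H ^^ j) t - t - p\<bar>"
    using separated[of L] by blast
  obtain n where n': "max (2 * K1) (2 * K1 * l / \<tau>) < c ^ n"
    using real_arch_pow[OF c(1)] by blast
  have n: "K1 / c ^ (2 * n) \<le> 1 / 2" "2 * K1 * l / c ^ n \<le> \<tau>"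
  proof -
    have "c ^ n \<le> c ^ (2 * n)" using c by (intro power_increasing) auto
    then have "2 * K1 \<le> c ^ (2 * n)" using n' by linarith
    then show "K1 / c ^ (2 * n) \<le> 1 / 2" using c by (simp add: divide_simps)
    show "2 * K1 * l / c ^ n \<le> \<tau>" using n' c \<tau>(1) by (simp add: divide_simps mult.commute)
  qed
  have n_pos: "0 < n" using n' K1 by (cases n) auto
  define N where "N = nat \<lceil>32 * (ln 2 + ln K + \<epsilon> * (2 * n)) / \<epsilon>\<rceil> + 4 * n + 4 * Q + 1"
  have N: "32 * (ln 2 + ln K + \<epsilon> * real (2 * n)) \<le> \<epsilon> * N" "4 * n + 4 * Q < N"
  proof -
    have "32 * (ln 2 + ln K + \<epsilon> * (2 * n)) / \<epsilon> \<le> N" unfolding N_def by linarith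
    then show "32 * (ln 2 + ln K + \<epsilon> * real (2 * n)) \<le> \<epsilon> * N" using \<epsilon> by (simp add: field_simps)
  qed (simp add: N_def)
  obtain x where x: "exp \<nu> ^ N \<le> 2 * norm (P N x)" using lower by blast
  define z where "z i = (H ^^ i) x" for i
  define B\<^sub>1 where "B\<^sub>1 = F.slow_times a n\<^sub>0 (2 * n) N x"
  define B\<^sub>2 where "B\<^sub>2 = B.slow_times a n\<^sub>0 (2 * n) N (z N)"
  have B: "8 * card B\<^sub>1 \<le> N" "8 * card B\<^sub>2 \<le> N"
  proof -
    show "8 * card B\<^sub>1 \<le> N"
      unfolding B\<^sub>1_def a_def using \<nu> \<epsilon> b_def n0 N(1) x by (intro F.few_slow_times) auto
    have "norm (P' N (z N)) = norm (P N x)" by (simp add: norm_P' z_def)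
    then show "8 * card B\<^sub>2 \<le> N"
      unfolding B\<^sub>2_def a_def using \<nu> \<epsilon> b_def n0 N(1) x by (intro B.few_slow_times) auto
  qed
  define U where "U = {i. i < N \<and> (\<exists>y. y - z i \<le> \<tau> \<and> d \<le> (H ^^ n) y - (H ^^ n) (z i))}"
  define S where "S = {i. i < N \<and> (\<exists>y. y - z i \<le> \<tau> \<and> d \<le> (H' ^^ n) y - (H' ^^ n) (z i))}"
  have sep: "\<tau> < \<bar>z j - z i - p\<bar>" if "i < j" "j < i + L" "p \<in> \<int>" for i j p
  proof -
    have "z j = (H ^^ (j - i)) (z i)"
      using that by (simp add: z_def flip: funpow_add[THEN fun_cong, unfolded comp_apply])
    then show ?thesis using \<tau>(2)[of "j - i" p "z i"] that by auto
  qed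
  have card_le: "8 * card D \<le> N + 8 * Q" if "card D \<le> (N div L + 1) * Q" for D :: "nat set"
  proof -
    have "8 * card D \<le> L * (N div L) + 8 * Q" using that by (simp add: L_def algebra_simps)
    also have "L * (N div L) \<le> N" by simp
    finally show ?thesis by simp
  qed
  have US: "8 * card U \<le> N + 8 * Q" "8 * card S \<le> N + 8 * Q"
  proof -
    have "card U \<le> (N div L + 1) * Q"
      by (rule card_long_image_arcs_le[OF strict_mono_funpow(1)[of n] _ Q L, where z = z and \<tau> = \<tau>])
        (auto simp: U_def funpow_add_Int sep)
    then show "8 * card U \<le> N + 8 * Q" by (rule card_le)
    have "card S \<le> (N div L + 1) * Q"
      by (rule card_long_image_arcs_le[OF strict_mono_funpow(2)[of n] _ Q L, where z = z and \<tau> = \<tau>])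
        (auto simp: S_def funpow_add_Int sep)
    then show "8 * card S \<le> N + 8 * Q" by (rule card_le)
  qed
  \<comment> \<open>The reversed segment starts at \<open>z N\<close>, so its time
    \<open>N - n - i\<close> is the point \<open>z (i + n)\<close>. The first and last
    \<open>n\<close> times are left out because their windows do not fit.\<close>
  have cover: "{n..<N - n} \<subseteq> ((\<lambda>k. k + n) ` B\<^sub>1 \<union> (\<lambda>k. N - n - k) ` B\<^sub>2) \<union> (U \<union> S)"
  proof (rule subsetI, rule ccontr)
    fix i assume i: "i \<in> {n..<N - n}"
      and "i \<notin> ((\<lambda>k. k + n) ` B\<^sub>1 \<union> (\<lambda>k. N - n - k) ` B\<^sub>2) \<union> (U \<union> S)"
    then have not_in: "i - n \<notin> B\<^sub>1" "N - n - i \<notin> B\<^sub>2" "i \<notin> U" "i \<notin> S" by force+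
    have m: "(H' ^^ n) (z i) = z (i - n)"
      using i by (simp add: z_def funpow_inverse_le)
    have p: "(H ^^ n) (z i) = (H' ^^ (N - n - i)) (z N)"
    proof -
      have "(H' ^^ (N - n - i)) (z N) = (H ^^ (n + i)) x"
      proof -
        have "N - (N - n - i) = n + i" using i by auto
        then show ?thesis by (simp add: z_def funpow_inverse_le)
      qed
      then show ?thesis by (simp add: z_def funpow_add)
    qed
    have "\<exists>y. y - z i \<le> \<tau> \<and>
        (d \<le> (H ^^ n) y - (H ^^ n) (z i) \<or> d \<le> (H' ^^ n) y - (H' ^^ n) (z i))"
    proof (rule long_arc[OF cd cd' a _ _ k])
      show "\<kappa> * a ^ l \<le> norm (P l ((H' ^^ n) (z i)))" if "l \<le> 2 * n" for l
        using not_in(1) i that unfolding m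
        by (intro lower_growth norm_P_ge_1)
          (auto simp: B\<^sub>1_def F.slow_times_def F.slow_def z_def not_less)
      show "\<kappa> * a ^ l \<le> norm (P' l ((H ^^ n) (z i)))" if "l \<le> 2 * n" for l
        using not_in(2) i n_pos that unfolding p
        by (intro lower_growth B.norm_P_ge_1)
          (auto simp: B\<^sub>2_def B.slow_times_def B.slow_def not_less)
    qed (use c l n d(2) in \<open>simp_all add: K1_def[symmetric] c_def[symmetric] X_def[symmetric]\<close>)
    then show False using not_in(3,4) i by (auto simp: U_def S_def)
  qed
  have fin: "finite B\<^sub>1" "finite B\<^sub>2" "finite U" "finite S"
    by (simp_all add: B\<^sub>1_def B\<^sub>2_def U_def S_def)
  \<comment> \<open>The four sets have at most \<open>N / 2 + 2 * Q\<close> elements together, which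
    would force \<open>N \<le> 4 * n + 4 * Q\<close>.\<close>
  have "N - n - n \<le> card (((\<lambda>k. k + n) ` B\<^sub>1 \<union> (\<lambda>k. N - n - k) ` B\<^sub>2) \<union> (U \<union> S))"
    using card_mono[OF _ cover] fin by simp
  also have "\<dots> \<le> card ((\<lambda>k. k + n) ` B\<^sub>1 \<union> (\<lambda>k. N - n - k) ` B\<^sub>2) + card (U \<union> S)"
    by (rule card_Un_le)
  also have "\<dots> \<le> (card ((\<lambda>k. k + n) ` B\<^sub>1) + card ((\<lambda>k. N - n - k) ` B\<^sub>2)) + (card U + card S)"
    by (intro add_mono card_Un_le)
  also have "\<dots> \<le> (card B\<^sub>1 + card B\<^sub>2) + (card U + card S)"
    by (intro add_mono card_image_le fin order_refl)
  finally show False using B US N(2) by linarith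
qed

theorem subexponential_growth:
  assumes "0 < \<epsilon>"
  shows "\<exists>K. \<forall>n t. norm (P n t) \<le> K * exp (\<epsilon> * n)"
proof -
  obtain \<nu> where \<nu>: "0 \<le> \<nu>"
    "\<And>\<epsilon>. 0 < \<epsilon> \<Longrightarrow> \<exists>K\<ge>1. \<forall>n x. norm (P n x) \<le> K * exp (\<nu> + \<epsilon>) ^ n"
    "\<And>n. \<exists>x. exp \<nu> ^ n \<le> 2 * norm (P n x)"
    using growth_rate by blast
  have "\<nu> = 0" using growth_rate_not_pos[OF _ \<nu>(2,3)] \<nu>(1) by fastforce
  then show ?thesis
    using \<nu>(2)[OF assms] by (auto simp: mult.commute[of \<epsilon>] exp_of_nat_mult)
qed

end

section \<open>Lifts and derivatives on the annulus\<close>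

lemma Ints_valued_constant:
  fixes f :: "'a::topological_space \<Rightarrow> real"
  assumes "connected S" "continuous_on S f" "\<And>x. x \<in> S \<Longrightarrow> f x \<in> \<int>" "x \<in> S" "y \<in> S"
  shows "f x = f y"
proof -
  have "f constant_on S"
  proof (rule continuous_discrete_range_constant[OF assms(1,2)])
    fix x assume x: "x \<in> S"
    have "1 \<le> norm (f y - f x)" if "y \<in> S" "f y \<noteq> f x" for y
      using Ints_eq_abs_less1[of "f y" "f x"] assms(3) x that by (force simp: not_less)
    then show "\<exists>e>0. \<forall>y. y \<in> S \<and> f y \<noteq> f x \<longrightarrow> e \<le> norm (f y - f x)"
      by (intro exI[of _ 1]) auto
  qed
  then show ?thesis using assms by (auto simp: constant_on_def)
qed

lemma translation_of_int:
  fixes g :: "real \<Rightarrow> real"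
  assumes "\<And>t. g (t + 1) = g t + c"
  shows "g (t + of_int k) = g t + of_int k * c"
proof -
  have nat: "g (t + real n) = g t + real n * c" for n t
  proof (induction n)
    case (Suc n)
    then show ?case using assms[of "t + real n"] by (simp add: algebra_simps)
  qed simp
  show ?thesis
  proof (cases k)
    case (nonneg n)
    then show ?thesis using nat[of t n] by simp
  next
    case (neg n)
    then have k: "t + of_int k + real (Suc n) = t" "of_int k = - real (Suc n)" by simp_all
    then have "g (t + of_int k) = g t - real (Suc n) * c"
      using nat[of "t + of_int k" "Suc n"] by simp
    then show ?thesis unfolding k(2) by (simp only: mult_minus_left diff_conv_add_uminus)
  qed
qed

text \<open>Periodicity is asked of distances, which also covers maps that commute with integer
  translations, such as \<open>H'\<close>.\<close>

lemma uniformly_continuous_on_periodic: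
  fixes f :: "real \<Rightarrow> 'a::metric_space"
  assumes cont: "continuous_on UNIV f"
    and per: "\<And>s t k. dist (f (s + of_int k)) (f (t + of_int k)) = dist (f s) (f t)"
  shows "uniformly_continuous_on UNIV f"
  unfolding uniformly_continuous_on_def
proof (intro allI impI)
  fix e :: real assume "0 < e"
  \<comment> \<open>A margin of 1 on both sides of [0, 1] leaves room for the second point after the
    first has been translated into [0, 1).\<close>
  moreover have "uniformly_continuous_on {-1..2} f"
    by (intro compact_uniformly_continuous continuous_on_subset[OF cont]) auto
  ultimately obtain d where d: "0 < d"
    "\<And>s t. s \<in> {-1..2} \<Longrightarrow> t \<in> {-1..2} \<Longrightarrow> dist t s < d \<Longrightarrow> dist (f t) (f s) < e"
    unfolding uniformly_continuous_on_def by meson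
  have "dist (f t) (f s) < e" if "dist t s < min d 1" for s t
  proof -
    define k where "k = - \<lfloor>s\<rfloor>"
    have "0 \<le> s + of_int k" "s + of_int k < 1" unfolding k_def by linarith+
    moreover have "\<bar>t - s\<bar> < 1" "\<bar>t - s\<bar> < d" using that by (auto simp: dist_real_def)
    ultimately have "dist (f (t + of_int k)) (f (s + of_int k)) < e"
      by (intro d) (auto simp: dist_real_def)
    then show ?thesis by (simp add: per)
  qed
  then show "\<exists>d>0. \<forall>s\<in>UNIV. \<forall>t\<in>UNIV. dist t s < d \<longrightarrow> dist (f t) (f s) < e"
    using d(1) by (intro exI[of _ "min d 1"]) auto
qed

section \<open>Lifting maps into the circle\<close>

lemma to_circle_add_Int [simp]: "k \<in> \<int> \<Longrightarrow> to_circle (t + k) = to_circle t"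
  by (simp add: to_circle_eq_iff)

text \<open>Embeds the circle into the complex plane, so that lifts are obtained from continuous
  logarithms.\<close>

lift_definition circle_cis :: "circle \<Rightarrow> complex" is "\<lambda>t. cis (2 * pi * t)"
proof -
  fix s t :: real assume "s - t \<in> \<int>"
  then obtain k where "s = t + of_int k" by (metis Ints_cases add.commute diff_add_cancel)
  then have "cis (2 * pi * s) = cis (2 * pi * t) * cis (2 * pi * of_int k)"
    by (simp add: cis_mult algebra_simps)
  then show "cis (2 * pi * s) = cis (2 * pi * t)" by (simp add: cis_multiple_2pi)
qed

lemma circle_cis_to_circle: "circle_cis (to_circle t) = cis (2 * pi * t)"
  by transfer simp

lemma inj_circle_cis: "circle_cis x = circle_cis y \<Longrightarrow> x = y"
proof transfer
  fix s t :: real assume "cis (2 * pi * s) = cis (2 * pi * t)"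
  then have "cis (2 * pi * (s - t)) = 1" by (simp add: right_diff_distrib flip: cis_divide)
  then have "cos (2 * pi * (s - t)) = 1" by (simp add: complex_eq_iff)
  then obtain k where "2 * pi * (s - t) = of_int k * 2 * pi"
    using cos_one_2pi_int by auto
  then show "s - t \<in> \<int>" by simp
qed

lemma continuous_on_circle_cis: "continuous_on S circle_cis"
proof -
  have "open (circle_cis -` V)" if "open V" for V
  proof -
    have "to_circle -` circle_cis -` V = (\<lambda>t. cis (2 * pi * t)) -` V"
      by (auto simp: circle_cis_to_circle)
    moreover have "open ((\<lambda>t. cis (2 * pi * t)) -` V)"
      by (intro open_vimage that continuous_intros)
    ultimately show ?thesis by (simp add: open_circle_iff)
  qed
  then have "continuous_on UNIV circle_cis" by (simp add: continuous_on_open_vimage)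
  then show ?thesis by (rule continuous_on_subset) simp
qed

lemma lift_to_circle:
  fixes \<psi> :: "'a::real_normed_vector \<Rightarrow> circle"
  assumes "convex S" "continuous_on S \<psi>"
  obtains L where "continuous_on S L" "\<And>x. x \<in> S \<Longrightarrow> to_circle (L x) = \<psi> x"
proof -
  have "continuous_on S (circle_cis \<circ> \<psi>)"
    by (intro continuous_on_compose assms continuous_on_circle_cis)
  moreover have norm1: "norm (circle_cis x) = 1" for x by transfer simp
  then have "(circle_cis \<circ> \<psi>) x \<noteq> 0" for x by (metis comp_apply norm_zero zero_neq_one)
  ultimately obtain g where g: "continuous_on S g" "\<And>x. x \<in> S \<Longrightarrow> circle_cis (\<psi> x) = exp (g x)"
    using continuous_logarithm_on_contractible[of S "circle_cis \<circ> \<psi>"]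
      convex_imp_contractible[OF assms(1)] by auto
  show ?thesis
  proof
    show "continuous_on S (\<lambda>x. Im (g x) / (2 * pi))"
      by (intro continuous_intros g) auto
    fix x assume x: "x \<in> S"
    have "Re (g x) = 0"
      using norm1[of "\<psi> x"] g(2)[OF x] by simp
    then have "exp (g x) = cis (Im (g x))" by (simp add: exp_eq_polar)
    then show "to_circle (Im (g x) / (2 * pi)) = \<psi> x"
      using g(2)[OF x] by (intro inj_circle_cis) (simp add: circle_cis_to_circle)
  qed
qed

section \<open>Derivatives and global lifts on the annulus\<close>

lemma continuous_on_to_annulus: "continuous_on S to_annulus"
proof -
  have "continuous_on S (\<lambda>z. (to_circle (fst z), snd z))"
    by (intro continuous_intros continuous_on_compose2[OF continuous_on_to_circle]) auto
  then show ?thesis by (simp add: to_annulus_def[abs_def])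
qed

lemma to_annulus_add_Int [simp]: "k \<in> \<int> \<Longrightarrow> to_annulus (z + (k, 0)) = to_annulus z"
  by (simp add: to_annulus_eq_iff)

lemma to_annulus_cases: obtains z where "x = to_annulus z"
  by (cases x) (metis fst_conv snd_conv to_annulus_def to_circle_cases)

lemma fst_to_annulus [simp]: "fst (to_annulus z) = to_circle (fst z)"
  and snd_to_annulus [simp]: "snd (to_annulus z) = snd z"
  by (simp_all add: to_annulus_def)

lemma dist_to_annulus_le: "dist (to_annulus z) (to_annulus w) \<le> dist z w"
proof -
  have "infdist (fst z - fst w) \<int> \<le> dist (fst z) (fst w)"
    using infdist_le[of 0 \<int> "fst z - fst w"] by (simp add: dist_real_def)
  then show ?thesis
    unfolding dist_prod_def by (simp add: dist_to_circle infdist_nonneg power_mono)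
qed

lemma to_annulus_eqE:
  assumes "to_annulus w = to_annulus z"
  obtains k where "k \<in> \<int>" "w = z + (k, 0)"
proof
  show "fst w - fst z \<in> \<int>" using assms by (simp add: to_annulus_eq_iff)
  show "w = z + (fst w - fst z, 0)" using assms by (simp add: to_annulus_eq_iff prod_eq_iff)
qed

text \<open>The definition supplies a local lift at some point above x; an integer translation moves
  it to the prescribed \<open>z\<close>. The chain rule needs this, as the second local lift must be
  based at the value of the first.\<close>

lemma has_annulus_derivativeE:
  assumes "has_annulus_derivative f D (to_annulus z)"
  obtains F where "\<forall>\<^sub>F w in nhds z. to_annulus (F w) = f (to_annulus w)"
    "(F has_derivative blinfun_apply D) (at z)"
proof -
  obtain z0 F where F: "to_annulus z0 = to_annulus z" "(F has_derivative blinfun_apply D) (at z0)"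
      "\<forall>\<^sub>F w in nhds z0. to_annulus (F w) = f (to_annulus w)"
    using assms unfolding has_annulus_derivative_def by blast
  obtain k where k: "k \<in> \<int>" "z0 = z + (k, 0)" by (rule to_annulus_eqE[OF F(1)])
  show ?thesis
  proof
    have "((\<lambda>w. w + (k, 0)) \<longlongrightarrow> z0) (nhds z)"
      unfolding k(2) by (rule tendsto_eq_intros filterlim_ident | simp)+
    with F(3) have "\<forall>\<^sub>F w in nhds z. to_annulus (F (w + (k, 0))) = f (to_annulus (w + (k, 0)))"
      unfolding filterlim_iff by blast
    then show "\<forall>\<^sub>F w in nhds z. to_annulus (F (w + (k, 0))) = f (to_annulus w)"
      using k(1) by simp
    have "((\<lambda>w. w + (k, 0)) has_derivative (\<lambda>h. h)) (at z)"
      by (auto intro!: derivative_eq_intros)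
    then show "((\<lambda>w. F (w + (k, 0))) has_derivative blinfun_apply D) (at z)"
      using has_derivative_compose[of "\<lambda>w. w + (k, 0)" "\<lambda>h. h" z UNIV F "blinfun_apply D"]
        F(2) k(2) by simp
  qed
qed

lemma has_annulus_derivative_compose:
  assumes "has_annulus_derivative f D x" "has_annulus_derivative g E (f x)"
  shows "has_annulus_derivative (g \<circ> f) (E o\<^sub>L D) x"
proof -
  obtain z where z: "x = to_annulus z" by (rule to_annulus_cases)
  obtain F where F: "\<forall>\<^sub>F w in nhds z. to_annulus (F w) = f (to_annulus w)"
    "(F has_derivative blinfun_apply D) (at z)"
    using assms(1) unfolding z by (rule has_annulus_derivativeE)
  have Fz: "to_annulus (F z) = f x" using eventually_nhds_x_imp_x[OF F(1)] z by simp
  obtain G where G: "\<forall>\<^sub>F w in nhds (F z). to_annulus (G w) = g (to_annulus w)"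
    "(G has_derivative blinfun_apply E) (at (F z))"
    using assms(2) unfolding Fz[symmetric] by (rule has_annulus_derivativeE)
  have "isCont F z" using F(2) by (rule has_derivative_continuous)
  then have "(F \<longlongrightarrow> F z) (nhds z)" by (simp add: isCont_def tendsto_at_iff_tendsto_nhds)
  with G(1) have "\<forall>\<^sub>F w in nhds z. to_annulus (G (F w)) = g (to_annulus (F w))"
    unfolding filterlim_iff by blast
  with F(1) have "\<forall>\<^sub>F w in nhds z. to_annulus (G (F w)) = (g \<circ> f) (to_annulus w)"
    by eventually_elim simp
  moreover have "((\<lambda>w. G (F w)) has_derivative blinfun_apply (E o\<^sub>L D)) (at z)"
    using has_derivative_compose[OF F(2) G(2)] by (simp add: o_def blinfun_compose.rep_eq)
  ultimately show ?thesis
    unfolding has_annulus_derivative_def z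
    by (intro exI[of _ z] exI[of _ "\<lambda>w. G (F w)"] conjI refl)
qed

lemma has_annulus_derivative_id: "has_annulus_derivative id id_blinfun x"
proof -
  obtain z where z: "x = to_annulus z" by (rule to_annulus_cases)
  have "((\<lambda>w. w) has_derivative blinfun_apply id_blinfun) (at z)"
    by (simp add: id_blinfun.rep_eq)
  then show ?thesis
    unfolding has_annulus_derivative_def z by (intro exI[of _ z] exI[of _ "\<lambda>w. w"]) auto
qed

lemma C1_annulus_has_derivative: "C1_annulus f \<Longrightarrow> has_annulus_derivative f (annulus_deriv f x) x"
  unfolding C1_annulus_def using annulus_deriv_eqI by metis

lemma has_annulus_derivative_funpow:
  assumes "C1_annulus f"
  shows "has_annulus_derivative (f ^^ n) (cocycle f (annulus_deriv f) n x) x"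
proof (induction n)
  case 0
  then show ?case using has_annulus_derivative_id by (simp add: id_def)
next
  case (Suc n)
  then show ?case
    using has_annulus_derivative_compose[OF Suc C1_annulus_has_derivative[OF assms]] by (simp add: o_def)
qed

lemma annulus_deriv_funpow:
  "C1_annulus f \<Longrightarrow> annulus_deriv (f ^^ n) x = cocycle f (annulus_deriv f) n x"
  by (rule annulus_deriv_eqI[OF has_annulus_derivative_funpow])

lemma C1_annulus_continuous:
  assumes "C1_annulus f"
  shows "continuous_on UNIV (\<lambda>z. f (to_annulus z))"
  unfolding continuous_on_eq_continuous_at[OF open_UNIV]
proof
  fix z
  obtain F where F: "\<forall>\<^sub>F w in nhds z. to_annulus (F w) = f (to_annulus w)"
    "(F has_derivative blinfun_apply (annulus_deriv f (to_annulus z))) (at z)"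
    using C1_annulus_has_derivative[OF assms] by (rule has_annulus_derivativeE)
  have "isCont F z" using F(2) by (rule has_derivative_continuous)
  moreover have "isCont to_annulus (F z)"
    using continuous_on_to_annulus[of UNIV] by (metis UNIV_I continuous_on_eq_continuous_at open_UNIV)
  ultimately have "isCont (to_annulus \<circ> F) z" by (rule continuous_at_compose)
  moreover have "\<forall>\<^sub>F w in nhds z. (to_annulus \<circ> F) w = f (to_annulus w)"
    using F(1) by simp
  ultimately show "isCont (\<lambda>z. f (to_annulus z)) z"
    using isCont_cong[THEN iffD1] by fast
qed

definition annulus_lift :: "(annulus \<Rightarrow> annulus) \<Rightarrow> (real \<times> real \<Rightarrow> real \<times> real) \<Rightarrow> bool"
  where "annulus_lift f F \<longleftrightarrow>
    continuous_on UNIV F \<and> (\<forall>z. to_annulus (F z) = f (to_annulus z))"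

lemma annulus_liftD: "annulus_lift f F \<Longrightarrow> to_annulus (F z) = f (to_annulus z)"
  and annulus_lift_continuous: "annulus_lift f F \<Longrightarrow> continuous_on UNIV F"
  unfolding annulus_lift_def by blast+

lemma C1_annulus_lift:
  assumes "C1_annulus f"
  obtains F where "annulus_lift f F"
proof -
  have cont: "continuous_on UNIV (\<lambda>z. f (to_annulus z))" by (rule C1_annulus_continuous[OF assms])
  then have "continuous_on UNIV (\<lambda>z. fst (f (to_annulus z)))" by (intro continuous_intros)
  then obtain L where L: "continuous_on UNIV L" "\<And>z. to_circle (L z) = fst (f (to_annulus z))"
    using lift_to_circle[OF convex_UNIV] by (metis UNIV_I)
  have "annulus_lift f (\<lambda>z. (L z, snd (f (to_annulus z))))"
    unfolding annulus_lift_def using L cont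
    by (auto intro!: continuous_intros simp: to_annulus_def)
  then show ?thesis by (rule that)
qed

text \<open>The global lift and a local one differ by an integer translation, which continuity makes
  constant near \<open>z\<close>.\<close>

lemma annulus_lift_has_derivative:
  assumes F: "annulus_lift f F" and D: "has_annulus_derivative f D (to_annulus z)"
  shows "(F has_derivative blinfun_apply D) (at z)"
proof -
  obtain G where G: "\<forall>\<^sub>F w in nhds z. to_annulus (G w) = f (to_annulus w)"
    "(G has_derivative blinfun_apply D) (at z)"
    using D by (rule has_annulus_derivativeE)
  define E where "E w = F w - G w" for w
  have Ints: "\<forall>\<^sub>F w in nhds z. fst (E w) \<in> \<int> \<and> snd (E w) = 0"
    using G(1)
  proof eventually_elim
    case (elim w)
    then have "to_annulus (F w) = to_annulus (G w)" by (simp add: annulus_liftD[OF F])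
    then show ?case by (simp add: E_def to_annulus_eq_iff)
  qed
  have "isCont F z"
    using annulus_lift_continuous[OF F] by (metis UNIV_I continuous_on_eq_continuous_at open_UNIV)
  then have "isCont E z"
    unfolding E_def by (intro continuous_intros has_derivative_continuous[OF G(2)])
  then have "(E \<longlongrightarrow> E z) (nhds z)" by (simp add: isCont_def tendsto_at_iff_tendsto_nhds)
  then have "\<forall>\<^sub>F w in nhds z. dist (E w) (E z) < 1" by (rule tendstoD) simp
  then have "\<forall>\<^sub>F w in nhds z. G w + E z = F w"
    using Ints
  proof eventually_elim
    case (elim w)
    have "fst (E z) \<in> \<int>" "snd (E z) = 0" using eventually_nhds_x_imp_x[OF Ints] by auto
    moreover have "\<bar>fst (E w) - fst (E z)\<bar> < 1"
      using elim(1) dist_fst_le[of "E w" "E z"] by (simp add: dist_real_def)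
    ultimately have "E w = E z"
      using elim(2) Ints_eq_abs_less1[of "fst (E w)" "fst (E z)"] by (simp add: prod_eq_iff)
    then show ?case by (simp add: E_def algebra_simps)
  qed
  then have "\<forall>\<^sub>F w in at z. G w + E z = F w" "G z + E z = F z"
    by (simp_all add: eventually_nhds_conv_at)
  moreover have "((\<lambda>w. G w + E z) has_derivative blinfun_apply D) (at z)"
    using has_derivative_add[OF G(2) has_derivative_const[of "E z"]] by simp
  ultimately show ?thesis
    using has_derivative_transform_eventually[of "\<lambda>w. G w + E z" _ z UNIV F] by auto
qed

text \<open>The degree is a positive integer by monotonicity. Were it larger than 1, the value
  \<open>H t + 1\<close> would be taken strictly inside a period, against injectivity of
  \<open>h\<close>.\<close>

lemma circle_lift_add_1:
  assumes H: "circle_lift h H" "strict_mono H" and h: "inj h"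
  shows "H (t + 1) = H t + 1"
proof -
  have lift: "to_circle (H s) = h (to_circle s)" for s
    using H(1) by (simp add: circle_lift_def)
  have "to_circle (H (t + 1)) = to_circle (H t)" by (simp add: lift)
  then have "H (t + 1) - H t \<in> \<int>" by (simp add: to_circle_eq_iff)
  then obtain k where k: "H (t + 1) - H t = of_int k" by (elim Ints_cases)
  have "H t < H (t + 1)" using H(2) by (simp add: strict_mono_less)
  then have "1 \<le> k" using k by linarith
  moreover have False if "1 < k"
  proof -
    have "2 \<le> real_of_int k" using that by linarith
    then have lt: "H t + 1 < H (t + 1)" using k by linarith
    have "\<exists>s\<ge>t. s \<le> t + 1 \<and> H s = H t + 1"
      using lt H(1) by (intro IVT') (auto simp: circle_lift_def intro: continuous_on_subset)
    then obtain s where s: "t \<le> s" "s \<le> t + 1" "H s = H t + 1" by blast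
    have "h (to_circle s) = h (to_circle t)" by (simp add: s(3) flip: lift)
    then have "to_circle s = to_circle t" using h by (simp add: inj_eq)
    then obtain j where j: "s - t = of_int j" by (auto simp: to_circle_eq_iff elim: Ints_cases)
    have "s \<noteq> t" "s \<noteq> t + 1" using s(3) lt by auto
    then have "0 < real_of_int j" "real_of_int j < 1" using s(1,2) j by linarith+
    then show False by simp
  qed
  ultimately have "k = 1" by fastforce
  then show ?thesis using k by simp
qed

text \<open>If \<open>H ^^ l\<close> moves a point by an integer p, the averages along multiples of
  \<open>l\<close> tend to p / l, so the rotation number is rational.\<close>

lemma irrational_rotation_no_periodic_points:
  assumes H: "circle_lift h H" "\<And>t. H (t + 1) = H t + 1"
    and \<rho>: "has_rotation_number h \<rho>" "\<rho> \<notin> \<rat>" and l: "0 < l"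
  shows "(H ^^ l) t - t \<notin> \<int>"
proof
  assume "(H ^^ l) t - t \<in> \<int>"
  then obtain p where p: "(H ^^ l) t = t + of_int p" by (metis Ints_cases add.commute diff_add_cancel)
  obtain G where G: "circle_lift h G" "\<And>t. (\<lambda>n. (G ^^ n) t / real n) \<longlonglongrightarrow> \<rho>"
    using \<rho>(1) by (auto simp: has_rotation_number_def)
  \<comment> \<open>The lift \<open>G\<close> that realizes \<rho> may be another lift of
    \<open>h\<close>; it differs from \<open>H\<close> by this integer.\<close>
  define q where "q = G 0 - H 0"
  have GH: "to_circle (G s) = to_circle (H s)" for s
    using G(1) H(1) by (simp add: circle_lift_def)
  then have q_Int: "q \<in> \<int>" by (simp add: q_def to_circle_eq_iff)
  have Gq: "G s = H s + q" for s
  proof -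
    have "G s - H s = G 0 - H 0"
      using GH G(1) H(1)
      by (intro Ints_valued_constant[where S = UNIV and f = "\<lambda>s. G s - H s"])
        (auto simp: circle_lift_def to_circle_eq_iff intro!: continuous_intros)
    then show ?thesis by (simp add: q_def)
  qed
  have H_add: "H (s + of_int k) = H s + of_int k" for s k
    using translation_of_int[of H 1] H(2) by simp
  have Hn_add: "(H ^^ n) (s + of_int k) = (H ^^ n) s + of_int k" for n s k
    by (induction n) (simp_all add: H_add)
  obtain q' where q': "q = of_int q'" using q_Int by (elim Ints_cases)
  have Gn: "(G ^^ n) s = (H ^^ n) s + n * q" for n s
  proof (induction n)
    case (Suc n)
    have "H ((H ^^ n) s + n * q) = H ((H ^^ n) s) + n * q"
      using H_add[of "(H ^^ n) s" "int n * q'"] by (simp add: q')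
    then have "G ((G ^^ n) s) = H ((H ^^ n) s) + n * q + q" by (simp add: Suc Gq del: funpow.simps)
    then show ?case by (simp add: algebra_simps)
  qed simp
  have Hlm: "(H ^^ (l * m)) t = t + m * of_int p" for m
  proof (induction m)
    case (Suc m)
    have "(H ^^ (l * Suc m)) t = (H ^^ l) ((H ^^ (l * m)) t)"
      by (simp add: funpow_add)
    also have "\<dots> = (H ^^ l) t + m * of_int p"
      using Hn_add[of l t "int m * p"] by (simp add: Suc)
    finally show ?case by (simp add: p algebra_simps)
  qed simp
  have "(\<lambda>m. (G ^^ (l * m)) t / real (l * m)) \<longlonglongrightarrow> \<rho>"
  proof (rule filterlim_compose[OF G(2)])
    show "filterlim (\<lambda>m. l * m) at_top at_top"
      using l by (intro filterlim_subseq) (auto simp: strict_mono_def)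
  qed
  moreover have "(\<lambda>m. (G ^^ (l * m)) t / real (l * m)) \<longlonglongrightarrow> of_int p / l + q"
  proof -
    have "(\<lambda>m. t / real l * (1 / real m) + (of_int p / l + q)) \<longlonglongrightarrow> t / real l * 0 + (of_int p / l + q)"
      by (intro tendsto_intros lim_1_over_n)
    moreover have "\<forall>\<^sub>F m in sequentially. t / real l * (1 / real m) + (of_int p / l + q) =
        (G ^^ (l * m)) t / real (l * m)"
      by (rule eventually_mono[OF eventually_gt_at_top[of 0]])
        (use l in \<open>simp add: Gn Hlm Hlm[unfolded mult.commute[of l]] field_simps\<close>)
    ultimately show ?thesis by (simp add: tendsto_cong)
  qed
  ultimately have "\<rho> = of_int p / l + q" by (rule LIMSEQ_unique)
  also have "\<dots> \<in> \<rat>" using q' by auto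
  finally show False using \<rho>(2) by simp
qed

text \<open>For a fixed number of steps the distance of the displacement from the integers is
  continuous, periodic in t and nowhere zero, hence bounded below by compactness; finitely many such
  bounds are combined.\<close>

lemma uniformly_separated_iterates:
  fixes H :: "real \<Rightarrow> real"
  assumes cont: "continuous_on UNIV H" and add: "\<And>t. H (t + 1) = H t + 1"
    and aper: "\<And>l t. 0 < l \<Longrightarrow> (H ^^ l) t - t \<notin> \<int>"
  shows "\<exists>\<tau>>0. \<forall>l t p. 0 < l \<longrightarrow> l < L \<longrightarrow> p \<in> \<int> \<longrightarrow> \<tau> < \<bar>(H ^^ l) t - t - p\<bar>"
proof (induction L)
  case 0
  then show ?case by (auto intro: exI[of _ 1])
next
  case (Suc L)
  then obtain \<tau> where \<tau>: "0 < \<tau>"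
    "\<And>l t p. 0 < l \<Longrightarrow> l < L \<Longrightarrow> p \<in> \<int> \<Longrightarrow> \<tau> < \<bar>(H ^^ l) t - t - p\<bar>" by blast
  show ?case
  proof (cases "L = 0")
    case True
    then show ?thesis using \<tau>(1) by auto
  next
    case False
    have H_add: "(H ^^ n) (s + of_int k) = (H ^^ n) s + of_int k" for n s k
      using translation_of_int[of H 1] add by (induction n) simp_all
    define u where "u t = infdist ((H ^^ L) t - t) \<int>" for t
    have "continuous_on UNIV (H ^^ L)"
    proof (induction L)
      case (Suc n)
      then show ?case
        using continuous_on_compose[OF Suc continuous_on_subset[OF cont]] by simp
    qed (simp add: id_def)
    then have "continuous_on {0..1} u"
      unfolding u_def by (intro continuous_intros) (auto intro: continuous_on_subset)
    then obtain t0 where t0: "\<And>t. t \<in> {0..1} \<Longrightarrow> u t0 \<le> u t"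
      using continuous_attains_inf[of "{0..1::real}" u] by (metis atLeastAtMost_iff compact_Icc empty_iff order_refl zero_le_one)
    have pos: "0 < u t0"
    proof -
      have "closed (\<int>::real set)" "(\<int>::real set) \<noteq> {}" by auto
      then have "u t0 \<noteq> 0"
        using in_closed_iff_infdist_zero[of "\<int>::real set" "(H ^^ L) t0 - t0"] aper[of L t0] False
        by (auto simp: u_def)
      then show ?thesis using infdist_nonneg[of "(H ^^ L) t0 - t0" \<int>] by (simp add: u_def)
    qed
    have "u t0 \<le> \<bar>(H ^^ L) t - t - p\<bar>" if "p \<in> \<int>" for t p
    proof -
      have "u t0 \<le> u (frac t)" using t0[of "frac t"] by (simp add: frac_ge_0 frac_lt_1 less_imp_le)
      also have "\<dots> = u t"
        using H_add[of L "frac t" "\<lfloor>t\<rfloor>"] by (simp add: u_def frac_def algebra_simps)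
      also have "\<dots> \<le> \<bar>(H ^^ L) t - t - p\<bar>"
        using infdist_le[OF that, of "(H ^^ L) t - t"] by (simp add: u_def dist_real_def)
      finally show ?thesis .
    qed
    note 1 = this
    have "min \<tau> (u t0 / 2) < \<bar>(H ^^ l) t - t - p\<bar>" if "0 < l" "l < Suc L" "p \<in> \<int>" for l t p
    proof (cases "l = L")
      case True
      then show ?thesis using 1[OF that(3), of t] pos by (simp add: min_def)
    next
      case False
      then have "l < L" using that(2) by simp
      then show ?thesis using \<tau>(2)[OF that(1) _ that(3), of t] by (simp add: min_def)
    qed
    then show ?thesis using \<tau>(1) pos by (intro exI[of _ "min \<tau> (u t0 / 2)"]) simp
  qed
qed

section \<open>Irrational invariant curves of twist maps\<close>

text \<open>The twist condition integrated along a vertical line; it will show that a vertical line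
  meets the lifted curve only once.\<close>

lemma twist_strict_mono:
  assumes f: "positive_symplectic_twist_map f" and F: "annulus_lift f F" and r: "r < r'"
  shows "fst (F (t, r)) < fst (F (t, r'))"
proof (rule DERIV_pos_imp_increasing[OF r])
  fix s
  let ?D = "annulus_deriv f (to_annulus (t, s))"
  have "C1_annulus f" and pos: "0 < fst (?D (0, 1))"
    using f unfolding positive_symplectic_twist_map_def C1_diffeo_def
    by (blast, meson less_trans)
  then have "(F has_derivative blinfun_apply ?D) (at (t, s))"
    by (intro annulus_lift_has_derivative[OF F] C1_annulus_has_derivative)
  moreover have "((\<lambda>s. (t, s)) has_derivative (\<lambda>h. (0, h))) (at s)"
    by (auto intro!: derivative_eq_intros)
  ultimately have "((\<lambda>s. F (t, s)) has_derivative (\<lambda>h. ?D (0, h))) (at s)"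
    using has_derivative_compose[of "\<lambda>s. (t, s)" "\<lambda>h. (0, h)" s UNIV F] by simp
  then have "((\<lambda>s. fst (F (t, s))) has_derivative (\<lambda>h. fst (?D (0, h)))) (at s)"
    by (rule has_derivative_fst)
  moreover have "(\<lambda>h. fst (?D (0, h))) = (*) (fst (?D (0, 1)))"
  proof
    fix h :: real
    have "?D (0, h) = h *\<^sub>R ?D (0, 1)" by (simp flip: blinfun.scaleR_right)
    then show "fst (?D (0, h)) = fst (?D (0, 1)) * h" by simp
  qed
  ultimately have "DERIV (\<lambda>s. fst (F (t, s))) s :> fst (?D (0, 1))"
    by (simp add: has_field_derivative_def)
  with pos show "\<exists>y. DERIV (\<lambda>s. fst (F (t, s))) s :> y \<and> 0 < y" by blast
qed

text \<open>
  If the end points of the lift agreed, contracting it in the plane would contract the curve.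
\<close>

lemma essential_curve_lift:
  assumes "essential_curve \<gamma>"
  obtains p k where "path p" "\<gamma> = to_annulus ` path_image p" "k \<noteq> 0"
    "pathfinish p = pathstart p + (of_int k, 0)"
proof -
  obtain c where c: "simple_path c" "pathfinish c = pathstart c"
    "\<not> (\<exists>a. homotopic_loops UNIV c (\<lambda>_. a))" "\<gamma> = path_image c"
    using assms unfolding essential_curve_def by blast
  have cont: "continuous_on {0..1} c"
    using simple_path_imp_path[OF c(1)] by (simp add: path_def)
  then have "continuous_on {0..1} (\<lambda>s. fst (c s))" by (intro continuous_intros)
  then obtain L where L: "continuous_on {0..1} L" "\<And>s. s \<in> {0..1} \<Longrightarrow> to_circle (L s) = fst (c s)"
    using lift_to_circle[OF convex_closed_interval] by metis
  define p where "p s = (L s, snd (c s))" for s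
  have p: "to_annulus (p s) = c s" if "s \<in> {0..1}" for s
    using L(2)[OF that] by (simp add: p_def to_annulus_def)
  have path: "path p"
    unfolding path_def p_def by (intro continuous_intros L cont)
  have ends: "to_annulus (p 1) = to_annulus (p 0)"
    using p[of 0] p[of 1] c(2) by (simp add: pathfinish_def pathstart_def)
  then obtain k where k: "k \<in> \<int>" "p 1 = p 0 + (k, 0)" by (rule to_annulus_eqE)
  have "k \<noteq> 0"
  proof
    assume "k = 0"
    then have "pathfinish p = pathstart p" using k(2) by (simp add: pathfinish_def pathstart_def flip: zero_prod_def)
    then have "homotopic_loops UNIV p (\<lambda>_. p 0)"
      using path by (intro homotopic_loops_linear) (auto simp: path_def pathfinish_def pathstart_def)
    then have "homotopic_loops UNIV (to_annulus \<circ> p) (to_annulus \<circ> (\<lambda>_. p 0))"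
      by (rule homotopic_loops_continuous_image) (auto intro: continuous_on_to_annulus)
    moreover have "homotopic_loops UNIV c (to_annulus \<circ> p)"
      using p c(2) simple_path_imp_path[OF c(1)] by (intro homotopic_loops_eq) auto
    ultimately have "homotopic_loops UNIV c (\<lambda>_. to_annulus (p 0))"
      using homotopic_loops_trans by (fastforce simp: o_def)
    then show False using c(3) by blast
  qed
  moreover have "\<gamma> = to_annulus ` path_image p"
    using p unfolding c(4) path_image_def by (force simp: image_image)
  ultimately show ?thesis
    using that[OF path] k by (auto simp: pathfinish_def pathstart_def elim!: Ints_cases)
qed

text \<open>
  The projected dynamics \<open>h\<close> turns the curve into a graph: along the lifted curve \<open>F\<^sub>1(t, r)\<close>
  and the lift \<open>H(t)\<close> of \<open>h\<close> differ by a constant, so the twist condition determines \<open>r\<close> by \<open>t\<close>.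
\<close>

lemma invariant_curve_is_graph:
  assumes f: "positive_symplectic_twist_map f" and F: "annulus_lift f F"
    and \<gamma>: "essential_curve \<gamma>" "f ` \<gamma> = \<gamma>"
    and h: "\<And>x. x \<in> \<gamma> \<Longrightarrow> h (fst x) = fst (f x)"
    and G: "circle_lift h G" "\<And>t. G (t + 1) = G t + 1"
  obtains c g where "c \<in> \<int>" "continuous_on UNIV g"
    "\<forall>z. to_annulus z \<in> \<gamma> \<longleftrightarrow> snd z = g (fst z)"
    "\<forall>t. F (t, g t) = (G t + c, g (G t + c))"
proof -
  obtain p k where p: "path p" "\<gamma> = to_annulus ` path_image p" "k \<noteq> 0"
    "pathfinish p = pathstart p + (of_int k, 0)"
    by (rule essential_curve_lift[OF \<gamma>(1)])
  have cont_p: "continuous_on {0..1} p" using p(1) by (simp add: path_def)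
  have cont_F: "continuous_on S F" for S
    using annulus_lift_continuous[OF F] by (rule continuous_on_subset) simp
  have cont_G: "continuous_on S G" for S
    using G(1) unfolding circle_lift_def by (auto intro: continuous_on_subset)
  have p_in: "to_annulus (p s) \<in> \<gamma>" if "s \<in> {0..1}" for s
    using that p(2) by (auto simp: path_image_def)
  have F_G: "to_circle (fst (F z)) = to_circle (G (fst z))" if "to_annulus z \<in> \<gamma>" for z
  proof -
    have "to_circle (fst (F z)) = fst (f (to_annulus z))"
      by (simp flip: annulus_liftD[OF F])
    also have "\<dots> = h (to_circle (fst z))" using h[OF that] by simp
    also have "\<dots> = to_circle (G (fst z))" using G(1) by (simp add: circle_lift_def)
    finally show ?thesis .
  qed
  \<comment> \<open>Along the path \<open>p\<close>, the functions \<open>fst (F (p s))\<close> and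
    \<open>G (fst (p s))\<close> lift the same map into the circle, so their difference is a
    constant integer.\<close>
  define c where "c = fst (F (p 0)) - G (fst (p 0))"
  have c: "c \<in> \<int>" using F_G[OF p_in[of 0]] by (simp add: c_def to_circle_eq_iff)
  have p_const: "fst (F (p s)) = G (fst (p s)) + c" if s: "s \<in> {0..1}" for s
  proof -
    have "fst (F (p s)) - G (fst (p s)) = fst (F (p 0)) - G (fst (p 0))"
    proof (rule Ints_valued_constant[where S = "{0..1}" and f = "\<lambda>s. fst (F (p s)) - G (fst (p s))"])
      show "continuous_on {0..1} (\<lambda>s. fst (F (p s)) - G (fst (p s)))"
        by (intro continuous_intros continuous_on_compose2[OF cont_F[of UNIV] cont_p]
            continuous_on_compose2[OF cont_G[of UNIV]] cont_p) auto
      show "fst (F (p s)) - G (fst (p s)) \<in> \<int>" if "s \<in> {0..1}" for s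
        using F_G[OF p_in[OF that]] by (simp add: to_circle_eq_iff)
    qed (use s in auto)
    then show ?thesis by (simp add: c_def)
  qed
  have G_add: "G (t + of_int j) = G t + of_int j" for t j
    using translation_of_int[of G 1] G(2) by simp
  define d where "d = fst (F ((0, 0) + (1, 0))) - fst (F (0, 0))"
  have F_add1: "fst (F (z + (1, 0))) = fst (F z) + d" for z
  proof -
    have "fst (F (z + (1, 0))) - fst (F z) = d"
      unfolding d_def
    proof (rule Ints_valued_constant[where S = UNIV and f = "\<lambda>z. fst (F (z + (1, 0))) - fst (F z)"])
      show "continuous_on UNIV (\<lambda>z. fst (F (z + (1, 0))) - fst (F z))"
        by (intro continuous_intros continuous_on_compose2[OF cont_F[of UNIV]]) auto
      fix z
      have "to_annulus (F (z + (1, 0))) = to_annulus (F z)" by (simp add: annulus_liftD[OF F])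
      then show "fst (F (z + (1, 0))) - fst (F z) \<in> \<int>" by (simp add: to_annulus_eq_iff)
    qed auto
    then show ?thesis by simp
  qed
  have F_add': "fst (F (z + (of_int j, 0))) = fst (F z) + of_int j * d" for z j
    using translation_of_int[of "\<lambda>t. fst (F (t, snd z))" d "fst z" j]
      F_add1[of "(t, snd z)" for t] by (cases z) simp
  \<comment> \<open>Between the ends of the path the first component of \<open>F\<close> changes by
    k d and \<open>G\<close> by k. The two changes agree, and k is nonzero because the curve is
    essential.\<close>
  have "d = 1"
  proof -
    have "p 1 = p 0 + (of_int k, 0)" using p(4) by (simp add: pathfinish_def pathstart_def)
    then have "of_int k * d = fst (F (p 1)) - fst (F (p 0))" using F_add'[of "p 0" k] by simp
    also have "\<dots> = G (fst (p 1)) - G (fst (p 0))" using p_const[of 0] p_const[of 1] by simp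
    also have "\<dots> = of_int k" using \<open>p 1 = p 0 + (of_int k, 0)\<close> by (simp add: G_add)
    finally show ?thesis using p(3) by simp
  qed
  then have F_add: "fst (F (z + (of_int j, 0))) = fst (F z) + of_int j" for z j
    using F_add' by simp
  have F_eq: "fst (F z) = G (fst z) + c" if "to_annulus z \<in> \<gamma>" for z
  proof -
    obtain s where s: "s \<in> {0..1}" "to_annulus z = to_annulus (p s)"
      using \<open>to_annulus z \<in> \<gamma>\<close> p(2) by (auto simp: path_image_def)
    obtain j where j: "j \<in> \<int>" "z = p s + (j, 0)" using s(2) by (rule to_annulus_eqE)
    then obtain i where i: "z = p s + (of_int i, 0)" by (auto elim: Ints_cases)
    have "fst (F z) = fst (F (p s)) + of_int i" unfolding i by (rule F_add)
    moreover have "G (fst z) = G (fst (p s)) + of_int i" by (simp add: i G_add)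
    ultimately show ?thesis using p_const[OF s(1)] by simp
  qed
  have unique: "r = r'" if "to_annulus (t, r) \<in> \<gamma>" "to_annulus (t, r') \<in> \<gamma>" for t r r'
    using F_eq[OF that(1)] F_eq[OF that(2)] twist_strict_mono[OF f F, of r r' t]
      twist_strict_mono[OF f F, of r' r t]
    by (cases r r' rule: linorder_cases) auto
  \<comment> \<open>The abscissa of the path sweeps an interval of length at least 1, so it meets
    every class modulo 1.\<close>
  have exist: "\<exists>r. to_annulus (t, r) \<in> \<gamma>" for t
  proof -
    let ?a = "min (fst (p 0)) (fst (p 1))" and ?b = "max (fst (p 0)) (fst (p 1))"
    define j where "j = \<lceil>?a - t\<rceil>"
    have "fst (p 1) = fst (p 0) + of_int k" using p(4) by (simp add: pathfinish_def pathstart_def)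
    then have "?a + 1 \<le> ?b" using p(3) by (auto simp: min_def max_def)
    moreover have "?a \<le> t + of_int j" "t + of_int j \<le> ?a + 1" unfolding j_def by linarith+
    ultimately have "?a \<le> t + of_int j" "t + of_int j \<le> ?b" by linarith+
    moreover have "connected ((\<lambda>s. fst (p s)) ` {0..1})"
      by (intro connected_continuous_image continuous_intros cont_p) simp
    moreover have "?a \<in> (\<lambda>s. fst (p s)) ` {0..1}" "?b \<in> (\<lambda>s. fst (p s)) ` {0..1}"
      by (auto simp: min_def max_def)
    ultimately have "t + of_int j \<in> (\<lambda>s. fst (p s)) ` {0..1}"
      by (meson connectedD_interval)
    then obtain s where s: "s \<in> {0..1}" "t + of_int j = fst (p s)" by auto
    have "(t, snd (p s)) + (of_int j, 0) = p s" using s(2) by (simp add: prod_eq_iff)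
    then have "to_annulus (t, snd (p s)) = to_annulus (p s)"
      using to_annulus_add_Int[of "of_int j" "(t, snd (p s))"] by simp
    then show ?thesis using p_in[OF s(1)] by metis
  qed
  define g where "g t = (SOME r. to_annulus (t, r) \<in> \<gamma>)" for t
  have g: "to_annulus (t, g t) \<in> \<gamma>" for t unfolding g_def by (rule someI_ex[OF exist])
  have graph: "to_annulus z \<in> \<gamma> \<longleftrightarrow> snd z = g (fst z)" for z
    using unique[of "fst z" "snd z" "g (fst z)"] g[of "fst z"] by (cases z) auto
  have compact: "compact \<gamma>"
    unfolding p(2) using p(1)
    by (intro compact_continuous_image continuous_on_to_annulus compact_path_image)
  have cont_g: "continuous_on UNIV g"
  proof (rule continuous_from_closed_graph)
    show "compact (snd ` \<gamma>)" by (intro compact_continuous_image compact continuous_intros)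
    show "g \<in> UNIV \<rightarrow> snd ` \<gamma>" using g by (force simp: image_iff)
    have "(\<lambda>x. (x, g x)) ` UNIV = to_annulus -` \<gamma>" using graph by force
    moreover have "closed (to_annulus -` \<gamma>)"
      using compact_imp_closed[OF compact] continuous_on_to_annulus[of UNIV]
      by (simp add: continuous_on_closed_vimage)
    ultimately show "closed ((\<lambda>x. (x, g x)) ` UNIV)" by simp
  qed
  show ?thesis
  proof (rule that[OF c cont_g], use graph in blast, rule allI)
    fix t
    have "to_annulus (F (t, g t)) \<in> \<gamma>"
      using g[of t] \<gamma>(2) annulus_liftD[OF F] by force
    then have "snd (F (t, g t)) = g (fst (F (t, g t)))" by (simp add: graph)
    then show "F (t, g t) = (G t + c, g (G t + c))"
      using F_eq[OF g[of t]] by (simp add: prod_eq_iff)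
  qed
qed

text \<open>The segment from \<open>z\<close> to \<open>w\<close> leaves the curve, so a Hoelder
  bound is needed on a neighbourhood of \<gamma>: a finite subcover and its Lebesgue number make the
  local constants uniform. The estimate is then the mean value inequality on the segment.\<close>

lemma locally_Holder_linearization:
  assumes f: "C1_annulus f" and F: "annulus_lift f F"
    and Holder: "locally_Holder \<alpha> (annulus_deriv f)" and \<alpha>: "0 < \<alpha>" and \<gamma>: "compact \<gamma>"
  obtains C \<delta> where "0 \<le> C" "0 < \<delta>"
    "\<And>z w. to_annulus z \<in> \<gamma> \<Longrightarrow> norm (w - z) \<le> \<delta> \<Longrightarrow>
      norm ((F w - F z) - annulus_deriv f (to_annulus z) (w - z)) \<le> C * norm (w - z) powr (1 + \<alpha>)"
proof -
  let ?A = "annulus_deriv f"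
  obtain U c where Uc: "\<forall>x. open (U x) \<and> x \<in> U x \<and>
      (\<forall>y\<in>U x. \<forall>z\<in>U x. dist (?A y) (?A z) \<le> c x * dist y z powr \<alpha>)"
    using Holder unfolding locally_Holder_def choice_iff by blast
  have U: "open (U x)" "x \<in> U x"
    "y \<in> U x \<Longrightarrow> z \<in> U x \<Longrightarrow> dist (?A y) (?A z) \<le> c x * dist y z powr \<alpha>" for x y z
    using Uc by blast+
  obtain T where T: "T \<subseteq> \<gamma>" "finite T" "\<gamma> \<subseteq> (\<Union>x\<in>T. U x)"
    using compactE_image[OF \<gamma>, of \<gamma> U] U by blast
  obtain \<epsilon> where \<epsilon>: "0 < \<epsilon>" "\<And>x. x \<in> \<gamma> \<Longrightarrow> \<exists>V\<in>U ` T. ball x \<epsilon> \<subseteq> V"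
    by (rule Heine_Borel_lemma[OF \<gamma> T(3)]) (use U(1) in blast)+
  define C where "C = (\<Sum>x\<in>T. \<bar>c x\<bar>)"
  have C: "0 \<le> C" by (simp add: C_def sum_nonneg)
  have c_le: "c x \<le> C" if "x \<in> T" for x
    unfolding C_def using member_le_sum[of x T "\<lambda>x. \<bar>c x\<bar>"] that T(2) by force
  have deriv: "(F has_derivative blinfun_apply (?A (to_annulus w))) (at w)" for w
    by (rule annulus_lift_has_derivative[OF F C1_annulus_has_derivative[OF f]])
  show ?thesis
  proof
    fix z w assume z: "to_annulus z \<in> \<gamma>" and w: "norm (w - z) \<le> \<epsilon> / 2"
    obtain x where x: "x \<in> T" "ball (to_annulus z) \<epsilon> \<subseteq> U x" using \<epsilon>(2)[OF z] by auto
    have near: "dist (?A (to_annulus y)) (?A (to_annulus z)) \<le> C * norm (w - z) powr \<alpha>"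
      if y: "y \<in> closed_segment z w" for y
    proof -
      have yz: "dist y z \<le> norm (w - z)"
        using segment_bound1[OF y] by (simp add: dist_norm)
      have "to_annulus y \<in> ball (to_annulus z) \<epsilon>" "to_annulus z \<in> ball (to_annulus z) \<epsilon>"
        using dist_to_annulus_le[of y z] yz w \<epsilon>(1) by (simp_all add: dist_commute)
      then have "to_annulus y \<in> U x" "to_annulus z \<in> U x" using x(2) by blast+
      then have "dist (?A (to_annulus y)) (?A (to_annulus z)) \<le>
          c x * dist (to_annulus y) (to_annulus z) powr \<alpha>" by (rule U(3))
      also have "\<dots> \<le> C * norm (w - z) powr \<alpha>"
        using c_le[OF x(1)] C \<alpha> dist_to_annulus_le[of y z] yz
        by (intro mult_mono powr_mono2) auto
      finally show ?thesis .
    qed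
    have "norm (F w - F z - ?A (to_annulus z) (w - z)) \<le> norm (w - z) * (C * norm (w - z) powr \<alpha>)"
    proof (rule differentiable_bound_linearization[where S = "closed_segment z w"
          and f' = "\<lambda>y. blinfun_apply (?A (to_annulus y))"])
      show "z + t *\<^sub>R (w - z) \<in> closed_segment z w" if "t \<in> {0..1}" for t
        using that by (auto simp: closed_segment_def algebra_simps intro!: exI[of _ t])
      show "(F has_derivative blinfun_apply (?A (to_annulus y))) (at y within closed_segment z w)" for y
        by (rule has_derivative_at_withinI[OF deriv])
      show "onorm (blinfun_apply (?A (to_annulus y)) - blinfun_apply (?A (to_annulus z))) \<le>
          C * norm (w - z) powr \<alpha>" if "y \<in> closed_segment z w" for y
        using near[OF that]
        by (simp add: dist_norm norm_blinfun.rep_eq minus_blinfun.rep_eq fun_diff_def)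
    qed simp
    also have "\<dots> = C * norm (w - z) powr (1 + \<alpha>)"
      by (cases "w = z") (simp_all add: powr_add)
    finally show "norm (F w - F z - ?A (to_annulus z) (w - z)) \<le> C * norm (w - z) powr (1 + \<alpha>)" .
  qed (use C \<epsilon> in auto)
qed

lemma uniform_subexponential_growth:
  assumes f: "positive_symplectic_twist_map f" "C1_Holder f"
    and \<gamma>: "essential_curve \<gamma>" "f ` \<gamma> = \<gamma>" "irrational_curve f \<gamma>" and \<epsilon>: "0 < \<epsilon>"
  shows "\<exists>K. \<forall>n. \<forall>x\<in>\<gamma>. norm (annulus_deriv (f ^^ n) x) \<le> K * exp (\<epsilon> * real n)"
proof -
  let ?D = "annulus_deriv f"
  have C1: "C1_annulus f" and sympl: "sympl_map (?D x)" for x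
    using f(1) unfolding positive_symplectic_twist_map_def C1_diffeo_def symplectic_def sympl_map_def
    by blast+
  obtain \<alpha> where \<alpha>: "0 < \<alpha>" "locally_Holder \<alpha> ?D"
    using f(2) unfolding C1_Holder_def by blast
  obtain F where F: "annulus_lift f F" by (rule C1_annulus_lift[OF C1])
  obtain h \<rho> where h: "\<And>x. x \<in> \<gamma> \<Longrightarrow> h (fst x) = fst (f x)" "orientation_preserving_homeo h"
    "has_rotation_number h \<rho>" "\<rho> \<notin> \<rat>"
    using \<gamma>(3) unfolding irrational_curve_def by blast
  obtain G where G: "circle_lift h G" "strict_mono G"
    using h(2) unfolding orientation_preserving_homeo_def by blast
  have "inj h"
    using h(2) unfolding orientation_preserving_homeo_def homeomorphism_def
    by (metis UNIV_I inj_on_inverseI)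
  then have G1: "G (t + 1) = G t + 1" for t by (rule circle_lift_add_1[OF G])
  obtain c g where cg: "c \<in> \<int>" "continuous_on UNIV g"
    "\<forall>z. to_annulus z \<in> \<gamma> \<longleftrightarrow> snd z = g (fst z)"
    "\<forall>t. F (t, g t) = (G t + c, g (G t + c))"
    by (rule invariant_curve_is_graph[OF f(1) F \<gamma>(1,2) h(1) G(1) G1])
  note g = cg(1,2) cg(3,4)[rule_format]
  \<comment> \<open>The shift by \<open>c\<close> selects the lift of \<open>h\<close> for which
    \<open>F\<close> sends \<open>\<Gamma> t\<close> to \<open>\<Gamma> (H t)\<close> itself, not
    only to a translate of it.\<close>
  define H where "H t = G t + c" for t
  define \<Gamma> where "\<Gamma> t = (t, g t)" for t
  define A where "A t = ?D (to_annulus (\<Gamma> t))" for t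
  have H: "circle_lift h H" "strict_mono H" "continuous_on UNIV H" and H1: "H (t + 1) = H t + 1" for t
    using G G1 g(1)
    by (auto simp: circle_lift_def H_def strict_mono_def intro!: continuous_intros)
  have \<Gamma>_in: "to_annulus (\<Gamma> t) \<in> \<gamma>" for t by (simp add: g(3) \<Gamma>_def)
  have F_\<Gamma>: "F (\<Gamma> t) = \<Gamma> (H t)" for t by (simp add: \<Gamma>_def H_def g(4))
  have cont_\<Gamma>: "continuous_on UNIV \<Gamma>" unfolding \<Gamma>_def by (intro continuous_intros g(2))
  have g1: "g (t + 1) = g t" for t
  proof -
    have "to_annulus (t + 1, g t) = to_annulus (\<Gamma> t)" by (simp add: to_annulus_eq_iff \<Gamma>_def)
    then have "to_annulus (t + 1, g t) \<in> \<gamma>" using \<Gamma>_in by simp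
    then show ?thesis by (simp add: g(3))
  qed
  have compact: "compact \<gamma>"
    using \<gamma>(1) unfolding essential_curve_def by (metis compact_simple_path_image)
  obtain M where M: "\<And>t. norm (A t) \<le> M"
  proof -
    have "compact (?D ` \<gamma>)"
      using C1 by (intro compact_continuous_image compact)
        (auto simp: C1_annulus_def intro: continuous_on_subset)
    then obtain M where "\<And>x. x \<in> \<gamma> \<Longrightarrow> norm (?D x) \<le> M"
      using compact_imp_bounded bounded_iff by (metis image_eqI)
    then have "norm (A t) \<le> M" for t using \<Gamma>_in by (simp add: A_def)
    then show ?thesis by (rule that)
  qed
  obtain C \<delta> where C: "0 \<le> C" "0 < \<delta>"
    "\<And>z w. to_annulus z \<in> \<gamma> \<Longrightarrow> norm (w - z) \<le> \<delta> \<Longrightarrow>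
      norm ((F w - F z) - ?D (to_annulus z) (w - z)) \<le> C * norm (w - z) powr (1 + \<alpha>)"
    by (rule locally_Holder_linearization[OF C1 F \<alpha>(2,1) compact]) blast
  have H_add: "H (t + of_int k) = H t + of_int k" for t k
    using translation_of_int[of H 1] H1 by simp
  have surj_H: "surj H"
  proof -
    have "\<exists>t. H t = s" for s
    proof -
      define k where "k = \<lfloor>s - H 0\<rfloor>"
      have "H (of_int k) \<le> s" "s \<le> H (of_int k + 1)"
        using H_add[of 0 k] H1[of "of_int k"] unfolding k_def by simp_all linarith+
      then have "\<exists>t\<ge>of_int k. t \<le> of_int k + 1 \<and> H t = s"
        by (intro IVT') (auto intro: continuous_on_subset[OF H(3)])
      then show ?thesis by blast
    qed
    then show ?thesis by (metis surjI)
  qed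
  have inj_H: "inj H" using H(2) by (rule strict_mono_imp_inj_on)
  define H' where "H' = inv H"
  have H': "H' (H t) = t" "H (H' t) = t" for t
    using inj_H surj_H by (simp_all add: H'_def surj_f_inv_f)
  have H'_add: "H' (t + of_int k) = H' t + of_int k" for t k
    by (metis H' H_add)
  have cont_H': "continuous_on UNIV H'"
  proof (rule continuous_onI_mono)
    show "open (range H')" using H'(1) by (metis open_UNIV surjI)
    show "H' x \<le> H' y" if "x \<le> y" for x y
      using that H' H(2) by (metis strict_mono_less_eq)
  qed
  interpret invariant_curve H A M H' \<Gamma> C \<alpha> \<delta>
  proof unfold_locales
    show "uniformly_continuous_on UNIV H'"
      by (rule uniformly_continuous_on_periodic[OF cont_H']) (simp add: H'_add dist_real_def)
    have "g (t + of_int k) = g t" for t k using translation_of_int[of g 0] g1 by simp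
    then show "uniformly_continuous_on UNIV \<Gamma>"
      by (intro uniformly_continuous_on_periodic[OF cont_\<Gamma>])
        (simp add: \<Gamma>_def dist_Pair_Pair dist_real_def)
    show "H (t + p) = H t + p" if "p \<in> \<int>" for p t
      using that H_add by (auto elim: Ints_cases)
    show "\<exists>\<tau>>0. \<forall>l t p. 0 < l \<longrightarrow> l < L \<longrightarrow> p \<in> \<int> \<longrightarrow> \<tau> < \<bar>(H ^^ l) t - t - p\<bar>" for L
      by (rule uniformly_separated_iterates[OF H(3) H1
            irrational_rotation_no_periodic_points[OF H(1) H1 h(3,4)]])
    show "norm ((\<Gamma> (H y) - \<Gamma> (H x)) - A x (\<Gamma> y - \<Gamma> x)) \<le> C * norm (\<Gamma> y - \<Gamma> x) powr (1 + \<alpha>)"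
      if "norm (\<Gamma> y - \<Gamma> x) \<le> \<delta>" for x y
      using C(3)[OF \<Gamma>_in that] by (simp add: F_\<Gamma> A_def)
  qed (use H' H(2) M C(1,2) \<alpha>(1) sympl g1 in \<open>simp_all add: A_def \<Gamma>_def\<close>)
  have "(f ^^ n) (to_annulus (\<Gamma> t)) = to_annulus (\<Gamma> ((H ^^ n) t))" for n t
    by (induction n) (simp_all add: F_\<Gamma> flip: annulus_liftD[OF F])
  then have "cocycle f ?D n (to_annulus (\<Gamma> t)) = P n t" for n t
    by (induction n) (simp_all add: A_def)
  then have "annulus_deriv (f ^^ n) (to_annulus (\<Gamma> t)) = P n t" for n t
    by (simp add: annulus_deriv_funpow[OF C1])
  moreover have "\<exists>t. x = to_annulus (\<Gamma> t)" if "x \<in> \<gamma>" for x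
  proof -
    obtain z where z: "x = to_annulus z" by (rule to_annulus_cases)
    then have "to_annulus z \<in> \<gamma>" using that by simp
    then have "snd z = g (fst z)" by (simp only: g(3))
    then have "z = \<Gamma> (fst z)" by (simp add: \<Gamma>_def prod_eq_iff)
    then show ?thesis using z by metis
  qed
  ultimately show ?thesis using subexponential_growth[OF \<epsilon>] by metis
qed

text \<open>By area preservation \<open>norm v \<le> norm (B n) * norm (B n v)\<close>, so slow
  growth of the norms also rules out exponential decay of any nonzero vector.\<close>

lemma subexponential_imp_zero_exponent:
  fixes B :: "nat \<Rightarrow> (real \<times> real) \<Rightarrow>\<^sub>L (real \<times> real)"
  assumes B: "\<And>n. sympl_map (B n)"
    and growth: "\<And>\<epsilon>. 0 < \<epsilon> \<Longrightarrow> \<exists>K. \<forall>n. norm (B n) \<le> K * exp (\<epsilon> * real n)" and v: "v \<noteq> 0"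
  shows "(\<lambda>n. ln (norm (B n v)) / real n) \<longlonglongrightarrow> 0"
proof (rule LIMSEQ_I)
  fix e :: real assume e: "0 < e"
  then obtain K where K: "\<And>n. norm (B n) \<le> K * exp (e / 2 * real n)" using growth[of "e / 2"] by auto
  have K1: "1 \<le> K" using K[of 0] sympl_map_norm_ge_1[OF B, of 0] by simp
  define R where "R = \<bar>ln (norm v)\<bar> + ln K"
  have bound: "\<bar>ln (norm (B n v))\<bar> \<le> R + e / 2 * n" for n
  proof -
    have nB: "1 \<le> norm (B n)" by (rule sympl_map_norm_ge_1[OF B])
    have lower: "norm v \<le> norm (B n) * norm (B n v)" by (rule sympl_map_norm_le[OF B])
    then have "B n v \<noteq> 0" using v by auto
    then have pos: "0 < norm (B n v)" by simp
    have nB': "B n \<noteq> 0" using nB by auto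
    have "ln (norm v) \<le> ln (norm (B n) * norm (B n v))"
      using lower v pos nB' by (subst ln_le_cancel_iff) auto
    also have "\<dots> = ln (norm (B n)) + ln (norm (B n v))"
      using pos nB' by (simp add: ln_mult)
    finally have 1: "ln (norm v) \<le> ln (norm (B n)) + ln (norm (B n v))" .
    have "ln (norm (B n v)) \<le> ln (norm (B n) * norm v)"
      using norm_blinfun[of "B n" v] v pos nB' by (subst ln_le_cancel_iff) auto
    also have "\<dots> = ln (norm (B n)) + ln (norm v)"
      using v nB' by (simp add: ln_mult)
    finally have 2: "ln (norm (B n v)) \<le> ln (norm (B n)) + ln (norm v)" .
    have "ln (norm (B n)) \<le> ln (K * exp (e / 2 * real n))"
      using K[of n] nB' K1 by (subst ln_le_cancel_iff) auto
    also have "\<dots> = ln K + e / 2 * n" using K1 by (simp add: ln_mult)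
    finally show ?thesis using 1 2 unfolding R_def by linarith
  qed
  obtain n0 where n0: "2 * R / e < real n0" using reals_Archimedean2 by blast
  have "norm (ln (norm (B n v)) / real n - 0) < e" if "Suc n0 \<le> n" for n
  proof -
    have "2 * R / e < real n" using n0 that by linarith
    then have "R < e / 2 * n" using e by (simp add: field_simps)
    then have "\<bar>ln (norm (B n v))\<bar> < e * n" using bound[of n] by (simp add: field_simps)
    then show ?thesis using that by (simp add: field_simps)
  qed
  then show "\<exists>n0. \<forall>n\<ge>n0. norm (ln (norm (B n v)) / real n - 0) < e" by blast
qed

theorem corollary1:
  fixes f :: "annulus \<Rightarrow> annulus" and \<gamma> :: "annulus set" and \<mu> :: "annulus measure"
  assumes "positive_symplectic_twist_map f" and "C1_Holder f"
    and "essential_curve \<gamma>" and "f ` \<gamma> = \<gamma>" and "irrational_curve f \<gamma>"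
    and "prob_space \<mu>" and "sets \<mu> = sets borel"
    and "distr \<mu> borel f = \<mu>" and "emeasure \<mu> \<gamma> = 1"
  shows "AE x in \<mu>. \<forall>v. v \<noteq> 0 \<longrightarrow> has_lyapunov_exponent f x v 0"
proof -
  interpret prob_space \<mu> by fact
  let ?D = "annulus_deriv f"
  have C1: "C1_annulus f" "C1_annulus (inv f)" and bij: "bij f" and sympl: "sympl_map (?D x)" for x
    using assms(1)
    unfolding positive_symplectic_twist_map_def C1_diffeo_def symplectic_def sympl_map_def
    by blast+
  have sympl_n: "sympl_map (annulus_deriv (f ^^ n) x)" for n x
    unfolding annulus_deriv_funpow[OF C1(1)]
    by (induction n) (simp_all add: sympl_map_compose sympl)
  have growth: "\<exists>K. \<forall>n. \<forall>x\<in>\<gamma>. norm (annulus_deriv (f ^^ n) x) \<le> K * exp (\<epsilon> * real n)" if "0 < \<epsilon>" for \<epsilon>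
    by (rule uniform_subexponential_growth[OF assms(1-5) that])
  have f_inv: "(f ^^ n) ((inv f ^^ n) x) = x" for n x
  proof (induction n arbitrary: x)
    case (Suc n)
    have "(f ^^ Suc n) ((inv f ^^ Suc n) x) = f ((f ^^ n) ((inv f ^^ n) (inv f x)))"
      by (simp add: funpow_swap1)
    then show ?case using Suc bij by (simp add: bij_is_surj surj_f_inv_f)
  qed simp
  have inv_in: "(inv f ^^ n) x \<in> \<gamma>" if "x \<in> \<gamma>" for n x
  proof (induction n)
    case (Suc n)
    then obtain y where "y \<in> \<gamma>" "(inv f ^^ n) x = f y" using assms(4) by blast
    then show ?case using bij by (simp add: bij_is_inj)
  qed (use that in simp)
  have inverse: "annulus_deriv (f ^^ n) ((inv f ^^ n) x) (annulus_deriv (inv f ^^ n) x v) = v" for n x v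
  proof -
    have "has_annulus_derivative (f ^^ n \<circ> inv f ^^ n)
        (annulus_deriv (f ^^ n) ((inv f ^^ n) x) o\<^sub>L annulus_deriv (inv f ^^ n) x) x"
      using has_annulus_derivative_funpow[OF C1(1)] has_annulus_derivative_funpow[OF C1(2)]
      unfolding annulus_deriv_funpow[OF C1(1)] annulus_deriv_funpow[OF C1(2)]
      by (intro has_annulus_derivative_compose) auto
    moreover have "f ^^ n \<circ> inv f ^^ n = id" by (simp add: fun_eq_iff f_inv)
    ultimately have "annulus_deriv (f ^^ n) ((inv f ^^ n) x) o\<^sub>L annulus_deriv (inv f ^^ n) x = id_blinfun"
      using has_annulus_derivative_unique[OF _ has_annulus_derivative_id] by simp
    from arg_cong[OF this, of "\<lambda>B. blinfun_apply B v"] show ?thesis by simp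
  qed
  have zero: "has_lyapunov_exponent f x v 0" if x: "x \<in> \<gamma>" and v: "v \<noteq> 0" for x v
    unfolding has_lyapunov_exponent_def minus_zero
  proof
    show "(\<lambda>n. ln (norm (annulus_deriv (f ^^ n) x v)) / real n) \<longlonglongrightarrow> 0"
    proof (rule subexponential_imp_zero_exponent[OF sympl_n _ v])
      show "\<exists>K. \<forall>n. norm (annulus_deriv (f ^^ n) x) \<le> K * exp (\<epsilon> * real n)" if "0 < \<epsilon>" for \<epsilon>
        using growth[OF that] x by blast
    qed
    show "(\<lambda>n. ln (norm (annulus_deriv (inv f ^^ n) x v)) / real n) \<longlonglongrightarrow> 0"
    proof (rule subexponential_imp_zero_exponent[OF _ _ v])
      show "sympl_map (annulus_deriv (inv f ^^ n) x)" for n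
        unfolding sympl_map_def
        using sympl_mapD[OF sympl_n[of n "(inv f ^^ n) x"], of "annulus_deriv (inv f ^^ n) x u"
            "annulus_deriv (inv f ^^ n) x w" for u w]
        by (simp only: inverse) simp
      \<comment> \<open>The forward derivative is taken at the base point
        \<open>(inv f ^^ n) x\<close>, which moves with \<open>n\<close> along the curve; the growth
        bound applies because it is uniform on \<gamma>.\<close>
      have "norm (annulus_deriv (inv f ^^ n) x) \<le> norm (annulus_deriv (f ^^ n) ((inv f ^^ n) x))" for n
        by (rule norm_right_inverse_le[OF sympl_n inverse])
      then show "\<exists>K. \<forall>n. norm (annulus_deriv (inv f ^^ n) x) \<le> K * exp (\<epsilon> * real n)" if "0 < \<epsilon>" for \<epsilon>
        using growth[OF that] inv_in[OF x] by (meson order_trans)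
    qed
  qed
  have "closed \<gamma>"
    using assms(3) unfolding essential_curve_def by (metis closed_simple_path_image)
  then have "\<gamma> \<in> events" using assms(7) by simp
  moreover have "prob \<gamma> = 1" using assms(9) by (simp add: measure_def)
  ultimately have "AE x in \<mu>. x \<in> \<gamma>" by (simp add: AE_in_set_eq_1)
  then show ?thesis by (rule AE_mp) (use zero in auto)
qed

end
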